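(* Let $\alpha,\beta,\gamma\in\mathbb{R}$ be three angles with $\sin(\beta-\gamma)\neq 0$, let $I\subseteq\{1,2\}\times\mathbb{N}_0$, let $Q\in L^2([0,1],\mathbb{R})$, and let $\omega_{i,n}>0$ for $(i,n)\in I$. For $q\in L^2([0,1],\mathbb{R})$ let $$G(q)=\sum_{(i,n)\in I}\omega_{i,n}\,(\lambda_{q,i,n}-\lambda_{Q,i,n})^2 .$$ If $I$ is finite or $(n\,\omega_{i,n})_{(i,n)\in I}$ is summable, then the functional $G$ has no local minima at $q$ with $G(q)>0$, i.e. for every $q\in L^2([0,1],\mathbb{R})$, $$\dot G[h](q)=0\ \text{ for all } h\in H^1[0,1]\quad\Longleftrightarrow\quad G(q)=0 .$$
   Context: $\mathbb{N}_0=\{0,1,2,\dots\}$. For a real potential $q\in L^2([0,1],\mathbb{R})$ consider the Sturm-Liouville equation $-u''+q(x)u=\lambda u$ on $[0,1]$. For angles $\alpha,\beta$, the boundary conditions $(\alpha\beta)$ are $$u(0)\cos\alpha+u'(0)\sin\alpha=0,\qquad u(1)\cos\beta+u'(1)\sin\beta=0,$$ and $(\alpha\gamma)$ denotes the same conditions with $\beta$ replaced by $\gamma$. For $n\in\mathbb{N}_0$, $\lambda_{q,1,n}$ denotes the $n$-th eigenvalue (in increasing order, starting with $n=0$) of this equation with boundary conditions $(\alpha\beta)$, and $\lambda_{q,2,n}$ the $n$-th eigenvalue with boundary conditions $(\alpha\gamma)$; the numbers $\lambda_{Q,i,n}$ are the corresponding eigenvalues for the potential $Q$. $\dot G[h](q)$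 denotes the derivative of $G$ at $q$ in direction $h$. $H^1[0,1]$ is the real Sobolev space of functions in $L^2$ with distributional derivative in $L^2$. *)

theory Defs
  imports "HOL-Analysis.Analysis"
begin

text \<open>
  Elements of \<open>L\<^sup>2([0,1],\<real>)\<close> are represented by functions \<^typ>\<open>real \<Rightarrow> real\<close>, whose values
  outside the unit interval are irrelevant. Nothing below distinguishes functions that agree
  almost everywhere on the unit interval.
\<close>

abbreviation leb01 :: "real measure" where
  "leb01 \<equiv> lebesgue_on {0..1}"

definition L2 :: "(real \<Rightarrow> real) set" where
  "L2 = {f. f \<in> borel_measurable leb01 \<and> integrable leb01 (\<lambda>x. (f x)\<^sup>2)}"

definition L2_dist :: "(real \<Rightarrow> real) \<Rightarrow> (real \<Rightarrow> real) \<Rightarrow> real" where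
  "L2_dist f g = sqrt (LINT x|leb01. (f x - g x)\<^sup>2)"

text \<open>
  The space of smooth functions with compact support in the open interval \<open>(0,1)\<close>; compactness
  is automatic, since the support is closed by definition and contained in a bounded set.
\<close>

definition test_functions :: "(real \<Rightarrow> real) set" where
  "test_functions = {\<phi>. (\<forall>k x. (deriv ^^ k) \<phi> differentiable (at x)) \<and>
                        closure {x. \<phi> x \<noteq> 0} \<subseteq> {0<..<1}}"

definition weak_deriv :: "(real \<Rightarrow> real) \<Rightarrow> (real \<Rightarrow> real) \<Rightarrow> bool" where
  "weak_deriv h g \<longleftrightarrow>
     (\<forall>\<phi>\<in>test_functions. (LINT x|leb01. h x * deriv \<phi> x) = - (LINT x|leb01. g x * \<phi> x))"

definition H1 :: "(real \<Rightarrow> real) set" where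
  "H1 = {h \<in> L2. \<exists>g\<in>L2. weak_deriv h g}"

text \<open>
  \<open>u\<close> solves \<open>-u'' + q u = \<mu> u\<close> on the unit interval, with first derivative \<open>v\<close>: the function
  \<open>v\<close> is absolutely continuous, that is, the indefinite Lebesgue integral of an integrable
  \<open>w = u''\<close>, and the equation holds almost everywhere. The derivatives at the endpoints are
  one-sided.
\<close>

definition SL_solution ::
  "(real \<Rightarrow> real) \<Rightarrow> real \<Rightarrow> (real \<Rightarrow> real) \<Rightarrow> (real \<Rightarrow> real) \<Rightarrow> bool" where
  "SL_solution q \<mu> u v \<longleftrightarrow>
     (\<forall>x\<in>{0..1}. (u has_real_derivative v x) (at x within {0..1})) \<and>
     (\<exists>w. integrable leb01 w \<and>
          (\<forall>x\<in>{0..1}. v x = v 0 + (LINT t|lebesgue_on {0..x}. w t)) \<and>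
          (AE x in leb01. - w x + q x * u x = \<mu> * u x))"

definition SL_spectrum :: "(real \<Rightarrow> real) \<Rightarrow> real \<Rightarrow> real \<Rightarrow> real set" where
  "SL_spectrum q \<alpha> \<beta> =
     {\<mu>. \<exists>u v. SL_solution q \<mu> u v \<and> (\<exists>x\<in>{0..1}. u x \<noteq> 0) \<and>
               u 0 * cos \<alpha> + v 0 * sin \<alpha> = 0 \<and>
               u 1 * cos \<beta> + v 1 * sin \<beta> = 0}"

text \<open>
  The problem is self-adjoint with separated boundary conditions, so all eigenvalues are real
  and simple, and the spectrum is discrete and bounded below. Hence the \<open>n\<close>-th eigenvalue,
  counted from \<open>0\<close>, is the one that has exactly \<open>n\<close> eigenvalues below it.
\<close>

definition SL_eigenvalue :: "(real \<Rightarrow> real) \<Rightarrow> real \<Rightarrow> real \<Rightarrow> nat \<Rightarrow> real" where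
  "SL_eigenvalue q \<alpha> \<beta> n =
     (THE \<mu>. \<mu> \<in> SL_spectrum q \<alpha> \<beta> \<and>
             finite {\<nu> \<in> SL_spectrum q \<alpha> \<beta>. \<nu> < \<mu>} \<and>
             card {\<nu> \<in> SL_spectrum q \<alpha> \<beta>. \<nu> < \<mu>} = n)"

definition eigval :: "real \<Rightarrow> real \<Rightarrow> real \<Rightarrow> (real \<Rightarrow> real) \<Rightarrow> nat \<Rightarrow> nat \<Rightarrow> real" where
  "eigval \<alpha> \<beta> \<gamma> q i n = SL_eigenvalue q \<alpha> (if i = 1 then \<beta> else \<gamma>) n"

definition G_functional ::
  "real \<Rightarrow> real \<Rightarrow> real \<Rightarrow> (nat \<times> nat) set \<Rightarrow> (nat \<Rightarrow> nat \<Rightarrow> real) \<Rightarrow>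
   (real \<Rightarrow> real) \<Rightarrow> (real \<Rightarrow> real) \<Rightarrow> real" where
  "G_functional \<alpha> \<beta> \<gamma> I \<omega> Q q =
     (\<Sum>\<^sub>\<infinity>(i, n)\<in>I. \<omega> i n * (eigval \<alpha> \<beta> \<gamma> q i n - eigval \<alpha> \<beta> \<gamma> Q i n)\<^sup>2)"

text \<open>The two-sided derivative of \<open>F\<close> at \<open>q\<close> in direction \<open>h\<close> exists and equals \<open>D\<close>.\<close>

definition has_dir_derivative ::
  "((real \<Rightarrow> real) \<Rightarrow> real) \<Rightarrow> (real \<Rightarrow> real) \<Rightarrow> (real \<Rightarrow> real) \<Rightarrow> real \<Rightarrow> bool" where
  "has_dir_derivative F q h D \<longleftrightarrow>
     ((\<lambda>t. F (\<lambda>x. q x + t * h x)) has_real_derivative D) (at 0)"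

definition L2_local_min :: "((real \<Rightarrow> real) \<Rightarrow> real) \<Rightarrow> (real \<Rightarrow> real) \<Rightarrow> bool" where
  "L2_local_min F q \<longleftrightarrow>
     q \<in> L2 \<and> (\<exists>\<epsilon>>0. \<forall>p\<in>L2. L2_dist p q < \<epsilon> \<longrightarrow> F q \<le> F p)"

end

theory Submission
  imports Defs
begin

text \<open>
  If \<open>y\<close> is an eigenfunction for the eigenvalue \<open>\<lambda>\<^sub>n(q)\<close>, then \<open>\<lambda>\<^sub>n(q + t h)\<close> has at \<open>t = 0\<close> the
  derivative \<open>\<integral>h y\<^sup>2 / \<integral>y\<^sup>2\<close>, and \<open>y\<^sup>2 / \<integral>y\<^sup>2\<close> is bounded uniformly in \<open>n\<close>. Hence eigenvalues move
  with a speed bounded independently of \<open>n\<close>, the functional can be differentiated term by term,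
  and its derivative in direction \<open>h\<close> is \<open>\<Sum> c\<^bsub>i,n\<^esub> \<integral>h y\<^bsub>i,n\<^esub>\<^sup>2 / \<integral>y\<^bsub>i,n\<^esub>\<^sup>2\<close> where
  \<open>c\<^bsub>i,n\<^esub> = 2 \<omega>\<^bsub>i,n\<^esub> (\<lambda>\<^bsub>q,i,n\<^esub> - \<lambda>\<^bsub>Q,i,n\<^esub>)\<close>. A local minimum is a critical point, so everything
  follows once the vanishing of this sum for all \<open>h\<close> forces all \<open>c\<^bsub>i,n\<^esub>\<close> to vanish, that is, once the
  normalized squares of the eigenfunctions of both problems together are linearly independent
  even with respect to infinite sums.

  Independence is proved with a biorthogonal family (\<open>biorthogonal_direction\<close>,
  \<open>gradients_independent\<close>). Let \<open>z\<^sub>1\<close> be the eigenfunction with index \<open>(j,m)\<close> and eigenvalue \<open>\<mu>\<close>, and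
  let \<open>z\<^sub>2\<close> solve the equation for the same \<open>\<mu>\<close> and satisfy at \<open>1\<close> the boundary condition of the
  other problem. For an eigenfunction \<open>y\<close> with eigenvalue \<open>\<lambda>\<close>,
  \<open>2 \<integral>y\<^sup>2 (z\<^sub>1 z\<^sub>2)' = [y\<^sup>2 z\<^sub>1 z\<^sub>2] + \<integral>(y\<^sup>2 (z\<^sub>1 z\<^sub>2)' - (y\<^sup>2)' z\<^sub>1 z\<^sub>2)\<close>.
  If \<open>\<lambda> \<noteq> \<mu>\<close>, the last integrand is the derivative of \<open>W(y,z\<^sub>1) W(y,z\<^sub>2) / (\<lambda> - \<mu>)\<close>, where
  \<open>W(y,z) = y z' - y' z\<close>. One factor vanishes at \<open>0\<close>, where \<open>y\<close> and \<open>z\<^sub>1\<close> share a boundary condition,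
  and one at \<open>1\<close>, where \<open>y\<close> shares its boundary condition with \<open>z\<^sub>1\<close> or with \<open>z\<^sub>2\<close>. If \<open>y = z\<^sub>1\<close>, the
  integrand is \<open>y\<^sup>2\<close> times the nonzero constant \<open>W(z\<^sub>1,z\<^sub>2)\<close>. Up to boundary terms the direction
  \<open>(z\<^sub>1 z\<^sub>2)'\<close> therefore detects only \<open>c\<^bsub>j,m\<^esub>\<close>. The boundary terms contribute multiples of
  \<open>\<Sum> c\<^bsub>i,n\<^esub> y\<^bsub>i,n\<^esub>(s)\<^sup>2 / \<integral>y\<^bsub>i,n\<^esub>\<^sup>2\<close> for \<open>s = 0, 1\<close>, and these sums vanish because they are the limits
  of the derivatives in the directions \<open>(k+1) (1-x)\<^sup>k\<close> and \<open>(k+1) x\<^sup>k\<close>, which concentrate at \<open>s\<close>.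

  The spectral theory rests on one substitution. With \<open>\<sigma>(x) = \<integral>\<^sub>0\<^sup>x q\<close> and the quasi-derivative
  \<open>p = u' - \<sigma> u\<close>, the equation \<open>-u'' + q u = \<lambda> u\<close> becomes the system \<open>u' = p + \<sigma> u\<close>,
  \<open>p' = -\<lambda> u - \<sigma> (p + \<sigma> u)\<close> with continuous coefficients, so that all solutions are continuously
  differentiable and classical calculus applies. Solutions with fixed data at \<open>0\<close> depend continuously
  on \<open>\<lambda>\<close> and on the coupling \<open>t\<close> of the potential \<open>q + t h\<close>. The planar curve \<open>u' + \<i> u\<close> never
  vanishes; its phase \<open>\<Theta>\<close> at \<open>x = 1\<close> (the Pruefer angle) can be chosen continuously, increases
  strictly in \<open>\<lambda>\<close>, and is unbounded. The \<open>n\<close>-th eigenvalue is the parameter at which the phase reaches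
  the \<open>n\<close>-th admissible multiple of \<open>\<pi>\<close>, counted from a first one that does not depend on \<open>t\<close>; this
  yields continuity in \<open>t\<close>, and Wronskians of solutions for different \<open>t\<close> yield the derivative.
\<close>

section \<open>Calculus and linear differential equations on the unit interval\<close>

lemma continuous_on_unit_interval_bounded:
  fixes f :: "real \<Rightarrow> 'a::real_normed_vector"
  assumes "continuous_on {0..1} f"
  shows "\<exists>M\<ge>0. \<forall>x\<in>{0..1}. norm (f x) \<le> M"
  using compact_imp_bounded[OF compact_continuous_image[OF assms compact_Icc]]
  unfolding bounded_pos by (auto intro: less_imp_le)

lemma gronwall_le:
  fixes E E' :: "real \<Rightarrow> real"
  assumes der: "\<And>x. x \<in> {0..1} \<Longrightarrow> (E has_real_derivative E' x) (at x within {0..1})"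
    and le: "\<And>x. x \<in> {0..1} \<Longrightarrow> E' x \<le> K * E x"
    and s: "0 \<le> s" "s \<le> x" "x \<le> 1"
  shows "E x \<le> exp (K * (x - s)) * E s"
proof -
  define F where "F = (\<lambda>x. exp (- K * x) * E x)"
  have dF: "(F has_real_derivative exp (- K * x) * (E' x - K * E x)) (at x within {0..1})"
    if "x \<in> {0..1}" for x
    unfolding F_def by (rule derivative_eq_intros der that refl | simp add: algebra_simps)+
  have "F x \<le> F s"
  proof (rule DERIV_nonpos_imp_decreasing_open[OF s(2)])
    fix z assume z: "s < z" "z < x"
    then have "z \<in> {0..1}" using s by auto
    from dF[OF this] have "(F has_real_derivative exp (- K * z) * (E' z - K * E z)) (at z)"
      using z s by (simp add: at_within_Icc_at)
    moreover have "exp (- K * z) * (E' z - K * E z) \<le> 0"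
      using le[OF \<open>z \<in> {0..1}\<close>] by (simp add: mult_le_0_iff)
    ultimately show "\<exists>y. (F has_real_derivative y) (at z) \<and> y \<le> 0" by blast
  next
    have "continuous_on {0..1} F"
      by (rule DERIV_continuous_on) (use dF in blast)
    then show "continuous_on {s..x} F" by (rule continuous_on_subset) (use s in auto)
  qed
  then have "exp (K * x) * F x \<le> exp (K * x) * F s" by simp
  then show ?thesis
    unfolding F_def by (simp add: algebra_simps exp_minus exp_diff divide_simps exp_add)
qed

lemma has_real_derivative_reflect01:
  fixes f f' :: "real \<Rightarrow> real"
  assumes f: "\<And>x. x \<in> {0..1} \<Longrightarrow> (f has_real_derivative f' x) (at x within {0..1})" and x: "x \<in> {0..1}"
  shows "((\<lambda>x. f (1 - x)) has_real_derivative - f' (1 - x)) (at x within {0..1})"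
proof -
  have im: "(\<lambda>x. 1 - x) ` {0..1::real} = {0..1}"
    by (auto simp: image_iff intro: bexI[of _ "1 - x" for x])
  have "((\<lambda>x. 1 - x) has_real_derivative - 1) (at x within {0..1})"
    by (rule derivative_eq_intros refl | simp)+
  moreover have "(f has_real_derivative f' (1 - x)) (at (1 - x) within (\<lambda>x. 1 - x) ` {0..1})"
    unfolding im using f x by simp
  ultimately show ?thesis
    using DERIV_image_chain[of f "f' (1 - x)" "\<lambda>x. 1 - x" x "{0..1}" "-1"] by (simp add: o_def)
qed

lemma gronwall_abs:
  fixes E E' :: "real \<Rightarrow> real"
  assumes der: "\<And>x. x \<in> {0..1} \<Longrightarrow> (E has_real_derivative E' x) (at x within {0..1})"
    and le: "\<And>x. x \<in> {0..1} \<Longrightarrow> \<bar>E' x\<bar> \<le> K * E x"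
    and K: "K \<ge> 0" and E: "\<And>x. x \<in> {0..1} \<Longrightarrow> E x \<ge> 0"
    and s: "s \<in> {0..1}" "x \<in> {0..1}"
  shows "E x \<le> exp K * E s"
proof (cases "s \<le> x")
  case True
  have "E x \<le> exp (K * (x - s)) * E s"
    by (rule gronwall_le[OF der]) (use s True le in \<open>force+\<close>)
  also have "\<dots> \<le> exp K * E s"
    using s True K E[OF s(1)] by (intro mult_right_mono) (auto intro: mult_left_le)
  finally show ?thesis .
next
  case False
  have "E (1 - (1 - x)) \<le> exp (K * ((1 - x) - (1 - s))) * E (1 - (1 - s))"
  proof (rule gronwall_le[where E = "\<lambda>x. E (1 - x)" and E' = "\<lambda>x. - E' (1 - x)"])
    fix z :: real assume z: "z \<in> {0..1}"
    show "((\<lambda>x. E (1 - x)) has_real_derivative - E' (1 - z)) (at z within {0..1})"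
      by (rule has_real_derivative_reflect01[OF der z])
    show "- E' (1 - z) \<le> K * E (1 - z)" using le[of "1 - z"] z by auto
  qed (use s False in auto)
  then have "E x \<le> exp (K * (s - x)) * E s" by simp
  also have "\<dots> \<le> exp K * E s"
    using s False K E[OF s(1)] by (intro mult_right_mono) (auto intro: mult_left_le)
  finally show ?thesis .
qed

lemma ftc_subinterval:
  fixes f f' :: "real \<Rightarrow> real"
  assumes "\<And>x. x \<in> {0..1} \<Longrightarrow> (f has_real_derivative f' x) (at x within {0..1})"
    and "0 \<le> a" "a \<le> b" "b \<le> 1"
  shows "(f' has_integral (f b - f a)) {a..b}"
proof (rule fundamental_theorem_of_calculus)
  fix z assume "z \<in> {a..b}"
  then have "(f has_real_derivative f' z) (at z within {0..1})" using assms by auto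
  then show "(f has_vector_derivative f' z) (at z within {a..b})"
    unfolding has_real_derivative_iff_has_vector_derivative
    by (rule has_vector_derivative_within_subset) (use assms in auto)
qed (use assms in auto)

lemma ftc01:
  fixes f f' :: "real \<Rightarrow> real"
  assumes "\<And>x. x \<in> {0..1} \<Longrightarrow> (f has_real_derivative f' x) (at x within {0..1})"
    and "x \<in> {0..1}"
  shows "(f' has_integral (f x - f 0)) {0..x}"
  using assms(2) by (intro ftc_subinterval[OF assms(1)]) auto

lemma absolutely_integrable_times_continuous:
  fixes q u :: "real \<Rightarrow> real"
  assumes "q absolutely_integrable_on {0..1}" "continuous_on {0..1} u"
  shows "(\<lambda>x. q x * u x) absolutely_integrable_on {0..1}"
proof -
  have "(\<lambda>x. u x * q x) absolutely_integrable_on {0..1}"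
    using assms by (intro absolutely_integrable_bounded_measurable_product_real
        continuous_imp_measurable_on_sets_lebesgue compact_imp_bounded compact_continuous_image) auto
  then show ?thesis by (simp add: mult.commute)
qed

lemma continuous_on_indefinite_integral:
  fixes q :: "real \<Rightarrow> real"
  assumes "q absolutely_integrable_on {0..1}"
  shows "continuous_on {0..1} (\<lambda>x. integral {0..x} q)"
  by (intro indefinite_integral_continuous_1 set_lebesgue_integral_eq_integral(1) assms)

lemmas integral_abs_bound_integral = integral_norm_bound_integral[where 'a = real, unfolded real_norm_def]

lemma integral_split01:
  fixes f :: "real \<Rightarrow> real"
  assumes "f integrable_on {0..1}" "0 \<le> a" "a \<le> b" "b \<le> 1"
  shows "integral {a..b} f = integral {0..b} f - integral {0..a} f"
proof -
  have "f integrable_on {0..b}" by (rule integrable_on_subinterval[OF assms(1)]) (use assms in auto)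
  from Henstock_Kurzweil_Integration.integral_combine[OF assms(2,3) this] show ?thesis by simp
qed

text \<open>
  The product rule for an absolutely continuous and a continuously differentiable factor. The
  difference \<open>F\<close> of both sides satisfies \<open>\<bar>F b - F a\<bar> \<le> 2 V \<bar>b - a\<bar> \<integral>\<^sub>a\<^sup>b \<bar>q\<bar>\<close>, where \<open>V\<close> bounds \<open>v\<close>. Since the
  integral tends to zero with \<open>b - a\<close>, \<open>F\<close> has derivative zero at every point, not only almost everywhere.
\<close>

lemma indefinite_integral_product_rule:
  fixes q u v :: "real \<Rightarrow> real"
  assumes q: "q absolutely_integrable_on {0..1}"
    and u: "\<And>x. x \<in> {0..1} \<Longrightarrow> (u has_real_derivative v x) (at x within {0..1})"
    and v: "continuous_on {0..1} v"
    and x: "x \<in> {0..1}"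
  shows "integral {0..x} (\<lambda>s. q s * u s)
       = integral {0..x} q * u x - integral {0..x} (\<lambda>s. integral {0..s} q * v s)"
proof -
  define \<sigma> where "\<sigma> = (\<lambda>x. integral {0..x} q)"
  define N where "N = (\<lambda>x. integral {0..x} (\<lambda>s. \<bar>q s\<bar>))"
  define F where "F = (\<lambda>x. integral {0..x} (\<lambda>s. q s * u s) - \<sigma> x * u x + integral {0..x} (\<lambda>s. \<sigma> s * v s))"
  have uc: "continuous_on {0..1} u" by (rule DERIV_continuous_on) (use u in blast)
  have qa: "(\<lambda>s. \<bar>q s\<bar>) absolutely_integrable_on {0..1}"
    using absolutely_integrable_norm[OF q] by (simp add: o_def)
  have \<sigma>c: "continuous_on {0..1} \<sigma>" unfolding \<sigma>_def by (rule continuous_on_indefinite_integral[OF q])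
  have Nc: "continuous_on {0..1} N" unfolding N_def by (rule continuous_on_indefinite_integral[OF qa])
  obtain V where V: "\<And>x. x \<in> {0..1} \<Longrightarrow> \<bar>v x\<bar> \<le> V"
    using continuous_on_unit_interval_bounded[OF v] unfolding real_norm_def by blast
  have V0: "V \<ge> 0" using V[of 0] by auto
  have lip: "\<bar>u a - u b\<bar> \<le> V * \<bar>a - b\<bar>" if "a \<in> {0..1}" "b \<in> {0..1}" for a b
    using field_differentiable_bound[of "{0..1}" u v V a b] u V that by auto
  note ai = set_lebesgue_integral_eq_integral(1)
  have iqu: "(\<lambda>s. q s * u s) integrable_on {0..1}" by (intro ai absolutely_integrable_times_continuous q uc)
  have iq: "q integrable_on {0..1}" by (rule ai[OF q])
  have ia: "(\<lambda>s. \<bar>q s\<bar>) integrable_on {0..1}" by (rule ai[OF qa])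
  have isv: "(\<lambda>s. \<sigma> s * v s) integrable_on {0..1}"
    by (intro integrable_continuous_real continuous_intros \<sigma>c v)
  have iv: "v integrable_on {0..1}" by (intro integrable_continuous_real v)
  have bound1: "\<bar>F b - F a\<bar> \<le> 2 * V * (b - a) * \<bar>N b - N a\<bar>" if ab: "0 \<le> a" "a \<le> b" "b \<le> 1" for a b
  proof -
    have sub: "f integrable_on {a..b}" if "f integrable_on {0..1}" for f :: "real \<Rightarrow> real"
      by (rule integrable_on_subinterval[OF that]) (use ab in auto)
    have Nd: "N b - N a = integral {a..b} (\<lambda>s. \<bar>q s\<bar>)"
      unfolding N_def using integral_split01[OF ia ab] by simp
    have Nn: "N b - N a \<ge> 0" unfolding Nd by (intro Henstock_Kurzweil_Integration.integral_nonneg sub ia) auto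
    have e1: "integral {a..b} (\<lambda>s. q s * (u s - u b)) = integral {a..b} (\<lambda>s. q s * u s) - integral {a..b} q * u b"
      by (subst right_diff_distrib, subst Henstock_Kurzweil_Integration.integral_diff) (auto intro!: sub iqu integrable_on_mult_left iq)
    have "(v has_integral (u b - u a)) {a..b}" by (rule ftc_subinterval[OF u ab])
    then have iva: "integral {a..b} v = u b - u a" by (rule integral_unique)
    have e2: "integral {a..b} (\<lambda>s. (\<sigma> s - \<sigma> a) * v s) = integral {a..b} (\<lambda>s. \<sigma> s * v s) - \<sigma> a * (u b - u a)"
      by (subst left_diff_distrib, subst Henstock_Kurzweil_Integration.integral_diff) (auto intro!: sub isv integrable_on_mult_right iv simp: iva)
    have "F b - F a = integral {a..b} (\<lambda>s. q s * (u s - u b)) + integral {a..b} (\<lambda>s. (\<sigma> s - \<sigma> a) * v s)"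
      unfolding e1 e2 F_def integral_split01[OF iqu ab] integral_split01[OF isv ab] integral_split01[OF iq ab]
      by (simp add: \<sigma>_def algebra_simps)
    moreover have "\<bar>integral {a..b} (\<lambda>s. q s * (u s - u b))\<bar> \<le> integral {a..b} (\<lambda>s. V * (b - a) * \<bar>q s\<bar>)"
    proof (rule integral_abs_bound_integral)
      have "(\<lambda>s. q s * (u s - u b)) integrable_on {0..1}"
        by (intro ai absolutely_integrable_times_continuous q continuous_intros uc)
      then show "(\<lambda>s. q s * (u s - u b)) integrable_on {a..b}" by (rule sub)
      show "(\<lambda>s. V * (b - a) * \<bar>q s\<bar>) integrable_on {a..b}" by (intro integrable_on_mult_right sub ia)
      fix s assume s: "s \<in> {a..b}"
      have "\<bar>u s - u b\<bar> \<le> V * \<bar>s - b\<bar>" by (rule lip) (use s ab in auto)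
      also have "\<dots> \<le> V * (b - a)" by (rule mult_left_mono) (use s V0 in auto)
      finally have "\<bar>u s - u b\<bar> * \<bar>q s\<bar> \<le> V * (b - a) * \<bar>q s\<bar>" by (rule mult_right_mono) auto
      then show "\<bar>q s * (u s - u b)\<bar> \<le> V * (b - a) * \<bar>q s\<bar>" by (simp add: abs_mult mult.commute)
    qed
    moreover have "\<bar>integral {a..b} (\<lambda>s. (\<sigma> s - \<sigma> a) * v s)\<bar> \<le> integral {a..b} (\<lambda>s. (N b - N a) * V)"
    proof (rule integral_abs_bound_integral)
      have "continuous_on {0..1} (\<lambda>s. (\<sigma> s - \<sigma> a) * v s)" by (intro continuous_intros \<sigma>c v)
      then show "(\<lambda>s. (\<sigma> s - \<sigma> a) * v s) integrable_on {a..b}"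
        by (intro sub integrable_continuous_real)
      fix s assume s: "s \<in> {a..b}"
      have as: "0 \<le> a" "a \<le> s" "s \<le> 1" and sb: "0 \<le> s" "s \<le> b" "b \<le> 1" using s ab by auto
      have "\<bar>\<sigma> s - \<sigma> a\<bar> = \<bar>integral {a..s} q\<bar>" using integral_split01[OF iq as] by (simp add: \<sigma>_def)
      also have "\<dots> \<le> integral {a..s} (\<lambda>s. \<bar>q s\<bar>)"
        by (rule integral_abs_bound_integral)
           (use as in \<open>auto intro!: integrable_on_subinterval[OF iq] integrable_on_subinterval[OF ia]\<close>)
      also have "\<dots> = N s - N a" using integral_split01[OF ia as] by (simp add: N_def)
      also have "\<dots> \<le> N b - N a"
      proof -
        have "N b - N s = integral {s..b} (\<lambda>s. \<bar>q s\<bar>)" using integral_split01[OF ia sb] by (simp add: N_def)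
        also have "\<dots> \<ge> 0" by (intro Henstock_Kurzweil_Integration.integral_nonneg integrable_on_subinterval[OF ia]) (use sb in auto)
        finally show ?thesis by simp
      qed
      finally have "\<bar>\<sigma> s - \<sigma> a\<bar> \<le> N b - N a" .
      moreover have "\<bar>v s\<bar> \<le> V" by (rule V) (use as in auto)
      ultimately show "\<bar>(\<sigma> s - \<sigma> a) * v s\<bar> \<le> (N b - N a) * V"
        unfolding abs_mult using Nn by (intro mult_mono) auto
    qed auto
    ultimately have "\<bar>F b - F a\<bar> \<le> V * (b - a) * (N b - N a) + (N b - N a) * V * (b - a)"
      using ab Nd abs_triangle_ineq[of "integral {a..b} (\<lambda>s. q s * (u s - u b))"
          "integral {a..b} (\<lambda>s. (\<sigma> s - \<sigma> a) * v s)"]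
      by (simp add: mult_ac)
    then show ?thesis using Nn by (simp add: algebra_simps)
  qed
  have bound: "\<bar>F b - F a\<bar> \<le> 2 * V * \<bar>b - a\<bar> * \<bar>N b - N a\<bar>" if "a \<in> {0..1}" "b \<in> {0..1}" for a b
    using bound1[of a b] bound1[of b a] that by (cases "a \<le> b") (auto simp: abs_minus_commute)
  have "(F has_real_derivative 0) (at x within {0..1})" if x: "x \<in> {0..1}" for x
    unfolding has_field_derivative_iff
  proof (rule Lim_null_comparison)
    show "\<forall>\<^sub>F y in at x within {0..1}. norm ((F y - F x) / (y - x)) \<le> 2 * V * \<bar>N y - N x\<bar>"
      unfolding eventually_at
    proof (intro exI[of _ 1] conjI ballI impI)
      fix y :: real assume y: "y \<in> {0..1}" "y \<noteq> x \<and> dist y x < 1"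
      then show "norm ((F y - F x) / (y - x)) \<le> 2 * V * \<bar>N y - N x\<bar>"
        using bound[OF x y(1)] by (simp add: divide_simps abs_divide mult_ac)
    qed simp
    have "((\<lambda>y. N y) \<longlongrightarrow> N x) (at x within {0..1})"
      using Nc x by (simp add: continuous_on_def)
    then have "((\<lambda>y. 2 * V * \<bar>N y - N x\<bar>) \<longlongrightarrow> 2 * V * \<bar>N x - N x\<bar>) (at x within {0..1})"
      by (intro tendsto_intros)
    then show "((\<lambda>y. 2 * V * \<bar>N y - N x\<bar>) \<longlongrightarrow> 0) (at x within {0..1})" by simp
  qed
  then obtain c where c: "\<And>x. x \<in> {0..1} \<Longrightarrow> F x = c"
    using has_field_derivative_zero_constant[of "{0..1}" F] by auto
  have "F 0 = 0" unfolding F_def \<sigma>_def by simp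
  then have "F x = 0" using c[of 0] c[OF x] by simp
  then show ?thesis unfolding F_def \<sigma>_def by simp
qed

text \<open>
  Picard iteration, written as the series of the iterated integrals \<open>Y n\<close>, which are dominated by
  the exponential series of \<open>M\<close>.
\<close>

lemma linear_ode_exists:
  fixes A :: "real \<Rightarrow> 'a::banach \<Rightarrow>\<^sub>L 'a"
  assumes A: "continuous_on {0..1} A"
  shows "\<exists>Y. Y 0 = c \<and> (\<forall>x\<in>{0..1}. (Y has_vector_derivative A x (Y x)) (at x within {0..1}))"
proof -
  obtain M where M: "\<And>x. x \<in> {0..1} \<Longrightarrow> norm (A x) \<le> M"
    using continuous_on_unit_interval_bounded[OF A] by blast
  have M0: "M \<ge> 0" using order_trans[OF norm_ge_zero M[of 0]] by simp
  define Y where "Y = rec_nat (\<lambda>_. c) (\<lambda>_ f x. integral {0..x} (\<lambda>s. A s (f s)))"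
  have Y0: "Y 0 = (\<lambda>_. c)" and YS: "Y (Suc n) = (\<lambda>x. integral {0..x} (\<lambda>s. A s (Y n s)))" for n
    by (simp_all add: Y_def)
  have Acont: "continuous_on {0..1} (\<lambda>s. A s (f s))" if "continuous_on {0..1} f" for f
    by (intro blinfun.continuous_on A that)
  have Ycont: "continuous_on {0..1} (Y n)" for n
  proof (induction n)
    case (Suc n)
    show ?case unfolding YS
      by (intro indefinite_integral_continuous_1 integrable_continuous_real Acont Suc)
  qed (simp add: Y0)
  have Ybound: "norm (Y n x) \<le> norm c * (M * x) ^ n / fact n" if "x \<in> {0..1}" for n x
    using that
  proof (induction n arbitrary: x)
    case (Suc n)
    have "((\<lambda>s. M * (norm c * (M * s) ^ n / fact n)) has_integral
       (norm c * (M * x) ^ Suc n / fact (Suc n) - norm c * (M * 0) ^ Suc n / fact (Suc n))) {0..x}"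
    proof (rule ftc01[OF _ Suc.prems])
      fix z :: real
      have "((\<lambda>x. norm c * (M * x) ^ Suc n / fact (Suc n)) has_real_derivative
          norm c * (real (Suc n) * (M * z) ^ n * M) / fact (Suc n)) (at z within {0..1})"
        by (rule derivative_eq_intros refl | simp)+
      also have "norm c * (real (Suc n) * (M * z) ^ n * M) / fact (Suc n) = M * (norm c * (M * z) ^ n / fact n)"
        by (simp add: field_simps del: of_nat_Suc)
      finally show "((\<lambda>x. norm c * (M * x) ^ Suc n / fact (Suc n)) has_real_derivative
          M * (norm c * (M * z) ^ n / fact n)) (at z within {0..1})" .
    qed
    then have hi: "((\<lambda>s. M * (norm c * (M * s) ^ n / fact n)) has_integral
       (norm c * (M * x) ^ Suc n / fact (Suc n))) {0..x}" by simp
    have "norm (Y (Suc n) x) \<le> integral {0..x} (\<lambda>s. M * (norm c * (M * s) ^ n / fact n))"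
      unfolding YS
    proof (rule integral_norm_bound_integral)
      show "(\<lambda>s. A s (Y n s)) integrable_on {0..x}"
        by (intro integrable_continuous_real continuous_on_subset[OF Acont[OF Ycont]]) (use Suc.prems in auto)
      show "(\<lambda>s. M * (norm c * (M * s) ^ n / fact n)) integrable_on {0..x}" using hi by blast
      fix s assume s: "s \<in> {0..x}"
      then have s1: "s \<in> {0..1}" using Suc.prems by auto
      have "norm (A s (Y n s)) \<le> norm (A s) * norm (Y n s)" by (rule norm_blinfun)
      also have "\<dots> \<le> M * (norm c * (M * s) ^ n / fact n)"
        by (intro mult_mono M Suc.IH s1 M0) auto
      finally show "norm (A s (Y n s)) \<le> M * (norm c * (M * s) ^ n / fact n)" .
    qed
    then show ?case using integral_unique[OF hi] by simp
  qed (simp add: Y0)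
  define S where "S = (\<lambda>n x. \<Sum>k<n. Y k x)"
  define L where "L = (\<lambda>x. suminf (\<lambda>k. Y k x))"
  have ul: "uniform_limit {0..1} S L sequentially"
    unfolding S_def L_def
  proof (rule Weierstrass_m_test)
    fix n and x :: real assume x: "x \<in> {0..1}"
    have "norm (Y n x) \<le> norm c * (M * x) ^ n / fact n" by (rule Ybound[OF x])
    also have "\<dots> \<le> norm c * M ^ n / fact n"
      using x M0 by (intro divide_right_mono mult_left_mono power_mono) (auto intro: mult_left_le)
    finally show "norm (Y n x) \<le> norm c * M ^ n / fact n" .
  next
    have "summable (\<lambda>n. norm c * (inverse (fact n) * M ^ n))" by (intro summable_mult summable_exp)
    then show "summable (\<lambda>n. norm c * M ^ n / fact n)" by (simp add: field_simps)
  qed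
  have Scont: "continuous_on {0..1} (S n)" for n unfolding S_def by (intro continuous_intros Ycont)
  have Lcont: "continuous_on {0..1} L"
    by (rule uniform_limit_theorem[OF _ ul]) (auto simp: Scont)
  have rec: "S (Suc n) x = c + integral {0..x} (\<lambda>s. A s (S n s))" if x: "x \<in> {0..1}" for n x
  proof (induction n)
    case 0 show ?case by (simp add: S_def Y0 blinfun.zero_right)
  next
    case (Suc n)
    have sub: "(\<lambda>s. A s (f s)) integrable_on {0..x}" if "continuous_on {0..1} f" for f
      by (intro integrable_continuous_real continuous_on_subset[OF Acont[OF that]]) (use x in auto)
    have "S (Suc (Suc n)) x = S (Suc n) x + Y (Suc n) x" by (simp add: S_def)
    also have "\<dots> = c + (integral {0..x} (\<lambda>s. A s (S n s)) + integral {0..x} (\<lambda>s. A s (Y n s)))"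
      using Suc by (simp add: YS)
    also have "integral {0..x} (\<lambda>s. A s (S n s)) + integral {0..x} (\<lambda>s. A s (Y n s))
       = integral {0..x} (\<lambda>s. A s (S n s) + A s (Y n s))"
      by (rule Henstock_Kurzweil_Integration.integral_add[symmetric]; intro sub Scont Ycont)
    also have "(\<lambda>s. A s (S n s) + A s (Y n s)) = (\<lambda>s. A s (S (Suc n) s))"
      by (simp add: S_def blinfun.add_right)
    finally show ?case .
  qed
  have Lint: "L x = c + integral {0..x} (\<lambda>s. A s (L s))" if x: "x \<in> {0..1}" for x
  proof -
    have "uniform_limit {0..x} (\<lambda>n s. A s (S n s)) (\<lambda>s. A s (L s)) sequentially"
    proof (rule uniform_limitI)
      fix e :: real assume e: "e > 0"
      then have "e / (M + 1) > 0" using M0 by simp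
      from uniform_limitD[OF ul this]
      show "\<forall>\<^sub>F n in sequentially. \<forall>s\<in>{0..x}. dist (A s (S n s)) (A s (L s)) < e"
      proof eventually_elim
        case (elim n)
        show ?case
        proof
          fix s assume "s \<in> {0..x}"
          then have s: "s \<in> {0..1}" using x by auto
          have "dist (A s (S n s)) (A s (L s)) = norm (A s (S n s - L s))"
            by (simp add: dist_norm blinfun.diff_right)
          also have "\<dots> \<le> norm (A s) * norm (S n s - L s)" by (rule norm_blinfun)
          also have "\<dots> \<le> (M + 1) * norm (S n s - L s)" using M[OF s] by (intro mult_right_mono) auto
          also have "\<dots> < (M + 1) * (e / (M + 1))"
            using elim s M0 by (intro mult_strict_left_mono) (auto simp: dist_norm)
          finally show "dist (A s (S n s)) (A s (L s)) < e" using M0 by simp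
        qed
      qed
    qed
    then obtain II J where IJ: "\<And>n. ((\<lambda>s. A s (S n s)) has_integral II n) {0..x}"
      "((\<lambda>s. A s (L s)) has_integral J) {0..x}" "II \<longlonglongrightarrow> J"
      by (rule uniform_limit_integral)
         (use x in \<open>auto intro!: continuous_on_subset[OF Acont[OF Scont]]\<close>)
    have "(\<lambda>n. S (Suc n) x) \<longlonglongrightarrow> L x"
      using tendsto_uniform_limitI[OF ul x] by (rule LIMSEQ_Suc)
    moreover have "(\<lambda>n. S (Suc n) x) \<longlonglongrightarrow> c + J"
      unfolding rec[OF x] using IJ by (auto simp: integral_unique[OF IJ(1)] intro!: tendsto_intros)
    ultimately show ?thesis using LIMSEQ_unique integral_unique[OF IJ(2)] by auto
  qed
  have "(L has_vector_derivative A x (L x)) (at x within {0..1})" if x: "x \<in> {0..1}" for x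
  proof -
    have "((\<lambda>u. c + integral {0..u} (\<lambda>s. A s (L s))) has_vector_derivative 0 + A x (L x)) (at x within {0..1})"
      by (intro has_vector_derivative_add has_vector_derivative_const
            integral_has_vector_derivative Acont Lcont x)
    then show ?thesis
      using has_vector_derivative_transform[OF x, of L] Lint by auto
  qed
  moreover have "L 0 = c" using Lint[of 0] by simp
  ultimately show ?thesis by blast
qed

text \<open>
  The difference \<open>d = Y - Z\<close> solves \<open>d' = A d + (A - B) Z\<close>, so Gronwall's inequality applies to
  \<open>d \<bullet> d + (e N)\<^sup>2\<close>; the added constant absorbs the inhomogeneity.
\<close>

lemma linear_ode_dependence:
  fixes A B :: "real \<Rightarrow> 'a::real_inner \<Rightarrow>\<^sub>L 'a"
  assumes Y: "\<And>x. x \<in> {0..1} \<Longrightarrow> (Y has_vector_derivative A x (Y x)) (at x within {0..1})"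
    and Z: "\<And>x. x \<in> {0..1} \<Longrightarrow> (Z has_vector_derivative B x (Z x)) (at x within {0..1})"
    and init: "Y 0 = Z 0"
    and K: "\<And>x. x \<in> {0..1} \<Longrightarrow> norm (A x) \<le> K"
    and AB: "\<And>x. x \<in> {0..1} \<Longrightarrow> norm (A x - B x) \<le> e"
    and N: "\<And>x. x \<in> {0..1} \<Longrightarrow> norm (Z x) \<le> N"
    and x: "x \<in> {0..1}"
  shows "(norm (Y x - Z x))\<^sup>2 \<le> exp (2 * K + 1) * (e * N)\<^sup>2"
proof -
  have K0: "K \<ge> 0" using order_trans[OF norm_ge_zero K[of 0]] by simp
  define d where "d = (\<lambda>x. Y x - Z x)"
  define d' where "d' = (\<lambda>x. A x (d x) + (A x - B x) (Z x))"
  have d: "(d has_vector_derivative d' x) (at x within {0..1})" if "x \<in> {0..1}" for x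
  proof -
    have "(d has_vector_derivative (A x (Y x) - B x (Z x))) (at x within {0..1})"
      unfolding d_def by (intro has_vector_derivative_diff Y Z that)
    also have "A x (Y x) - B x (Z x) = d' x"
      by (simp add: d'_def d_def blinfun.diff_left blinfun.diff_right)
    finally show ?thesis .
  qed
  define E where "E = (\<lambda>x. d x \<bullet> d x + (e * N)\<^sup>2)"
  have dE: "(E has_real_derivative 2 * (d x \<bullet> d' x)) (at x within {0..1})" if "x \<in> {0..1}" for x
    using has_derivative_inner[OF d[OF that, unfolded has_vector_derivative_def] d[OF that, unfolded has_vector_derivative_def]]
    unfolding E_def has_field_derivative_def
    by (intro has_derivative_eq_rhs[OF has_derivative_add[OF _ has_derivative_const]])
       (assumption, simp add: inner_commute algebra_simps fun_eq_iff)
  have "E x \<le> exp ((2 * K + 1) * (x - 0)) * E 0"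
  proof (rule gronwall_le[OF dE])
    fix x :: real assume x: "x \<in> {0..1}"
    have "norm (d' x) \<le> norm (A x (d x)) + norm ((A x - B x) (Z x))"
      unfolding d'_def by (rule norm_triangle_ineq)
    also have "\<dots> \<le> norm (A x) * norm (d x) + norm (A x - B x) * norm (Z x)"
      by (intro add_mono norm_blinfun)
    also have "\<dots> \<le> K * norm (d x) + e * N"
      using order_trans[OF norm_ge_zero AB[OF x]] by (intro add_mono mult_mono K AB N x K0) auto
    finally have n: "norm (d' x) \<le> K * norm (d x) + e * N" .
    have "d x \<bullet> d' x \<le> norm (d x) * norm (d' x)" by (rule norm_cauchy_schwarz)
    also have "\<dots> \<le> norm (d x) * (K * norm (d x) + e * N)" by (intro mult_left_mono n) auto
    finally have "2 * (d x \<bullet> d' x) \<le> 2 * K * (norm (d x))\<^sup>2 + 2 * norm (d x) * (e * N)"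
      by (simp add: power2_eq_square algebra_simps)
    also have "2 * norm (d x) * (e * N) \<le> (norm (d x))\<^sup>2 + (e * N)\<^sup>2"
      by (rule sum_squares_bound)
    also have "2 * K * (norm (d x))\<^sup>2 + ((norm (d x))\<^sup>2 + (e * N)\<^sup>2) \<le> (2 * K + 1) * E x"
      unfolding E_def power2_norm_eq_inner[symmetric] using K0 by (simp add: algebra_simps)
    finally show "2 * (d x \<bullet> d' x) \<le> (2 * K + 1) * E x" by simp
  qed (use x in auto)
  also have "E 0 = (e * N)\<^sup>2" by (simp add: E_def d_def init)
  also have "exp ((2 * K + 1) * (x - 0)) * (e * N)\<^sup>2 \<le> exp (2 * K + 1) * (e * N)\<^sup>2"
    using x K0 by (intro mult_right_mono) (auto intro: mult_left_le)
  finally show ?thesis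
    unfolding E_def d_def power2_norm_eq_inner by (smt (verit) zero_le_power2)
qed

lemma linear_ode_continuous_param:
  fixes A :: "'p::metric_space \<Rightarrow> real \<Rightarrow> 'a::real_inner \<Rightarrow>\<^sub>L 'a"
  assumes A: "continuous_on (UNIV \<times> {0..1}) (\<lambda>(a, x). A a x)"
    and Y0: "\<And>a. Y a 0 = c"
    and Y: "\<And>a x. x \<in> {0..1} \<Longrightarrow> (Y a has_vector_derivative A a x (Y a x)) (at x within {0..1})"
  shows "continuous_on (UNIV \<times> {0..1}) (\<lambda>(a, x). Y a x)"
proof -
  have Yc: "continuous_on {0..1} (Y a)" for a
    using Y by (meson continuous_on_eq_continuous_within has_vector_derivative_continuous)
  have Ac: "continuous_on {0..1} (A a)" for a
  proof -
    have "continuous_on {0..1} (\<lambda>x. (a, x))" by (intro continuous_intros)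
    from continuous_on_compose2[OF A this] show ?thesis by auto
  qed
  have unif: "\<exists>d>0. \<forall>b x. dist b a < d \<longrightarrow> x \<in> {0..1} \<longrightarrow> dist (Y b x) (Y a x) < \<epsilon>"
    if \<epsilon>: "\<epsilon> > 0" for a \<epsilon>
  proof -
    obtain K where K: "\<And>x. x \<in> {0..1} \<Longrightarrow> norm (A a x) \<le> K"
      using continuous_on_unit_interval_bounded[OF Ac] by blast
    obtain N where N: "\<And>x. x \<in> {0..1} \<Longrightarrow> norm (Y a x) \<le> N"
      using continuous_on_unit_interval_bounded[OF Yc] by blast
    have N0: "N \<ge> 0" using order_trans[OF norm_ge_zero N[of 0]] by simp
    define C where "C = sqrt (exp (2 * (K + 1) + 1))"
    have C: "C > 0" by (simp add: C_def)
    define e where "e = min 1 (\<epsilon> / (2 * C * (N + 1)))"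
    have e: "e > 0" "e \<le> 1" using \<epsilon> C N0 by (auto simp: e_def)
    obtain X0 where X0: "a \<in> X0" "open X0" "\<forall>b\<in>X0 \<inter> UNIV. \<forall>x\<in>{0..1}. dist ((\<lambda>(a, x). A a x) (b, x)) ((\<lambda>(a, x). A a x) (a, x)) \<le> e"
      using continuous_on_prod_compactE[OF A compact_Icc UNIV_I e(1)] by metis
    obtain d where d: "d > 0" "\<And>b. dist b a < d \<Longrightarrow> b \<in> X0" using X0 by (meson open_dist)
    have "dist (Y b x) (Y a x) < \<epsilon>" if b: "dist b a < d" and x: "x \<in> {0..1}" for b x
    proof -
      have AB: "norm (A b x - A a x) \<le> e" if "x \<in> {0..1}" for x
        using X0(3) d(2)[OF b] that by (auto simp: dist_norm)
      have KB: "norm (A b x) \<le> K + 1" if "x \<in> {0..1}" for x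
      proof -
        have "norm (A b x) \<le> norm (A b x - A a x) + norm (A a x)"
          using norm_triangle_ineq[of "A b x - A a x" "A a x"] by simp
        then show ?thesis using AB[OF that] K[OF that] e by linarith
      qed
      have "(norm (Y b x - Y a x))\<^sup>2 \<le> exp (2 * (K + 1) + 1) * (e * N)\<^sup>2"
        using Y0[of a] Y0[of b] by (intro linear_ode_dependence[OF Y Y _ KB AB N x]) auto
      also have "\<dots> = (C * (e * N))\<^sup>2" by (simp add: C_def power_mult_distrib)
      finally have "norm (Y b x - Y a x) \<le> C * (e * N)"
        by (rule power2_le_imp_le) (use C e N0 in auto)
      also have "\<dots> \<le> C * (e * (N + 1))" using C e by (intro mult_left_mono) auto
      also have "\<dots> \<le> C * (\<epsilon> / (2 * C * (N + 1)) * (N + 1))"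
        using C N0 by (intro mult_left_mono mult_right_mono) (auto simp: e_def)
      also have "\<dots> = \<epsilon> / 2"
      proof -
        have "C \<noteq> 0" "N + 1 \<noteq> 0" using C N0 by auto
        then show ?thesis by simp
      qed
      also have "\<dots> < \<epsilon>" using \<epsilon> by simp
      finally show ?thesis by (simp add: dist_norm)
    qed
    then show ?thesis using d(1) by blast
  qed
  show ?thesis
    unfolding continuous_on_iff
  proof (intro ballI allI impI)
    fix ax :: "'p \<times> real" and \<epsilon> :: real
    assume ax: "ax \<in> UNIV \<times> {0..1}" and \<epsilon>: "\<epsilon> > 0"
    obtain a x where [simp]: "ax = (a, x)" by (cases ax)
    have x: "x \<in> {0..1}" using ax by simp
    obtain d1 where d1: "d1 > 0" "\<And>b z. dist b a < d1 \<Longrightarrow> z \<in> {0..1} \<Longrightarrow> dist (Y b z) (Y a z) < \<epsilon> / 2"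
      using unif[of "\<epsilon> / 2" a] \<epsilon> by auto
    obtain d2 where d2: "d2 > 0" "\<And>z. z \<in> {0..1} \<Longrightarrow> dist z x < d2 \<Longrightarrow> dist (Y a z) (Y a x) < \<epsilon> / 2"
      using Yc[of a] x \<epsilon> unfolding continuous_on_iff by (meson half_gt_zero)
    show "\<exists>d>0. \<forall>bz\<in>UNIV \<times> {0..1}. dist bz ax < d \<longrightarrow>
        dist (case bz of (a, x) \<Rightarrow> Y a x) (case ax of (a, x) \<Rightarrow> Y a x) < \<epsilon>"
    proof (intro exI[of _ "min d1 d2"] conjI ballI impI)
      fix bz :: "'p \<times> real" assume bz: "bz \<in> UNIV \<times> {0..1}" "dist bz ax < min d1 d2"
      obtain b z where [simp]: "bz = (b, z)" by (cases bz)
      have "dist b a < d1" "dist z x < d2"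
        using bz dist_fst_le[of bz ax] dist_snd_le[of bz ax] by auto
      then have "dist (Y b z) (Y a z) < \<epsilon> / 2" "dist (Y a z) (Y a x) < \<epsilon> / 2"
        using d1 d2 bz by auto
      then show "dist (case bz of (a, x) \<Rightarrow> Y a x) (case ax of (a, x) \<Rightarrow> Y a x) < \<epsilon>"
        using dist_triangle[of "Y b z" "Y a x" "Y a z"] by simp
    qed (use d1 d2 in auto)
  qed
qed

section \<open>The Sturm-Liouville equation as a system with continuous coefficients\<close>

text \<open>
  Here \<open>\<sigma>\<close> stands for a primitive of the potential and \<open>p\<close> for the quasi-derivative \<open>y' - \<sigma> y\<close>. The
  potential itself does not occur, and no Lebesgue integral is involved.
\<close>

definition sl_system ::
  "(real \<Rightarrow> real) \<Rightarrow> real \<Rightarrow> (real \<Rightarrow> real) \<Rightarrow> (real \<Rightarrow> real) \<Rightarrow> bool" where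
  "sl_system \<sigma> l y p \<longleftrightarrow> (\<forall>x\<in>{0..1}.
     (y has_real_derivative p x + \<sigma> x * y x) (at x within {0..1}) \<and>
     (p has_real_derivative - l * y x - \<sigma> x * (p x + \<sigma> x * y x)) (at x within {0..1}))"

lemma sl_systemD:
  assumes "sl_system \<sigma> l y p" "x \<in> {0..1}"
  shows "(y has_real_derivative p x + \<sigma> x * y x) (at x within {0..1})"
    and "(p has_real_derivative - l * y x - \<sigma> x * (p x + \<sigma> x * y x)) (at x within {0..1})"
  using assms by (auto simp: sl_system_def)

lemma sl_system_continuous:
  assumes "sl_system \<sigma> l y p"
  shows "continuous_on {0..1} y" "continuous_on {0..1} p"
  by (rule DERIV_continuous_on, erule sl_systemD[OF assms])+

lemma sl_system_combination:
  assumes "sl_system \<sigma> l y p" "sl_system \<sigma> l z r"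
  shows "sl_system \<sigma> l (\<lambda>x. a * y x + b * z x) (\<lambda>x. a * p x + b * r x)"
  unfolding sl_system_def
proof (intro ballI conjI)
  fix x :: real assume x: "x \<in> {0..1}"
  show "((\<lambda>x. a * y x + b * z x) has_real_derivative
          a * p x + b * r x + \<sigma> x * (a * y x + b * z x)) (at x within {0..1})"
    by (rule derivative_eq_intros sl_systemD[OF assms(1) x] sl_systemD[OF assms(2) x] refl
        | simp add: algebra_simps)+
  show "((\<lambda>x. a * p x + b * r x) has_real_derivative
          - l * (a * y x + b * z x) - \<sigma> x * (a * p x + b * r x + \<sigma> x * (a * y x + b * z x)))
         (at x within {0..1})"
    by (rule derivative_eq_intros sl_systemD[OF assms(1) x] sl_systemD[OF assms(2) x] refl
        | simp add: algebra_simps)+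
qed

definition sl_matrix :: "real \<Rightarrow> real \<Rightarrow> (real \<times> real) \<Rightarrow>\<^sub>L (real \<times> real)" where
  "sl_matrix s l = Blinfun (\<lambda>w. (snd w, 0)) + s *\<^sub>R Blinfun (\<lambda>w. (fst w, - snd w))
     + (l + s\<^sup>2) *\<^sub>R Blinfun (\<lambda>w. (0, - fst w))"

lemma sl_matrix_apply: "sl_matrix s l (u, v) = (v + s * u, - l * u - s * (v + s * u))"
proof -
  have "bounded_linear (\<lambda>w::real\<times>real. (snd w, 0::real))"
    "bounded_linear (\<lambda>w::real\<times>real. (fst w, - snd w))"
    "bounded_linear (\<lambda>w::real\<times>real. (0::real, - fst w))"
    by (intro bounded_linear_Pair bounded_linear_fst bounded_linear_snd bounded_linear_zero bounded_linear_minus)+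
  then show ?thesis
    unfolding sl_matrix_def
    by (simp add: blinfun.add_left blinfun.scaleR_left bounded_linear_Blinfun_apply
        power2_eq_square algebra_simps)
qed

lemma sl_matrix_continuous:
  assumes "continuous_on S f" "continuous_on S g"
  shows "continuous_on S (\<lambda>x. sl_matrix (f x) (g x))"
  unfolding sl_matrix_def by (intro continuous_intros assms)

lemma sl_system_vector_form:
  "sl_system \<sigma> l (\<lambda>x. fst (Y x)) (\<lambda>x. snd (Y x)) \<longleftrightarrow>
   (\<forall>x\<in>{0..1}. (Y has_vector_derivative sl_matrix (\<sigma> x) l (Y x)) (at x within {0..1}))"
proof -
  have "(Y has_vector_derivative sl_matrix (\<sigma> x) l (Y x)) (at x within {0..1}) \<longleftrightarrow>
     ((\<lambda>x. fst (Y x)) has_real_derivative snd (Y x) + \<sigma> x * fst (Y x)) (at x within {0..1}) \<and>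
     ((\<lambda>x. snd (Y x)) has_real_derivative - l * fst (Y x) - \<sigma> x * (snd (Y x) + \<sigma> x * fst (Y x)))
       (at x within {0..1})" (is "?L \<longleftrightarrow> ?R1 \<and> ?R2") for x
  proof
    have e: "sl_matrix (\<sigma> x) l (Y x) =
       (snd (Y x) + \<sigma> x * fst (Y x), - l * fst (Y x) - \<sigma> x * (snd (Y x) + \<sigma> x * fst (Y x)))"
      using sl_matrix_apply[of "\<sigma> x" l "fst (Y x)" "snd (Y x)"] by simp
    show "?R1 \<and> ?R2" if ?L
      using has_derivative_fst[OF that[unfolded has_vector_derivative_def e]]
        has_derivative_snd[OF that[unfolded has_vector_derivative_def e]]
      by (simp add: has_real_derivative_iff_has_vector_derivative has_vector_derivative_def)
    show ?L if "?R1 \<and> ?R2"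
      using that has_vector_derivative_Pair[of "\<lambda>x. fst (Y x)" _ x "{0..1}" "\<lambda>x. snd (Y x)"]
      unfolding e by (simp add: has_real_derivative_iff_has_vector_derivative)
  qed
  then show ?thesis unfolding sl_system_def by blast
qed

lemma sl_system_exists:
  assumes "continuous_on {0..1} \<sigma>"
  shows "\<exists>y p. y 0 = a \<and> p 0 = b \<and> sl_system \<sigma> l y p"
proof -
  have "continuous_on {0..1} (\<lambda>x. sl_matrix (\<sigma> x) l)"
    by (intro sl_matrix_continuous assms continuous_intros)
  from linear_ode_exists[OF this, of "(a, b)"] obtain Y where Y: "Y 0 = (a, b)"
    "\<forall>x\<in>{0..1}. (Y has_vector_derivative sl_matrix (\<sigma> x) l (Y x)) (at x within {0..1})" by blast
  then have "sl_system \<sigma> l (\<lambda>x. fst (Y x)) (\<lambda>x. snd (Y x))" by (simp add: sl_system_vector_form)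
  then show ?thesis using Y(1) by (intro exI[of _ "\<lambda>x. fst (Y x)"] exI[of _ "\<lambda>x. snd (Y x)"]) auto
qed

text \<open>
  In the energy \<open>p\<^sup>2 + k y\<^sup>2\<close> the large terms \<open>-2 l p y\<close> and \<open>2 k p y\<close> of the derivative nearly cancel if
  \<open>k\<close> is close to \<open>l\<close>. The logarithmic derivative is then bounded independently of \<open>l\<close>, which is the
  source of all bounds that are uniform in the eigenvalue.
\<close>

lemma sl_system_energy:
  assumes sys: "sl_system \<sigma> l y p"
    and M: "\<And>x. x \<in> {0..1} \<Longrightarrow> \<bar>\<sigma> x\<bar> \<le> M"
    and k: "k \<ge> 1" "\<bar>k - l\<bar> \<le> D"
    and sx: "s \<in> {0..1}" "x \<in> {0..1}"
  shows "(p x)\<^sup>2 + k * (y x)\<^sup>2 \<le> exp (2 * M + M\<^sup>2 + D) * ((p s)\<^sup>2 + k * (y s)\<^sup>2)"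
proof (rule gronwall_abs[where E = "\<lambda>x. (p x)\<^sup>2 + k * (y x)\<^sup>2" and E' = "\<lambda>x. 2 * (k - l - (\<sigma> x)\<^sup>2) * (p x * y x) - 2 * \<sigma> x * (p x)\<^sup>2 + 2 * k * \<sigma> x * (y x)\<^sup>2"])
  show "2 * M + M\<^sup>2 + D \<ge> 0" using M[of 0] k by (intro add_nonneg_nonneg) auto
  fix x :: real assume x: "x \<in> {0..1}"
  show "((\<lambda>x. (p x)\<^sup>2 + k * (y x)\<^sup>2) has_real_derivative
     2 * (k - l - (\<sigma> x)\<^sup>2) * (p x * y x) - 2 * \<sigma> x * (p x)\<^sup>2 + 2 * k * \<sigma> x * (y x)\<^sup>2) (at x within {0..1})"
    by (rule derivative_eq_intros sl_systemD[OF sys x] refl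
        | simp add: power2_eq_square algebra_simps)+
  show "0 \<le> (p x)\<^sup>2 + k * (y x)\<^sup>2" using k by simp
  have M0: "M \<ge> 0" using M[OF x] by simp
  have "(y x)\<^sup>2 \<le> k * (y x)\<^sup>2" using mult_right_mono[OF k(1), of "(y x)\<^sup>2"] by simp
  then have py: "2 * \<bar>p x * y x\<bar> \<le> (p x)\<^sup>2 + k * (y x)\<^sup>2"
    using sum_squares_bound[of "\<bar>p x\<bar>" "\<bar>y x\<bar>"] by (simp add: abs_mult mult.assoc)
  have "(\<sigma> x)\<^sup>2 \<le> M\<^sup>2" using M[OF x] M0 by (simp add: abs_le_square_iff[symmetric])
  then have "\<bar>k - l - (\<sigma> x)\<^sup>2\<bar> \<le> D + M\<^sup>2" using k(2) zero_le_power2[of "\<sigma> x"] by linarith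
  then have "\<bar>k - l - (\<sigma> x)\<^sup>2\<bar> * (2 * \<bar>p x * y x\<bar>) \<le> (D + M\<^sup>2) * ((p x)\<^sup>2 + k * (y x)\<^sup>2)"
    using py by (intro mult_mono) auto
  moreover have "\<bar>2 * \<sigma> x * (p x)\<^sup>2\<bar> \<le> 2 * M * (p x)\<^sup>2"
    unfolding abs_mult using M[OF x] by (intro mult_mono) auto
  moreover have "\<bar>2 * k * \<sigma> x * (y x)\<^sup>2\<bar> \<le> 2 * k * M * (y x)\<^sup>2"
    unfolding abs_mult using M[OF x] k(1) M0 by (intro mult_mono) auto
  moreover have "\<bar>2 * (k - l - (\<sigma> x)\<^sup>2) * (p x * y x)\<bar> = \<bar>k - l - (\<sigma> x)\<^sup>2\<bar> * (2 * \<bar>p x * y x\<bar>)"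
    by (simp only: abs_mult abs_numeral mult_ac)
  ultimately have "\<bar>2 * (k - l - (\<sigma> x)\<^sup>2) * (p x * y x) - 2 * \<sigma> x * (p x)\<^sup>2 + 2 * k * \<sigma> x * (y x)\<^sup>2\<bar>
     \<le> (D + M\<^sup>2) * ((p x)\<^sup>2 + k * (y x)\<^sup>2) + 2 * M * (p x)\<^sup>2 + 2 * k * M * (y x)\<^sup>2"
    by linarith
  also have "\<dots> = (2 * M + M\<^sup>2 + D) * ((p x)\<^sup>2 + k * (y x)\<^sup>2)" by (simp add: algebra_simps)
  finally show "\<bar>2 * (k - l - (\<sigma> x)\<^sup>2) * (p x * y x) - 2 * \<sigma> x * (p x)\<^sup>2 + 2 * k * \<sigma> x * (y x)\<^sup>2\<bar>
     \<le> (2 * M + M\<^sup>2 + D) * ((p x)\<^sup>2 + k * (y x)\<^sup>2)" .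
qed (use sx in auto)

lemma sl_system_zero:
  assumes sys: "sl_system \<sigma> l y p" and \<sigma>: "continuous_on {0..1} \<sigma>"
    and s: "s \<in> {0..1}" "y s = 0" "p s = 0" and x: "x \<in> {0..1}"
  shows "y x = 0 \<and> p x = 0"
proof -
  obtain M where M: "\<And>x. x \<in> {0..1} \<Longrightarrow> \<bar>\<sigma> x\<bar> \<le> M"
    using continuous_on_unit_interval_bounded[OF \<sigma>] unfolding real_norm_def by blast
  have "(p x)\<^sup>2 + 1 * (y x)\<^sup>2 \<le> exp (2 * M + M\<^sup>2 + \<bar>1 - l\<bar>) * ((p s)\<^sup>2 + 1 * (y s)\<^sup>2)"
    by (rule sl_system_energy[OF sys M]) (use s x in auto)
  then have "(p x)\<^sup>2 + (y x)\<^sup>2 \<le> 0" using s by simp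
  then show ?thesis by (simp add: sum_power2_le_zero_iff)
qed

lemma sl_system_unique:
  assumes "sl_system \<sigma> l y p" "sl_system \<sigma> l z r" and \<sigma>: "continuous_on {0..1} \<sigma>"
    and "y 0 = z 0" "p 0 = r 0" and x: "x \<in> {0..1}"
  shows "y x = z x \<and> p x = r x"
  using sl_system_zero[OF sl_system_combination[OF assms(1,2), of 1 "-1"] \<sigma>, of 0 x] assms by simp

text \<open>
  The first equation of the system turns \<open>y = 0\<close> into \<open>p = 0\<close>, already at the endpoint \<open>0\<close>.
\<close>

lemma sl_system_nontrivial:
  assumes sys: "sl_system \<sigma> l y p" and init: "y 0 \<noteq> 0 \<or> p 0 \<noteq> 0"
  shows "\<exists>x\<in>{0..1}. y x \<noteq> 0"
proof (rule ccontr)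
  assume "\<not> ?thesis"
  then have z: "y x = 0" if "x \<in> {0..1}" for x using that by blast
  have "((\<lambda>x. 0) has_real_derivative p 0 + \<sigma> 0 * y 0) (at 0 within {0..1})"
    by (rule has_field_derivative_transform_within[OF sl_systemD(1)[OF sys] zero_less_one]) (use z in auto)
  moreover have "((\<lambda>x. 0) has_real_derivative 0) (at 0 within {0..1::real})" by simp
  ultimately have "p 0 + \<sigma> 0 * y 0 = 0"
    by (rule has_field_derivative_unique) (simp add: trivial_limit_within islimpt_Icc)
  then show False using init z[of 0] by simp
qed

text \<open>
  Averaging \<open>f x \<le> f s + \<integral>g\<close> over \<open>s\<close>.
\<close>

lemma le_integral_plus_variation:
  fixes f f' g :: "real \<Rightarrow> real"
  assumes f: "\<And>x. x \<in> {0..1} \<Longrightarrow> (f has_real_derivative f' x) (at x within {0..1})"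
    and le: "\<And>x. x \<in> {0..1} \<Longrightarrow> \<bar>f' x\<bar> \<le> g x" and g: "continuous_on {0..1} g"
    and x: "x \<in> {0..1}"
  shows "f x \<le> integral {0..1} f + integral {0..1} g"
proof -
  have ig: "g integrable_on {0..1}" by (rule integrable_continuous_real[OF g])
  have g0: "g z \<ge> 0" if "z \<in> {0..1}" for z using le[OF that] by simp
  have one: "\<bar>f b - f a\<bar> \<le> integral {0..1} g" if ab: "0 \<le> a" "a \<le> b" "b \<le> 1" for a b
  proof -
    have "(f' has_integral (f b - f a)) {a..b}" by (rule ftc_subinterval[OF f ab])
    then have "f' integrable_on {a..b}" "f b - f a = integral {a..b} f'" by (auto simp: integral_unique)
    moreover have igab: "g integrable_on {a..b}"
      by (rule integrable_on_subinterval[OF ig]) (use ab in auto)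
    ultimately have "\<bar>f b - f a\<bar> \<le> integral {a..b} g"
      using integral_norm_bound_integral[of f' "{a..b}" g] le ab by auto
    also have "\<dots> \<le> integral {0..1} g"
      by (rule integral_subset_le[OF _ igab ig]) (use ab g0 in auto)
    finally show ?thesis .
  qed
  have "f x \<le> f s + integral {0..1} g" if "s \<in> {0..1}" for s
    using one[of s x] one[of x s] x that by (cases "s \<le> x") auto
  moreover have "f integrable_on {0..1}"
    by (intro integrable_continuous_real DERIV_continuous_on) (use f in blast)
  then have hi: "((\<lambda>s. f s + integral {0..1} g) has_integral (integral {0..1} f + integral {0..1} g)) {0..1}"
    using has_integral_add[OF integrable_integral has_integral_const_real[of "integral {0..1} g" 0 1]]
    by simp
  ultimately show ?thesis
    using has_integral_le[OF has_integral_const_real[of "f x" 0 1] hi] by simp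
qed

lemma integral_square_pos:
  fixes y :: "real \<Rightarrow> real"
  assumes y: "continuous_on {0..1} y" and s: "s \<in> {0..1}" "y s \<noteq> 0"
  shows "integral {0..1} (\<lambda>x. (y x)\<^sup>2) > 0"
proof -
  have c: "continuous_on (cbox 0 1) (\<lambda>x. (y x)\<^sup>2)" using y by (auto intro!: continuous_intros)
  have "integral (cbox 0 1) (\<lambda>x. (y x)\<^sup>2) \<noteq> 0"
    using integral_cbox_eq_0_iff[OF c] s by auto
  moreover have "integral {0..1} (\<lambda>x. (y x)\<^sup>2) \<ge> 0"
    by (intro Henstock_Kurzweil_Integration.integral_nonneg integrable_continuous_real continuous_intros y) auto
  ultimately show ?thesis by simp
qed

text \<open>
  The two constants of the lemma \<open>eigenfunction_bounds\<close> below. They depend only on a bound \<open>M\<close> for \<open>\<sigma>\<close>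
  and on a constant \<open>B\<close> that controls the boundary conditions.
\<close>

definition spectral_bound :: "real \<Rightarrow> real \<Rightarrow> real" where
  "spectral_bound M B = M\<^sup>2 + 2 * B * (2 + 2 * M + 4 * B)"

definition eigfun_bound :: "real \<Rightarrow> real \<Rightarrow> real" where
  "eigfun_bound M B = exp (2 * M + M\<^sup>2 + (1 + spectral_bound M B)) * (3 + 2 * spectral_bound M B)"

text \<open>
  Integrating \<open>(p y)' = p\<^sup>2 - l y\<^sup>2 - \<sigma>\<^sup>2 y\<^sup>2\<close> bounds \<open>\<integral>p\<^sup>2\<close> by a multiple of \<open>\<integral>y\<^sup>2\<close> and boundary terms, which are
  at most \<open>B\<close> times a value of \<open>y\<^sup>2\<close>. Such a value is at most a multiple of \<open>\<integral>y\<^sup>2\<close> plus a small multiple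
  of \<open>\<integral>p\<^sup>2\<close> and can be absorbed, so that \<open>\<integral>p\<^sup>2 \<le> 2 (l + C) \<integral>y\<^sup>2\<close>. This bounds \<open>l\<close> from below. It also
  bounds the mean of the energy \<open>p\<^sup>2 + k y\<^sup>2\<close> with \<open>k = max l 1\<close> by a multiple of \<open>k \<integral>y\<^sup>2\<close>; since the energy
  is comparable at all points, \<open>k y\<^sup>2\<close> obeys the same bound everywhere.
\<close>

lemma eigenfunction_bounds:
  assumes sys: "sl_system \<sigma> l y p" and \<sigma>: "continuous_on {0..1} \<sigma>"
    and M: "\<And>x. x \<in> {0..1} \<Longrightarrow> \<bar>\<sigma> x\<bar> \<le> M"
    and B: "B \<ge> 0" "\<bar>p 0 * y 0\<bar> \<le> B * (y 0)\<^sup>2" "\<bar>p 1 * y 1\<bar> \<le> B * (y 1)\<^sup>2"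
    and nz: "z \<in> {0..1}" "y z \<noteq> 0"
  shows "- spectral_bound M B \<le> l"
    and "x \<in> {0..1} \<Longrightarrow> (y x)\<^sup>2 \<le> eigfun_bound M B * integral {0..1} (\<lambda>x. (y x)\<^sup>2)"
proof -
  note cont = sl_system_continuous[OF sys]
  have M0: "M \<ge> 0" using M[of 0] by simp
  define I where "I = integral {0..1} (\<lambda>x. (y x)\<^sup>2)"
  define P where "P = integral {0..1} (\<lambda>x. (p x)\<^sup>2)"
  define C where "C = spectral_bound M B"
  have C0: "C \<ge> 0" unfolding C_def spectral_bound_def using M0 B(1) by auto
  have I0: "I > 0" unfolding I_def by (rule integral_square_pos[OF cont(1) nz])
  have hI: "((\<lambda>x. (y x)\<^sup>2) has_integral I) {0..1}" unfolding I_def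
    by (intro integrable_integral integrable_continuous_real continuous_intros cont)
  have hP: "((\<lambda>x. (p x)\<^sup>2) has_integral P) {0..1}" unfolding P_def
    by (intro integrable_integral integrable_continuous_real continuous_intros cont)
  \<comment> \<open>The weight \<open>e\<close> is so small that \<open>2 B\<close> times the bound below contains at most half of \<open>P\<close>.\<close>
  define e where "e = 1 / (4 * B + 1)"
  have e: "e > 0" "1 / e = 4 * B + 1" "2 * B * e \<le> 1 / 2"
    using B(1) by (auto simp: e_def field_simps)
  have sup: "(y x)\<^sup>2 \<le> (2 + 2 * M + 4 * B) * I + e * P" if x: "x \<in> {0..1}" for x
  proof -
    have "(y x)\<^sup>2 \<le> integral {0..1} (\<lambda>x. (y x)\<^sup>2)
        + integral {0..1} (\<lambda>x. (2 * M + 1 / e) * (y x)\<^sup>2 + e * (p x)\<^sup>2)"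
    proof (rule le_integral_plus_variation[where f' = "\<lambda>x. 2 * y x * (p x + \<sigma> x * y x)"])
      fix x :: real assume x: "x \<in> {0..1}"
      show "((\<lambda>x. (y x)\<^sup>2) has_real_derivative 2 * y x * (p x + \<sigma> x * y x)) (at x within {0..1})"
        by (rule derivative_eq_intros sl_systemD[OF sys x] refl | simp)+
      have "2 * (sqrt (1/e) * \<bar>y x\<bar>) * (sqrt e * \<bar>p x\<bar>) \<le> (sqrt (1/e) * \<bar>y x\<bar>)\<^sup>2 + (sqrt e * \<bar>p x\<bar>)\<^sup>2"
        by (rule sum_squares_bound)
      moreover have "2 * (sqrt (1/e) * \<bar>y x\<bar>) * (sqrt e * \<bar>p x\<bar>) = 2 * \<bar>y x * p x\<bar>"
        using e(1) by (simp add: abs_mult real_sqrt_divide)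
      ultimately have "2 * \<bar>y x * p x\<bar> \<le> 1 / e * (y x)\<^sup>2 + e * (p x)\<^sup>2"
        using e(1) by (simp add: power_mult_distrib)
      moreover have "\<bar>2 * \<sigma> x * (y x)\<^sup>2\<bar> \<le> 2 * M * (y x)\<^sup>2"
        unfolding abs_mult using M[OF x] by (intro mult_mono) auto
      moreover have "2 * y x * (p x + \<sigma> x * y x) = 2 * (y x * p x) + 2 * \<sigma> x * (y x)\<^sup>2"
        by (simp add: power2_eq_square algebra_simps)
      ultimately show "\<bar>2 * y x * (p x + \<sigma> x * y x)\<bar> \<le> (2 * M + 1 / e) * (y x)\<^sup>2 + e * (p x)\<^sup>2"
        unfolding distrib_right by linarith
    qed (use x in \<open>auto intro!: continuous_intros cont\<close>)
    also have "integral {0..1} (\<lambda>x. (2 * M + 1 / e) * (y x)\<^sup>2 + e * (p x)\<^sup>2) = (2 * M + 1 / e) * I + e * P"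
      by (intro integral_unique has_integral_add has_integral_mult_right hI hP)
    finally show ?thesis unfolding I_def[symmetric] e(2) by (simp add: algebra_simps)
  qed
  have "((\<lambda>x. (p x)\<^sup>2 - l * (y x)\<^sup>2 - (\<sigma> x)\<^sup>2 * (y x)\<^sup>2) has_integral (p 1 * y 1 - p 0 * y 0)) {0..1}"
  proof (rule ftc01)
    fix x :: real assume x: "x \<in> {0..1}"
    show "((\<lambda>x. p x * y x) has_real_derivative (p x)\<^sup>2 - l * (y x)\<^sup>2 - (\<sigma> x)\<^sup>2 * (y x)\<^sup>2) (at x within {0..1})"
      by (rule derivative_eq_intros sl_systemD[OF sys x] refl | simp add: power2_eq_square algebra_simps)+
  qed auto
  then have "p 1 * y 1 - p 0 * y 0 \<ge> P - l * I - M\<^sup>2 * I"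
  proof (rule has_integral_le[rotated])
    show "((\<lambda>x. (p x)\<^sup>2 - l * (y x)\<^sup>2 - M\<^sup>2 * (y x)\<^sup>2) has_integral P - l * I - M\<^sup>2 * I) {0..1}"
      by (intro has_integral_diff has_integral_mult_right hI hP)
    fix x :: real assume x: "x \<in> {0..1}"
    have "(\<sigma> x)\<^sup>2 * (y x)\<^sup>2 \<le> M\<^sup>2 * (y x)\<^sup>2"
      using M[OF x] M0 by (intro mult_right_mono) (auto simp: abs_le_square_iff[symmetric])
    then show "(p x)\<^sup>2 - l * (y x)\<^sup>2 - M\<^sup>2 * (y x)\<^sup>2 \<le> (p x)\<^sup>2 - l * (y x)\<^sup>2 - (\<sigma> x)\<^sup>2 * (y x)\<^sup>2" by simp
  qed
  moreover have "B * (y 0)\<^sup>2 \<le> B * ((2 + 2 * M + 4 * B) * I + e * P)"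
    "B * (y 1)\<^sup>2 \<le> B * ((2 + 2 * M + 4 * B) * I + e * P)"
    by (intro mult_left_mono sup B(1); simp)+
  ultimately have "P \<le> l * I + M\<^sup>2 * I + 2 * (B * ((2 + 2 * M + 4 * B) * I + e * P))"
    using B(2,3) by linarith
  also have "\<dots> = l * I + C * I + (2 * B * e) * P"
    by (simp add: C_def spectral_bound_def algebra_simps)
  also have "\<dots> \<le> l * I + C * I + 1 / 2 * P"
    using e(3) has_integral_nonneg[OF hP] by (intro add_left_mono mult_right_mono) auto
  finally have P: "P \<le> 2 * (l + C) * I" by (simp add: algebra_simps)
  have "0 \<le> P" using has_integral_nonneg[OF hP] by simp
  then have "0 \<le> (l + C) * I" using P by linarith
  then have "0 \<le> l + C" using I0 by (simp add: zero_le_mult_iff)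
  then show lower: "- spectral_bound M B \<le> l" by (simp add: C_def)
  show "(y x)\<^sup>2 \<le> eigfun_bound M B * integral {0..1} (\<lambda>x. (y x)\<^sup>2)" if x: "x \<in> {0..1}"
  proof -
    define k where "k = max l 1"
    have k: "k \<ge> 1" "\<bar>k - l\<bar> \<le> 1 + C" using lower C0 by (auto simp: k_def C_def)
    define G where "G = exp (2 * M + M\<^sup>2 + (1 + C))"
    have en: "k * (y x)\<^sup>2 \<le> G * ((p s)\<^sup>2 + k * (y s)\<^sup>2)" if "s \<in> {0..1}" for s
      using sl_system_energy[OF sys M k that x] unfolding G_def by (smt (verit) zero_le_power2)
    have "k * (y x)\<^sup>2 \<le> G * (P + k * I)"
      using has_integral_le[OF has_integral_const_real[of "k * (y x)\<^sup>2" 0 1]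
          has_integral_mult_right[OF has_integral_add[OF hP has_integral_mult_right[OF hI, of k]], of G]] en
      by simp
    also have "\<dots> \<le> G * (k * ((3 + 2 * C) * I))"
    proof (rule mult_left_mono)
      have "P \<le> 2 * (k + C) * I" using P I0 by (smt (verit) k_def mult_right_mono)
      also have "\<dots> \<le> 2 * (k + C * k) * I" using k C0 I0
        by (intro mult_right_mono mult_left_mono add_left_mono) (auto simp: mult_le_cancel_left1)
      finally show "P + k * I \<le> k * ((3 + 2 * C) * I)" by (simp add: algebra_simps)
    qed (simp add: G_def)
    finally have "k * (y x)\<^sup>2 \<le> k * (G * ((3 + 2 * C) * I))" by (simp add: mult_ac)
    then have "(y x)\<^sup>2 \<le> G * ((3 + 2 * C) * I)" using k(1) by simp
    then show ?thesis by (simp add: eigfun_bound_def G_def C_def I_def)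
  qed
qed

lemma integrable_lebesgue_on_iff:
  fixes f :: "real \<Rightarrow> real"
  shows "integrable (lebesgue_on {a..b}) f \<longleftrightarrow> f absolutely_integrable_on {a..b}"
  by (simp add: set_integrable_def integrable_restrict_space)

lemma lebesgue_on_integral_eq:
  fixes f :: "real \<Rightarrow> real"
  assumes "f absolutely_integrable_on {a..b}"
  shows "integral\<^sup>L (lebesgue_on {a..b}) f = integral {a..b} f"
  using assms by (intro lebesgue_integral_eq_integral) (auto simp: integrable_lebesgue_on_iff)

lemma absolutely_integrable_on_initial:
  fixes f :: "real \<Rightarrow> real"
  assumes "f absolutely_integrable_on {0..1}" "x \<in> {0..1}"
  shows "f absolutely_integrable_on {0..x}"
  using assms by (intro set_integrable_subset[OF assms(1)]) auto

lemma L2_absolutely_integrable: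
  assumes "f \<in> L2"
  shows "f absolutely_integrable_on {0..1}"
proof -
  have f: "f \<in> borel_measurable leb01" "integrable leb01 (\<lambda>x. (f x)\<^sup>2)"
    using assms by (auto simp: L2_def)
  have "integrable leb01 (\<lambda>x. 1 + (f x)\<^sup>2)"
    by (intro Bochner_Integration.integrable_add f) (simp add: integrable_lebesgue_on_iff absolutely_integrable_continuous_real)
  then have "integrable leb01 f"
  proof (rule Bochner_Integration.integrable_bound[OF _ f(1)])
    have "\<bar>t\<bar> \<le> \<bar>1 + t\<^sup>2\<bar>" for t :: real
      using sum_squares_bound[of 1 "\<bar>t\<bar>"] by simp
    then show "AE x in leb01. norm (f x) \<le> norm (1 + (f x)\<^sup>2)" by simp
  qed
  then show ?thesis by (simp add: integrable_lebesgue_on_iff)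
qed

text \<open>
  The derivative of a solution is \<open>v = v 0 + \<integral>(q - l) u\<close>. By the product rule the integral is \<open>\<sigma> u\<close> plus
  the integral of a continuous function, so \<open>v - \<sigma> u\<close> is continuously differentiable.
\<close>

lemma sl_system_integral_form:
  assumes q: "q absolutely_integrable_on {0..1}"
    and u: "\<And>x. x \<in> {0..1} \<Longrightarrow> (u has_real_derivative v x) (at x within {0..1})"
    and v: "continuous_on {0..1} v" and x: "x \<in> {0..1}"
  shows "integral {0..x} (\<lambda>s. q s * u s - l * u s)
     = integral {0..x} q * u x + integral {0..x} (\<lambda>s. - l * u s - integral {0..s} q * v s)"
proof -
  have uc: "continuous_on {0..1} u" by (rule DERIV_continuous_on) (rule u)
  note ii = set_lebesgue_integral_eq_integral(1)[OF absolutely_integrable_on_initial[OF _ x]]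
  have i1: "(\<lambda>s. q s * u s) integrable_on {0..x}" by (intro ii absolutely_integrable_times_continuous q uc)
  have i2: "u integrable_on {0..x}" by (intro ii absolutely_integrable_continuous_real uc)
  have i3: "(\<lambda>s. integral {0..s} q * v s) integrable_on {0..x}"
    by (intro ii absolutely_integrable_continuous_real continuous_intros continuous_on_indefinite_integral q v)
  show ?thesis
    using i1 i3 integrable_on_mult_right[OF i2, of l] integrable_on_mult_right[OF i2, of "- l"]
      integral_mult_right[of "{0..x}" "- l" u] indefinite_integral_product_rule[OF q u v x]
    by (simp add: Henstock_Kurzweil_Integration.integral_diff)
qed

lemma SL_solution_imp_sl_system:
  assumes q: "q absolutely_integrable_on {0..1}" and sol: "SL_solution q l u v"
  shows "sl_system (\<lambda>x. integral {0..x} q) l u (\<lambda>x. v x - integral {0..x} q * u x)"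
proof -
  define \<sigma> where "\<sigma> = (\<lambda>x. integral {0..x} q)"
  from sol obtain w where u: "\<And>x. x \<in> {0..1} \<Longrightarrow> (u has_real_derivative v x) (at x within {0..1})"
    and w: "integrable leb01 w" "\<And>x. x \<in> {0..1} \<Longrightarrow> v x = v 0 + (LINT t|lebesgue_on {0..x}. w t)"
      "AE x in leb01. - w x + q x * u x = l * u x"
    unfolding SL_solution_def by blast
  have uc: "continuous_on {0..1} u" by (rule DERIV_continuous_on) (use u in blast)
  have \<sigma>c: "continuous_on {0..1} \<sigma>" unfolding \<sigma>_def by (rule continuous_on_indefinite_integral[OF q])
  have wa: "w absolutely_integrable_on {0..1}" using w(1) by (simp add: integrable_lebesgue_on_iff)
  have qu: "(\<lambda>s. q s * u s) absolutely_integrable_on {0..1}"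
    by (rule absolutely_integrable_times_continuous[OF q uc])
  have ua: "u absolutely_integrable_on {0..1}" by (rule absolutely_integrable_continuous_real[OF uc])
  have ra: "(\<lambda>s. q s * u s - l * u s) absolutely_integrable_on {0..1}"
    using set_integral_diff(1)[OF qu set_integrable_mult_right[of l, OF ua]] by simp
  have "AE x in lebesgue. x \<in> {0..1} \<longrightarrow> - w x + q x * u x = l * u x"
    using w(3) by (simp add: AE_restrict_space_iff)
  then obtain N where N: "negligible N" "\<And>x. x \<notin> N \<Longrightarrow> x \<in> {0..1} \<Longrightarrow> - w x + q x * u x = l * u x"
    unfolding eventually_ae_filter negligible_iff_null_sets by auto
  have v1: "v x = v 0 + integral {0..x} (\<lambda>s. q s * u s - l * u s)" if x: "x \<in> {0..1}" for x
  proof -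
    have "(LINT t|lebesgue_on {0..x}. w t) = integral {0..x} w"
      by (rule lebesgue_on_integral_eq[OF absolutely_integrable_on_initial[OF wa x]])
    also have "\<dots> = integral {0..x} (\<lambda>s. q s * u s - l * u s)"
      by (rule integral_spike[OF N(1)]) (use N(2) x in fastforce)
    finally show ?thesis using w(2)[OF x] by simp
  qed
  have "continuous_on {0..1} (\<lambda>x. v 0 + integral {0..x} (\<lambda>s. q s * u s - l * u s))"
    by (intro continuous_intros continuous_on_indefinite_integral ra)
  then have vc: "continuous_on {0..1} v" by (rule continuous_on_eq) (rule v1[symmetric])
  have p: "v x - \<sigma> x * u x = v 0 + integral {0..x} (\<lambda>s. - l * u s - \<sigma> s * v s)" if x: "x \<in> {0..1}" for x
    using v1[OF x] sl_system_integral_form[OF q u vc x, of l] by (simp add: \<sigma>_def)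
  have "((\<lambda>x. v x - \<sigma> x * u x) has_real_derivative - l * u x - \<sigma> x * v x) (at x within {0..1})"
    if x: "x \<in> {0..1}" for x
  proof -
    have "((\<lambda>x. v 0 + integral {0..x} (\<lambda>s. - l * u s - \<sigma> s * v s)) has_real_derivative 0 + (- l * u x - \<sigma> x * v x)) (at x within {0..1})"
      by (intro DERIV_add DERIV_const integral_has_real_derivative continuous_intros uc \<sigma>c vc x)
    then show ?thesis
      using has_field_derivative_transform_within[OF _ zero_less_one x, of _ _ "\<lambda>x. v x - \<sigma> x * u x"] p by simp
  qed
  then show ?thesis using u by (simp add: sl_system_def \<sigma>_def)
qed

lemma sl_system_imp_SL_solution:
  assumes q: "q absolutely_integrable_on {0..1}"
    and sys: "sl_system (\<lambda>x. integral {0..x} q) l y p"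
  shows "SL_solution q l y (\<lambda>x. p x + integral {0..x} q * y x)"
proof -
  define \<sigma> where "\<sigma> = (\<lambda>x. integral {0..x} q)"
  define v where "v = (\<lambda>x. p x + \<sigma> x * y x)"
  note sys' = sys[folded \<sigma>_def]
  note cont = sl_system_continuous[OF sys']
  have \<sigma>c: "continuous_on {0..1} \<sigma>" unfolding \<sigma>_def by (rule continuous_on_indefinite_integral[OF q])
  have vc: "continuous_on {0..1} v" unfolding v_def by (intro continuous_intros \<sigma>c cont)
  have yd: "(y has_real_derivative v x) (at x within {0..1})" if "x \<in> {0..1}" for x
    using sl_systemD(1)[OF sys' that] by (simp add: v_def)
  have qy: "(\<lambda>s. q s * y s) absolutely_integrable_on {0..1}"
    by (rule absolutely_integrable_times_continuous[OF q cont(1)])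
  have ya: "y absolutely_integrable_on {0..1}" by (rule absolutely_integrable_continuous_real[OF cont(1)])
  have wa: "(\<lambda>s. q s * y s - l * y s) absolutely_integrable_on {0..1}"
    using set_integral_diff(1)[OF qy set_integrable_mult_right[of l, OF ya]] by simp
  have vint: "v x = v 0 + (LINT t|lebesgue_on {0..x}. q t * y t - l * y t)" if x: "x \<in> {0..1}" for x
  proof -
    have "(LINT t|lebesgue_on {0..x}. q t * y t - l * y t) = integral {0..x} (\<lambda>s. q s * y s - l * y s)"
      by (rule lebesgue_on_integral_eq[OF absolutely_integrable_on_initial[OF wa x]])
    also have "\<dots> = \<sigma> x * y x + integral {0..x} (\<lambda>s. - l * y s - \<sigma> s * v s)"
      unfolding \<sigma>_def by (rule sl_system_integral_form[OF q yd vc x])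
    also have "integral {0..x} (\<lambda>s. - l * y s - \<sigma> s * v s) = p x - p 0"
      by (rule integral_unique, rule ftc01[OF _ x]) (use sl_systemD(2)[OF sys'] in \<open>simp add: v_def\<close>)
    finally show ?thesis by (simp add: v_def \<sigma>_def)
  qed
  have wi: "integrable leb01 (\<lambda>s. q s * y s - l * y s)" using wa by (simp add: integrable_lebesgue_on_iff)
  have "AE x in leb01. - (q x * y x - l * y x) + q x * y x = l * y x" by simp
  then have "SL_solution q l y v"
    unfolding SL_solution_def using yd vint wi by blast
  then show ?thesis by (simp add: v_def \<sigma>_def)
qed

text \<open>
  Every solution that satisfies the condition at \<open>0\<close> is a multiple of the one with initial data
  \<open>(sin \<alpha>, - cos \<alpha>)\<close>, so only the condition at \<open>1\<close> remains to be tested. At \<open>0\<close> derivative and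
  quasi-derivative agree, because \<open>\<integral>\<^sub>0\<^sup>x q\<close> vanishes there.
\<close>

lemma SL_spectrum_iff:
  assumes q: "q absolutely_integrable_on {0..1}"
    and sys: "sl_system (\<lambda>x. integral {0..x} q) l y p" "y 0 = sin \<alpha>" "p 0 = - cos \<alpha>"
  shows "l \<in> SL_spectrum q \<alpha> \<beta> \<longleftrightarrow> y 1 * cos \<beta> + (p 1 + integral {0..1} q * y 1) * sin \<beta> = 0"
proof
  assume "y 1 * cos \<beta> + (p 1 + integral {0..1} q * y 1) * sin \<beta> = 0"
  moreover have "\<exists>x\<in>{0..1}. y x \<noteq> 0"
    by (rule sl_system_nontrivial[OF sys(1)]) (use sys sin_zero_abs_cos_one[of \<alpha>] in auto)
  ultimately show "l \<in> SL_spectrum q \<alpha> \<beta>"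
    unfolding SL_spectrum_def using sl_system_imp_SL_solution[OF q sys(1)] sys(2,3)
    by (intro CollectI exI[of _ y] exI[of _ "\<lambda>x. p x + integral {0..x} q * y x"]) auto
next
  define \<sigma> where "\<sigma> = (\<lambda>x. integral {0..x} q)"
  have \<sigma>c: "continuous_on {0..1} \<sigma>" unfolding \<sigma>_def by (rule continuous_on_indefinite_integral[OF q])
  have \<sigma>0: "\<sigma> 0 = 0" by (simp add: \<sigma>_def)
  note sys1 = sys(1)[folded \<sigma>_def]
  assume "l \<in> SL_spectrum q \<alpha> \<beta>"
  then obtain u v where uv: "SL_solution q l u v" "\<exists>x\<in>{0..1}. u x \<noteq> 0"
    "u 0 * cos \<alpha> + v 0 * sin \<alpha> = 0" "u 1 * cos \<beta> + v 1 * sin \<beta> = 0"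
    unfolding SL_spectrum_def by blast
  \<comment> \<open>The factor by which \<open>(u 0, v 0)\<close> differs from the unit vector \<open>(sin \<alpha>, - cos \<alpha>)\<close>.\<close>
  define c where "c = u 0 * sin \<alpha> - v 0 * cos \<alpha>"
  have sc: "(sin \<alpha>)\<^sup>2 + (cos \<alpha>)\<^sup>2 = 1" by simp
  have c1: "u 0 = c * sin \<alpha>" and c2: "v 0 = - c * cos \<alpha>"
    unfolding c_def using uv(3) sc by (algebra, algebra)
  have eq: "u x = c * y x \<and> v x - \<sigma> x * u x = c * p x" if x: "x \<in> {0..1}" for x
    using sl_system_unique[OF SL_solution_imp_sl_system[OF q uv(1), folded \<sigma>_def]
        sl_system_combination[OF sys1 sys1, of c 0] \<sigma>c _ _ x] c1 c2 sys \<sigma>0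
    by (auto simp: \<sigma>_def)
  have "c \<noteq> 0" using uv(2) eq by auto
  have "v 1 = c * (p 1 + \<sigma> 1 * y 1)" using eq[of 1] by (simp add: algebra_simps)
  then have "c * (y 1 * cos \<beta> + (p 1 + \<sigma> 1 * y 1) * sin \<beta>) = 0"
    using eq[of 1] uv(4) by (simp add: algebra_simps)
  then show "y 1 * cos \<beta> + (p 1 + integral {0..1} q * y 1) * sin \<beta> = 0"
    using \<open>c \<noteq> 0\<close> by (simp add: \<sigma>_def)
qed

section \<open>The phase of the solutions\<close>

text \<open>
  The potentials may differ: \<open>\<tau> - \<sigma>\<close> enters multiplied by the derivative of \<open>y z\<close>, so that an integration
  by parts recovers the familiar term \<open>\<integral>(\<tau> - \<sigma>)' y z\<close>.
\<close>

lemma sl_wronskian_derivative: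
  assumes y: "sl_system \<sigma> l y p" and z: "sl_system \<tau> m z r" and x: "x \<in> {0..1}"
  shows "((\<lambda>x. y x * r x - p x * z x) has_real_derivative
     (l - m) * (y x * z x) - (\<tau> x - \<sigma> x) * (y x * (r x + \<tau> x * z x) + (p x + \<sigma> x * y x) * z x))
     (at x within {0..1})"
  by (rule derivative_eq_intros sl_systemD[OF y x] sl_systemD[OF z x] refl | simp add: algebra_simps)+

lemma sl_system_cong:
  assumes "sl_system \<sigma> l y p" "\<And>x. x \<in> {0..1} \<Longrightarrow> \<sigma> x = \<tau> x"
  shows "sl_system \<tau> l y p"
  using assms unfolding sl_system_def by simp

lemma sgn_exp: "sgn (exp z) = cis (Im z)" for z :: complex
  by (simp add: sgn_eq exp_eq_polar norm_mult)

text \<open>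
  Two values of \<open>g\<close> differ by a multiple of \<open>2 \<pi>\<close>, so \<open>g\<close> has discrete range.
\<close>

lemma cis_eq_imp_constant:
  fixes g :: "'a::topological_space \<Rightarrow> real"
  assumes g: "continuous_on S g" and S: "connected S" and c: "\<And>x. x \<in> S \<Longrightarrow> cis (g x) = c"
    and x: "x \<in> S" "y \<in> S"
  shows "g x = g y"
proof -
  have "g constant_on S"
  proof (rule continuous_discrete_range_constant[OF S g])
    fix x assume x: "x \<in> S"
    show "\<exists>e>0. \<forall>y. y \<in> S \<and> g y \<noteq> g x \<longrightarrow> e \<le> norm (g y - g x)"
    proof (intro exI[of _ 1] conjI allI impI)
      fix y assume y: "y \<in> S \<and> g y \<noteq> g x"
      have "cis (g y - g x) = cis (g y) / cis (g x)" by (simp add: cis_divide)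
      also have "\<dots> = 1" using c[of x] c[of y] x y by auto
      finally have "cos (g y - g x) = 1" by (simp add: complex_eq_iff)
      then obtain n :: int where n: "g y - g x = real_of_int n * 2 * pi"
        by (auto simp: cos_one_2pi_int)
      then have "n \<noteq> 0" using y by auto
      then have "1 \<le> \<bar>real_of_int n\<bar>" by linarith
      then have "1 * 1 \<le> \<bar>real_of_int n\<bar> * (2 * pi)" by (intro mult_mono) (use pi_gt3 in auto)
      then show "1 \<le> norm (g y - g x)" unfolding n by (simp add: abs_mult)
    qed simp
  qed
  then show ?thesis using x unfolding constant_on_def by metis
qed

text \<open>
  The image of \<open>f\<close> is an interval that contains no multiple of \<open>\<pi>\<close>.
\<close>

lemma sin_nonzero_imp_between_multiples:
  fixes f :: "'a::topological_space \<Rightarrow> real"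
  assumes f: "continuous_on S f" and S: "connected S" and nz: "\<And>x. x \<in> S \<Longrightarrow> sin (f x) \<noteq> 0"
  shows "\<exists>k::int. \<forall>x\<in>S. of_int k * pi < f x \<and> f x < of_int (k + 1) * pi"
proof (cases "S = {}")
  case False
  then obtain x0 where x0: "x0 \<in> S" by blast
  define k where "k = \<lfloor>f x0 / pi\<rfloor>"
  have "of_int k \<le> f x0 / pi" "f x0 / pi < of_int k + 1" unfolding k_def by linarith+
  then have k: "of_int k * pi \<le> f x0" "f x0 < of_int (k + 1) * pi"
    by (simp_all add: pos_le_divide_eq pos_divide_less_eq)
  have iv: "is_interval (f ` S)"
    using connected_continuous_image[OF f S] by (simp add: is_interval_connected_1)
  have nm: "of_int j * pi \<notin> f ` S" for j :: int
    using nz sin_zero_iff_int2 by (auto simp: image_iff) metis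
  have "of_int k * pi < f x \<and> f x < of_int (k + 1) * pi" if x: "x \<in> S" for x
  proof (rule ccontr)
    assume "\<not> ?thesis"
    then consider "f x \<le> of_int k * pi" | "of_int (k + 1) * pi \<le> f x" by linarith
    then show False
    proof cases
      case 1
      then have "of_int k * pi \<in> f ` S"
        using iv x x0 k(1) unfolding is_interval_1 by (meson imageI)
      then show False using nm by blast
    next
      case 2
      then have "of_int (k + 1) * pi \<in> f ` S"
        using iv x x0 k(2) unfolding is_interval_1 by (meson imageI less_imp_le)
      then show False using nm by blast
    qed
  qed
  then show ?thesis by blast
qed auto

text \<open>
  On an interval \<open>{a..b}\<close> the maximum can be attained only at \<open>b\<close>, since \<open>f\<close> increases to the right of
  every other point; and \<open>f a\<close> is exceeded somewhere.
\<close>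

lemma locally_increasing_imp_strict_mono:
  fixes f :: "real \<Rightarrow> real"
  assumes f: "continuous_on UNIV f"
    and loc: "\<And>x. \<exists>d>0. \<forall>y. x < y \<and> y < x + d \<longrightarrow> f x < f y"
  shows "strict_mono f"
proof (rule strict_monoI)
  fix a b :: real assume ab: "a < b"
  obtain c where c: "c \<in> {a..b}" "\<And>y. y \<in> {a..b} \<Longrightarrow> f y \<le> f c"
    using continuous_attains_sup[OF compact_Icc _ continuous_on_subset[OF f subset_UNIV], of a b] ab by auto
  have "c = b"
  proof (rule ccontr)
    assume "c \<noteq> b"
    then have cb: "c < b" using c by auto
    obtain d where d: "d > 0" "\<And>y. c < y \<Longrightarrow> y < c + d \<Longrightarrow> f c < f y" using loc[of c] by blast
    define y where "y = min b (c + d / 2)"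
    have "f c < f y" by (rule d(2)) (use d(1) cb in \<open>auto simp: y_def\<close>)
    moreover have "y \<in> {a..b}" using c(1) cb d(1) by (auto simp: y_def)
    ultimately show False using c(2)[of y] by simp
  qed
  obtain d where d: "d > 0" "\<And>y. a < y \<Longrightarrow> y < a + d \<Longrightarrow> f a < f y" using loc[of a] by blast
  define y where "y = min b (a + d / 2)"
  have "f a < f y" by (rule d(2)) (use d(1) ab in \<open>auto simp: y_def\<close>)
  moreover have "y \<in> {a..b}" using ab d(1) by (auto simp: y_def)
  ultimately show "f a < f b" using c(2)[of y] \<open>c = b\<close> by simp
qed

text \<open>
  The potentials \<open>q + t h\<close>, together with the initial data \<open>(sin \<alpha>, - cos \<alpha>)\<close> that encode the boundary
  condition at \<open>0\<close>. Spectral parameter and coupling are combined in a single parameter \<open>(l, t)\<close>, on which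
  everything depends continuously.
\<close>

locale sl_family =
  fixes q h :: "real \<Rightarrow> real" and \<alpha> :: real
  assumes q: "q absolutely_integrable_on {0..1}" and h: "h absolutely_integrable_on {0..1}"
begin

text \<open>
  The primitive of \<open>q + t h\<close> is \<open>sg t\<close>. It vanishes at \<open>0\<close>, where the quasi-derivative \<open>p\<close> and the
  derivative \<open>v\<close> of the solution \<open>y\<close> below therefore coincide.
\<close>

definition \<eta> :: "real \<Rightarrow> real" where "\<eta> x = integral {0..x} h"

definition sg :: "real \<Rightarrow> real \<Rightarrow> real" where "sg t x = integral {0..x} q + t * \<eta> x"

definition Sol :: "real \<times> real \<Rightarrow> real \<Rightarrow> real \<times> real" where
  "Sol a = (SOME Y. Y 0 = (sin \<alpha>, - cos \<alpha>) \<and>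
     (\<forall>x\<in>{0..1}. (Y has_vector_derivative sl_matrix (sg (snd a) x) (fst a) (Y x)) (at x within {0..1})))"

definition y where "y a x = fst (Sol a x)"
definition p where "p a x = snd (Sol a x)"
definition v where "v a x = p a x + sg (snd a) x * y a x"

lemma qh: "(\<lambda>x. q x + t * h x) absolutely_integrable_on {0..1}"
  using set_integral_add(1)[OF q set_integrable_mult_right[of t, OF h]] by simp

lemma sg_eq:
  assumes "x \<in> {0..1}"
  shows "integral {0..x} (\<lambda>x. q x + t * h x) = sg t x"
proof -
  note ii = set_lebesgue_integral_eq_integral(1)[OF absolutely_integrable_on_initial[OF _ assms]]
  show ?thesis unfolding sg_def \<eta>_def
    using ii[OF q] ii[OF h] by (simp add: Henstock_Kurzweil_Integration.integral_add integrable_on_mult_right)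
qed

lemma \<eta>_cont: "continuous_on {0..1} \<eta>"
  unfolding \<eta>_def by (rule continuous_on_indefinite_integral[OF h])

lemma sg_cont: "continuous_on {0..1} (sg t)"
  unfolding sg_def by (intro continuous_intros \<eta>_cont continuous_on_indefinite_integral[OF q])

lemma sg_0 [simp]: "sg t 0 = 0" by (simp add: sg_def \<eta>_def)

lemma sg_joint: "continuous_on (UNIV \<times> {0..1}) (\<lambda>z :: (real \<times> real) \<times> real. sg (snd (fst z)) (snd z))"
proof -
  have "continuous_on (UNIV \<times> {0..1}) (\<lambda>z :: (real \<times> real) \<times> real. integral {0..snd z} q)"
    by (rule continuous_on_compose2[OF continuous_on_indefinite_integral[OF q]]) (auto intro: continuous_intros)
  moreover have "continuous_on (UNIV \<times> {0..1}) (\<lambda>z :: (real \<times> real) \<times> real. \<eta> (snd z))"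
    by (rule continuous_on_compose2[OF \<eta>_cont]) (auto intro: continuous_intros)
  ultimately show ?thesis unfolding sg_def by (intro continuous_intros)
qed

lemma Sol: "Sol a 0 = (sin \<alpha>, - cos \<alpha>)"
  "x \<in> {0..1} \<Longrightarrow> (Sol a has_vector_derivative sl_matrix (sg (snd a) x) (fst a) (Sol a x)) (at x within {0..1})"
proof -
  have "continuous_on {0..1} (\<lambda>x. sl_matrix (sg (snd a) x) (fst a))"
    by (intro sl_matrix_continuous sg_cont continuous_intros)
  from someI_ex[OF linear_ode_exists[OF this, of "(sin \<alpha>, - cos \<alpha>)"]]
  show "Sol a 0 = (sin \<alpha>, - cos \<alpha>)"
    "x \<in> {0..1} \<Longrightarrow> (Sol a has_vector_derivative sl_matrix (sg (snd a) x) (fst a) (Sol a x)) (at x within {0..1})"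
    unfolding Sol_def[symmetric] by auto
qed

lemma init [simp]: "y a 0 = sin \<alpha>" "p a 0 = - cos \<alpha>" "v a 0 = - cos \<alpha>"
  by (simp_all add: y_def p_def v_def Sol)

lemma sys: "sl_system (sg (snd a)) (fst a) (y a) (p a)"
  using Sol(2)[of _ a] sl_system_vector_form[of "sg (snd a)" "fst a" "Sol a"]
  unfolding y_def p_def by blast

lemma Sol_joint: "continuous_on (UNIV \<times> {0..1}) (\<lambda>z. Sol (fst z) (snd z))"
proof -
  have "continuous_on (UNIV \<times> {0..1}) (\<lambda>(a, x). sl_matrix (sg (snd a) x) (fst a))"
    unfolding case_prod_beta by (intro sl_matrix_continuous sg_joint continuous_intros)
  from linear_ode_continuous_param[OF this Sol] show ?thesis by (simp add: case_prod_beta)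
qed

lemma y_joint: "continuous_on (UNIV \<times> {0..1}) (\<lambda>z. y (fst z) (snd z))"
  and p_joint: "continuous_on (UNIV \<times> {0..1}) (\<lambda>z. p (fst z) (snd z))"
  unfolding y_def p_def by (intro continuous_intros Sol_joint)+

lemma v_joint: "continuous_on (UNIV \<times> {0..1}) (\<lambda>z. v (fst z) (snd z))"
  unfolding v_def by (intro continuous_intros sg_joint y_joint p_joint)

lemma slice:
  fixes f :: "real \<times> real \<Rightarrow> real \<Rightarrow> 'b::topological_space"
  assumes "continuous_on (UNIV \<times> {0..1}) (\<lambda>z. f (fst z) (snd z))"
  shows "continuous_on {0..1} (f a)" "x \<in> {0..1} \<Longrightarrow> continuous_on UNIV (\<lambda>a. f a x)"
proof -
  have "continuous_on {0..1} (\<lambda>x. (a, x))" by (intro continuous_intros)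
  from continuous_on_compose2[OF assms this] show "continuous_on {0..1} (f a)" by auto
  show "continuous_on UNIV (\<lambda>a. f a x)" if "x \<in> {0..1}"
  proof -
    have "continuous_on UNIV (\<lambda>a :: real \<times> real. (a, x))" by (intro continuous_intros)
    moreover have "range (\<lambda>a :: real \<times> real. (a, x)) \<subseteq> UNIV \<times> {0..1}" using that by auto
    ultimately have "continuous_on UNIV (\<lambda>a. f (fst (a, x)) (snd (a, x)))"
      by (rule continuous_on_compose2[OF assms])
    then show ?thesis by simp
  qed
qed

lemmas y_cont = slice[OF y_joint] and p_cont = slice[OF p_joint] and v_cont = slice[OF v_joint]

lemma y_deriv: "x \<in> {0..1} \<Longrightarrow> (y a has_real_derivative v a x) (at x within {0..1})"
  using sl_systemD(1)[OF sys] by (simp add: v_def)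

lemma nonzero: "x \<in> {0..1} \<Longrightarrow> y a x \<noteq> 0 \<or> p a x \<noteq> 0"
  using sl_system_zero[OF sys sg_cont, of x a 0] sin_zero_abs_cos_one[of \<alpha>] by auto

lemma y_nonzero: "\<exists>x\<in>{0..1}. y a x \<noteq> 0"
  by (rule sl_system_nontrivial[OF sys]) (use nonzero[of 0 a] in auto)

text \<open>
  The two integrals in the Wronskian identity. \<open>H a b\<close> is \<open>\<integral>h y\<^sub>a y\<^sub>b\<close> after an integration by parts,
  which leaves only continuous integrands and thereby makes continuity in the parameter evident.
\<close>

definition K where "K a b = integral {0..1} (\<lambda>x. y a x * y b x)"

definition H where
  "H a b = \<eta> 1 * (y a 1 * y b 1) - integral {0..1} (\<lambda>x. \<eta> x * (y a x * v b x + v a x * y b x))"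

lemma K_pos: "K a a > 0"
  using y_nonzero[of a] integral_square_pos[OF y_cont(1)[of a]] by (auto simp: K_def power2_eq_square)

lemma integral_param:
  fixes f :: "real \<times> real \<Rightarrow> real \<Rightarrow> real"
  assumes "continuous_on (UNIV \<times> {0..1}) (\<lambda>z. f (fst z) (snd z))"
  shows "continuous_on UNIV (\<lambda>a. integral {0..1} (f a))"
  using integral_continuous_on_param[of UNIV 0 1 f] assms by (simp add: case_prod_beta)

lemma snd_compose: "continuous_on {0..1} f \<Longrightarrow> continuous_on (UNIV \<times> {0..1}) (\<lambda>z. f (snd z))"
  by (rule continuous_on_compose2) (auto intro: continuous_intros)

lemma K_cont: "continuous_on UNIV (\<lambda>a. K a b)"
  unfolding K_def by (intro integral_param continuous_intros y_joint snd_compose y_cont)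

lemma H_cont: "continuous_on UNIV (\<lambda>a. H a b)"
  unfolding H_def
  by (intro integral_param continuous_intros y_joint v_joint snd_compose y_cont v_cont \<eta>_cont; simp)

lemma H_eq: "H a b = integral {0..1} (\<lambda>x. h x * (y a x * y b x))"
proof -
  have "integral {0..1} (\<lambda>x. h x * (y a x * y b x)) = integral {0..1} h * (y a 1 * y b 1) -
     integral {0..1} (\<lambda>x. integral {0..x} h * (y a x * v b x + v a x * y b x))"
  proof (rule indefinite_integral_product_rule[OF h])
    fix x :: real assume x: "x \<in> {0..1}"
    show "((\<lambda>x. y a x * y b x) has_real_derivative y a x * v b x + v a x * y b x) (at x within {0..1})"
      by (rule derivative_eq_intros y_deriv x refl | simp)+
  qed (auto intro!: continuous_intros y_cont v_cont)
  then show ?thesis by (simp add: H_def \<eta>_def)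
qed

text \<open>
  There is no contribution from \<open>0\<close>, since all solutions have the same initial data.
\<close>

lemma wronskian:
  "y a 1 * v b 1 - v a 1 * y b 1 = (fst a - fst b) * K a b + (snd b - snd a) * H a b"
proof -
  have 1: "((\<lambda>x. (fst a - fst b) * (y a x * y b x) - (sg (snd b) x - sg (snd a) x) * (y a x * v b x + v a x * y b x))
     has_integral ((y a 1 * p b 1 - p a 1 * y b 1) - (y a 0 * p b 0 - p a 0 * y b 0))) {0..1}"
    by (rule ftc01) (use sl_wronskian_derivative[OF sys sys] in \<open>auto simp: v_def\<close>)
  have 2: "((\<lambda>x. (fst a - fst b) * (y a x * y b x) - (snd b - snd a) * (\<eta> x * (y a x * v b x + v a x * y b x)))
     has_integral ((fst a - fst b) * K a b - (snd b - snd a) * integral {0..1} (\<lambda>x. \<eta> x * (y a x * v b x + v a x * y b x)))) {0..1}"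
    unfolding K_def
    by (intro has_integral_diff has_integral_mult_right integrable_integral integrable_continuous_real
        continuous_intros y_cont v_cont \<eta>_cont)
  have 3: "(\<lambda>x. (fst a - fst b) * (y a x * y b x) - (sg (snd b) x - sg (snd a) x) * (y a x * v b x + v a x * y b x))
    = (\<lambda>x. (fst a - fst b) * (y a x * y b x) - (snd b - snd a) * (\<eta> x * (y a x * v b x + v a x * y b x)))"
    by (auto simp: sg_def algebra_simps)
  have "y a 1 * p b 1 - p a 1 * y b 1 = (fst a - fst b) * K a b
     - (snd b - snd a) * integral {0..1} (\<lambda>x. \<eta> x * (y a x * v b x + v a x * y b x))"
    using has_integral_unique[OF 1[unfolded 3] 2] by simp
  then show ?thesis by (simp add: H_def v_def sg_def algebra_simps)
qed

text \<open>
  The phase is obtained from a continuous logarithm of \<open>Z\<close>, which exists because the parameter domain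
  is convex and \<open>Z\<close> does not vanish.
\<close>

definition Z where "Z a x = Complex (v a x) (y a x)"

lemma Z_nonzero: "x \<in> {0..1} \<Longrightarrow> Z a x \<noteq> 0"
  using nonzero[of x a] by (auto simp: Z_def v_def complex_eq_iff)

lemma Z_joint: "continuous_on (UNIV \<times> {0..1}) (\<lambda>z. Z (fst z) (snd z))"
  unfolding Z_def by (intro continuous_on_Complex y_joint v_joint)

definition \<Theta> :: "real \<times> real \<Rightarrow> real \<Rightarrow> real" where
  "\<Theta> = (SOME \<Theta>. continuous_on (UNIV \<times> {0..1}) (\<lambda>z. \<Theta> (fst z) (snd z)) \<and>
     (\<forall>a. \<forall>x\<in>{0..1}. sgn (Z a x) = cis (\<Theta> a x)))"

lemma \<Theta>_joint: "continuous_on (UNIV \<times> {0..1}) (\<lambda>z. \<Theta> (fst z) (snd z))"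
  and \<Theta>: "x \<in> {0..1} \<Longrightarrow> sgn (Z a x) = cis (\<Theta> a x)"
proof -
  have "convex ((UNIV :: (real \<times> real) set) \<times> {0..1::real})" by (intro convex_Times) auto
  then have "contractible ((UNIV :: (real \<times> real) set) \<times> {0..1::real})" by (rule convex_imp_contractible)
  then obtain g where g: "continuous_on (UNIV \<times> {0..1}) g"
    "\<And>z. z \<in> UNIV \<times> {0..1} \<Longrightarrow> Z (fst z) (snd z) = exp (g z)"
    using continuous_logarithm_on_contractible[OF Z_joint] Z_nonzero by (metis mem_Times_iff)
  then have "continuous_on (UNIV \<times> {0..1}) (\<lambda>z. (\<lambda>a x. Im (g (a, x))) (fst z) (snd z)) \<and>
     (\<forall>a. \<forall>x\<in>{0..1}. sgn (Z a x) = cis ((\<lambda>a x. Im (g (a, x))) a x))"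
    using g by (auto intro!: continuous_intros simp: sgn_exp)
  from someI[of "\<lambda>\<Theta>. continuous_on (UNIV \<times> {0..1}) (\<lambda>z. \<Theta> (fst z) (snd z)) \<and>
     (\<forall>a. \<forall>x\<in>{0..1}. sgn (Z a x) = cis (\<Theta> a x))", OF this]
  show "continuous_on (UNIV \<times> {0..1}) (\<lambda>z. \<Theta> (fst z) (snd z))"
    "x \<in> {0..1} \<Longrightarrow> sgn (Z a x) = cis (\<Theta> a x)"
    unfolding \<Theta>_def[symmetric] by blast+
qed

lemmas \<Theta>_cont = slice[OF \<Theta>_joint]

lemma polar:
  assumes "x \<in> {0..1}"
  shows "v a x = cmod (Z a x) * cos (\<Theta> a x)" "y a x = cmod (Z a x) * sin (\<Theta> a x)"
    "cmod (Z a x) > 0"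
proof -
  have n: "cmod (Z a x) > 0" using Z_nonzero[OF assms] by simp
  have "Z a x = of_real (cmod (Z a x)) * sgn (Z a x)" using n by (simp add: sgn_eq)
  then have *: "Z a x = of_real (cmod (Z a x)) * cis (\<Theta> a x)" using \<Theta>[OF assms] by simp
  show "v a x = cmod (Z a x) * cos (\<Theta> a x)" using arg_cong[OF *, of Re] by (simp add: Z_def)
  show "y a x = cmod (Z a x) * sin (\<Theta> a x)" using arg_cong[OF *, of Im] by (simp add: Z_def)
  show "cmod (Z a x) > 0" by (rule n)
qed

lemma \<Theta>_init: "\<Theta> a 0 = \<Theta> b 0"
proof (rule cis_eq_imp_constant[of UNIV "\<lambda>a. \<Theta> a 0"])
  show "cis (\<Theta> x 0) = sgn (Complex (- cos \<alpha>) (sin \<alpha>))" for x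
    using \<Theta>[of 0 x] by (simp add: Z_def)
qed (auto intro: \<Theta>_cont connected_UNIV)

lemma wronskian_polar:
  "y a 1 * v b 1 - v a 1 * y b 1 = cmod (Z a 1) * cmod (Z b 1) * sin (\<Theta> a 1 - \<Theta> b 1)"
  using polar[of 1 a] polar[of 1 b] by (simp add: sin_diff algebra_simps)

text \<open>
  For equal \<open>t\<close> the Wronskian at \<open>1\<close> is a positive multiple of \<open>sin (\<Theta>\<^sub>l - \<Theta>\<^sub>m)\<close> and equals \<open>(l - m) \<integral>y\<^sub>l y\<^sub>m\<close>. If
  \<open>l\<close> is close to \<open>m\<close>, the integral is positive and the phases differ by less than \<open>\<pi>\<close>, so the sign of the
  sine is the sign of \<open>\<Theta>\<^sub>l - \<Theta>\<^sub>m\<close>: the phase increases to the right of every \<open>m\<close>, hence globally.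
\<close>

lemma \<Theta>_strict_mono: "strict_mono (\<lambda>l. \<Theta> (l, t) 1)"
proof (rule locally_increasing_imp_strict_mono)
  have pc: "continuous_on UNIV (\<lambda>l::real. (l, t))" by (intro continuous_intros)
  show "continuous_on UNIV (\<lambda>l. \<Theta> (l, t) 1)"
    by (rule continuous_on_compose2[OF \<Theta>_cont(2) pc]) auto
  have key: "\<exists>d>0. \<forall>l. \<bar>l - m\<bar> < d \<longrightarrow> K (l, t) (m, t) > 0 \<and> \<bar>\<Theta> (l, t) 1 - \<Theta> (m, t) 1\<bar> < pi" for m
  proof -
    have "continuous_on UNIV (\<lambda>l. K (l, t) (m, t))"
      by (rule continuous_on_compose2[OF K_cont pc]) auto
    then have "((\<lambda>l. K (l, t) (m, t)) \<longlongrightarrow> K (m, t) (m, t)) (at m)"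
      by (simp add: continuous_on_def)
    then have "\<forall>\<^sub>F l in at m. K (l, t) (m, t) > 0" using K_pos by (rule order_tendstoD(1))
    moreover have "((\<lambda>l. \<Theta> (l, t) 1) \<longlongrightarrow> \<Theta> (m, t) 1) (at m)"
      using \<open>continuous_on UNIV (\<lambda>l. \<Theta> (l, t) 1)\<close> by (simp add: continuous_on_def)
    then have "\<forall>\<^sub>F l in at m. dist (\<Theta> (l, t) 1) (\<Theta> (m, t) 1) < pi" by (rule tendstoD) simp
    ultimately have "\<forall>\<^sub>F l in at m. K (l, t) (m, t) > 0 \<and> \<bar>\<Theta> (l, t) 1 - \<Theta> (m, t) 1\<bar> < pi"
      by eventually_elim (simp add: dist_real_def)
    then obtain d where "d > 0" "\<forall>l. l \<noteq> m \<and> dist l m < d \<longrightarrow> K (l, t) (m, t) > 0 \<and> \<bar>\<Theta> (l, t) 1 - \<Theta> (m, t) 1\<bar> < pi"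
      unfolding eventually_at by auto
    moreover have "K (m, t) (m, t) > 0 \<and> \<bar>\<Theta> (m, t) 1 - \<Theta> (m, t) 1\<bar> < pi" using K_pos by simp
    ultimately show ?thesis unfolding dist_real_def by metis
  qed
  have W: "cmod (Z (l, t) 1) * cmod (Z (m, t) 1) * sin (\<Theta> (l, t) 1 - \<Theta> (m, t) 1) = (l - m) * K (l, t) (m, t)" for l m
    using wronskian[of "(l, t)" "(m, t)"] by (simp add: wronskian_polar)
  have Zp: "cmod (Z (l, t) 1) * cmod (Z (m, t) 1) > 0" for l m using polar(3)[of 1] by simp
  fix m
  obtain d where d: "d > 0" "\<And>l. \<bar>l - m\<bar> < d \<Longrightarrow> K (l, t) (m, t) > 0"
    "\<And>l. \<bar>l - m\<bar> < d \<Longrightarrow> \<bar>\<Theta> (l, t) 1 - \<Theta> (m, t) 1\<bar> < pi" using key[of m] by blast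
  show "\<exists>d>0. \<forall>l. m < l \<and> l < m + d \<longrightarrow> \<Theta> (m, t) 1 < \<Theta> (l, t) 1"
  proof (intro exI[of _ d] conjI allI impI d(1))
    fix l assume l: "m < l \<and> l < m + d"
    then have "(l - m) * K (l, t) (m, t) > 0" using d(2)[of l] by simp
    then have "sin (\<Theta> (l, t) 1 - \<Theta> (m, t) 1) > 0" using Zp W by (metis zero_less_mult_pos)
    then show "\<Theta> (m, t) 1 < \<Theta> (l, t) 1"
      using d(3)[of l] l sin_ge_zero[of "\<Theta> (m, t) 1 - \<Theta> (l, t) 1"] sin_minus[of "\<Theta> (l, t) 1 - \<Theta> (m, t) 1"]
      by (smt (verit))
  qed
qed

end

section \<open>Eigenvalues along a line of potentials\<close>

text \<open>
  If a strictly increasing phase starts between \<open>(k - 1) \<pi>\<close> and \<open>k \<pi>\<close>, then the zeros of its sine, in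
  increasing order, are the points at which it takes the values \<open>k \<pi>, (k + 1) \<pi>, \<dots>\<close>. This evaluates the
  description by which the \<open>n\<close>-th eigenvalue is defined.
\<close>

lemma nth_zero_of_sine_phase:
  fixes f :: "real \<Rightarrow> real" and k :: int
  assumes mono: "strict_mono f" and f: "continuous_on UNIV f" and unb: "\<And>B. \<exists>l. B < f l"
    and low: "\<And>l. of_int (k - 1) * pi < f l" and \<Lambda>: "f \<Lambda> < of_int k * pi"
    and S: "S = {l. sin (f l) = 0}"
  shows "f l = of_int (k + int n) * pi \<longleftrightarrow>
    l = (THE \<mu>. \<mu> \<in> S \<and> finite {\<nu> \<in> S. \<nu> < \<mu>} \<and> card {\<nu> \<in> S. \<nu> < \<mu>} = n)"
proof -
  have "\<exists>l. f l = of_int (k + int n) * pi" for n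
  proof -
    obtain b where b: "of_int (k + int n) * pi < f b" using unb by blast
    have a: "f \<Lambda> < of_int (k + int n) * pi"
      by (rule less_le_trans[OF \<Lambda>]) (simp add: mult_right_mono)
    then have "\<Lambda> \<le> b" using b strict_mono_less[OF mono, of \<Lambda> b] by linarith
    then have "\<exists>l\<ge>\<Lambda>. l \<le> b \<and> f l = of_int (k + int n) * pi"
      using a b by (intro IVT') (auto intro: continuous_on_subset[OF f])
    then show ?thesis by blast
  qed
  then obtain e where e: "\<And>n. f (e n) = of_int (k + int n) * pi" by metis
  have less: "e m < e n \<longleftrightarrow> m < n" for m n
  proof -
    have "e m < e n \<longleftrightarrow> f (e m) < f (e n)" using strict_mono_less[OF mono] by simp
    also have "\<dots> \<longleftrightarrow> m < n" unfolding e by simp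
    finally show ?thesis .
  qed
  have inj: "inj e" using less by (metis injI nat_neq_iff less_irrefl)
  have rng: "S = range e"
  proof
    show "range e \<subseteq> S"
    proof
      fix z assume "z \<in> range e"
      then obtain n where "z = e n" by blast
      then have "f z = of_int (k + int n) * pi" by (simp add: e)
      then show "z \<in> S" unfolding S mem_Collect_eq sin_zero_iff_int2 by blast
    qed
    show "S \<subseteq> range e"
    proof
      fix z assume "z \<in> S"
      then obtain j :: int where j: "f z = of_int j * pi" unfolding S by (auto simp: sin_zero_iff_int2)
      then have "of_int (k - 1) * pi < of_int j * pi" using low[of z] by simp
      then have "k - 1 < j" by (simp only: mult_less_cancel_right_pos[OF pi_gt_zero] of_int_less_iff)
      then have "f z = f (e (nat (j - k)))" unfolding e j by simp
      then show "z \<in> range e" using strict_mono_eq[OF mono] by auto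
    qed
  qed
  have below: "{\<nu> \<in> S. \<nu> < e n} = e ` {..<n}" for n unfolding rng using less by auto
  have card: "card {\<nu> \<in> S. \<nu> < e n} = n" "finite {\<nu> \<in> S. \<nu> < e n}" for n
    unfolding below using card_image[OF inj_on_subset[OF inj]] by auto
  have "(THE \<mu>. \<mu> \<in> S \<and> finite {\<nu> \<in> S. \<nu> < \<mu>} \<and> card {\<nu> \<in> S. \<nu> < \<mu>} = n) = e n"
  proof (rule the_equality)
    show "e n \<in> S \<and> finite {\<nu> \<in> S. \<nu> < e n} \<and> card {\<nu> \<in> S. \<nu> < e n} = n"
      using card rng by blast
    fix \<mu> assume \<mu>: "\<mu> \<in> S \<and> finite {\<nu> \<in> S. \<nu> < \<mu>} \<and> card {\<nu> \<in> S. \<nu> < \<mu>} = n"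
    then obtain m where "\<mu> = e m" using rng by blast
    then show "\<mu> = e n" using card(1)[of m] \<mu> by simp
  qed
  then show ?thesis using e[of n] strict_mono_eq[OF mono, of l "e n"] by auto
qed

lemma abs_mult_le_of_boundary_condition:
  fixes u w s c :: real
  assumes "u * c + w * s = 0" "s\<^sup>2 + c\<^sup>2 = 1"
  shows "\<bar>w * u\<bar> \<le> \<bar>c / s\<bar> * u\<^sup>2"
proof (cases "s = 0")
  case True
  then have "u = 0" using assms by auto
  then show ?thesis by simp
next
  case False
  then have "w = - (c / s) * u" using assms by (simp add: field_simps)
  then show ?thesis by (simp add: abs_mult power2_eq_square)
qed

context sl_family
begin

text \<open>
  For \<open>l = k\<^sup>2\<close> the phase of \<open>w = p + \<i> k y\<close> is easy to follow: its derivative \<open>Im (w' / w)\<close> is at least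
  \<open>k - M\<close>, where \<open>M\<close> bounds \<open>sg t\<close>. The curves \<open>Z\<close> and \<open>w\<close> never point in opposite directions, because both
  have the imaginary part \<open>y\<close> up to a positive factor, and where \<open>y = 0\<close> they have the same real part.
  Hence their phases differ by less than \<open>\<pi>\<close> up to a constant, and \<open>\<Theta>\<close> grows along the unit interval
  by at least \<open>k - M - 2 \<pi>\<close>. The phase at \<open>0\<close> is the same for all parameters.
\<close>

lemma \<Theta>_unbounded: "\<exists>l. B < \<Theta> (l, t) 1"
proof -
  obtain M where M: "\<And>x. x \<in> {0..1} \<Longrightarrow> \<bar>sg t x\<bar> \<le> M"
    using continuous_on_unit_interval_bounded[OF sg_cont[of t]] unfolding real_norm_def by blast
  have M0: "M \<ge> 0" using M[of 0] by simp
  define k where "k = max 1 (B + M + 2 * pi - \<Theta> (0, t) 0 + 1)"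
  have k1: "k \<ge> 1" by (simp add: k_def)
  define l where "l = k\<^sup>2"
  define a where "a = (l, t)"
  define w where "w = (\<lambda>x. Complex (p a x) (k * y a x))"
  define w' where "w' = (\<lambda>x. Complex (- l * y a x - sg t x * v a x) (k * v a x))"
  have wd: "(w has_vector_derivative w' x) (at x within {0..1})" if x: "x \<in> {0..1}" for x
  proof -
    have "(p a has_real_derivative - l * y a x - sg t x * v a x) (at x within {0..1})"
      using sl_systemD(2)[OF sys[of a] x] by (simp add: a_def v_def)
    moreover have "((\<lambda>x. k * y a x) has_real_derivative k * v a x) (at x within {0..1})"
      by (rule derivative_eq_intros y_deriv[OF x] refl | simp)+
    ultimately show ?thesis
      unfolding w_def w'_def by (simp add: has_vector_derivative_complex_iff)
  qed
  have wnz: "w x \<noteq> 0" if "x \<in> {0..1}" for x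
    using nonzero[OF that, of a] k1 by (auto simp: w_def complex_eq_iff)
  have wc: "continuous_on {0..1} w" unfolding w_def
    by (intro continuous_on_Complex continuous_intros p_cont y_cont)
  have w'c: "continuous_on {0..1} w'" unfolding w'_def
    by (intro continuous_on_Complex continuous_intros v_cont y_cont sg_cont)
  \<comment> \<open>\<open>L\<close> is a differentiable logarithm of \<open>w / w 0\<close>, and its imaginary part is the phase of \<open>w\<close>.\<close>
  define L where "L = (\<lambda>x. integral {0..x} (\<lambda>s. w' s / w s))"
  have Ld: "(L has_vector_derivative w' x / w x) (at x within {0..1})" if "x \<in> {0..1}" for x
    unfolding L_def by (intro integral_has_vector_derivative continuous_intros wc w'c that) (use wnz in auto)
  have Lc: "continuous_on {0..1} L"
    using Ld by (meson continuous_on_eq_continuous_within has_vector_derivative_continuous)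
  have expL: "exp (L x) = w x / w 0" if x: "x \<in> {0..1}" for x
  proof -
    have "((\<lambda>x. exp (- L x) * w x) has_vector_derivative 0) (at x within {0..1})" if x: "x \<in> {0..1}" for x
    proof -
      have "((\<lambda>x. - L x) has_vector_derivative - (w' x / w x)) (at x within {0..1})"
        by (intro has_vector_derivative_minus Ld x)
      then have "(exp \<circ> (\<lambda>x. - L x) has_vector_derivative - (w' x / w x) * exp (- L x)) (at x within {0..1})"
        by (rule field_vector_diff_chain_within) (simp add: DERIV_subset[OF DERIV_exp])
      from has_vector_derivative_mult[OF this wd[OF x]] show ?thesis
        using wnz[OF x] by (simp add: o_def)
    qed
    then obtain c where c: "\<And>x. x \<in> {0..1} \<Longrightarrow> exp (- L x) * w x = c"
      using has_vector_derivative_zero_constant[of "{0..1}" "\<lambda>x. exp (- L x) * w x"] by auto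
    have "exp (- L x) * w x = w 0" using c[OF x] c[of 0] by (simp add: L_def)
    then show ?thesis using wnz[of 0] by (simp add: exp_minus field_simps)
  qed
  have ImL: "Im (L 1) \<ge> k - M"
  proof -
    have "((\<lambda>x. Im (w' x / w x)) has_integral (Im (L 1) - Im (L 0))) {0..1}"
      by (rule ftc01) (use Ld in \<open>auto simp: has_real_derivative_iff_has_vector_derivative
            intro: bounded_linear.has_vector_derivative[OF bounded_linear_Im]\<close>)
    then have "k - M \<le> Im (L 1) - Im (L 0)"
    proof (rule has_integral_le[OF has_integral_const_real[of "k - M" 0 1, simplified]])
      fix x :: real assume x: "x \<in> {0..1}"
      define D where "D = (p a x)\<^sup>2 + (k * y a x)\<^sup>2"
      have D: "D > 0" using nonzero[OF x, of a] k1 unfolding D_def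
        by (metis mult_eq_0_iff not_one_le_zero sum_power2_gt_zero_iff)
      have "2 * \<bar>(k * y a x) * p a x\<bar> \<le> D"
        using sum_squares_bound[of "\<bar>k * y a x\<bar>" "\<bar>p a x\<bar>"] unfolding power2_abs abs_mult[symmetric] D_def by (simp add: abs_mult mult.assoc)
      then have "\<bar>sg t x\<bar> * (2 * \<bar>(k * y a x) * p a x\<bar>) \<le> M * D"
        using M[OF x] M0 by (intro mult_mono) auto
      then have "- (M * D) \<le> 2 * sg t x * ((k * y a x) * p a x)"
        using abs_ge_minus_self[of "2 * sg t x * ((k * y a x) * p a x)"]
        by (simp add: abs_mult mult_ac)
      moreover have "0 \<le> k * (sg t x)\<^sup>2 * (y a x)\<^sup>2" using k1 by simp
      ultimately have "(k - M) * D \<le> k * v a x * p a x - (- l * y a x - sg t x * v a x) * (k * y a x)"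
        unfolding D_def l_def v_def a_def snd_conv by (simp add: algebra_simps power2_eq_square)
      then show "k - M \<le> Im (w' x / w x)"
        using D unfolding Im_divide by (simp add: w_def w'_def D_def[symmetric] pos_le_divide_eq)
    qed
    then show ?thesis by (simp add: L_def)
  qed
  define r where "r = (\<lambda>x. Z a x / w x)"
  have rpos: "r x \<notin> \<real>\<^sub>\<le>\<^sub>0" if x: "x \<in> {0..1}" for x
  proof
    assume "r x \<in> \<real>\<^sub>\<le>\<^sub>0"
    then obtain c where c: "r x = of_real c" "c \<le> 0" by (auto elim: nonpos_Reals_cases)
    then have "Z a x = of_real c * w x" using wnz[OF x] by (simp add: r_def field_simps)
    then have vc: "v a x = c * p a x" and yc: "y a x = c * (k * y a x)"
      by (simp_all add: Z_def w_def complex_eq_iff)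
    have "c * k \<le> 0" using c(2) k1 by (simp add: mult_le_0_iff)
    have "(1 - c * k) * y a x = 0" using yc by (simp add: algebra_simps)
    then have y0: "y a x = 0" using \<open>c * k \<le> 0\<close> by auto
    then have "(1 - c) * p a x = 0" using vc by (simp add: v_def algebra_simps)
    then have "p a x = 0" using c(2) by auto
    then show False using y0 nonzero[OF x, of a] by simp
  qed
  have rc: "continuous_on {0..1} r" unfolding r_def
    by (intro continuous_intros wc slice(1)[OF Z_joint]) (use wnz in auto)
  have rnz: "r x \<noteq> 0" if "x \<in> {0..1}" for x using rpos[OF that] by auto
  \<comment> \<open>The principal logarithm of \<open>r\<close> accounts for the phase difference, so that \<open>cis \<circ> g\<close> is constant.\<close>
  define g where "g = (\<lambda>x. \<Theta> a x - Im (L x) - Im (Ln (r x)))"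
  have "g 1 = g 0"
  proof (rule cis_eq_imp_constant[of "{0..1}" g])
    show "continuous_on {0..1} g" unfolding g_def
      by (intro continuous_intros \<Theta>_cont Lc rc) (use rpos in auto)
    fix x :: real assume x: "x \<in> {0..1}"
    have "cis (g x) = cis (\<Theta> a x) / cis (Im (L x)) / cis (Im (Ln (r x)))"
      by (simp add: g_def cis_divide)
    also have "\<dots> = sgn (Z a x) / sgn (w x / w 0) / sgn (Z a x / w x)"
      using \<Theta>[OF x] sgn_exp[of "L x"] expL[OF x] sgn_exp[of "Ln (r x)"] rnz[OF x] by (simp add: r_def)
    also have "\<dots> = sgn (w 0)"
      using wnz[OF x] wnz[of 0] Z_nonzero[OF x, of a] by (simp add: sgn_divide sgn_zero_iff)
    finally show "cis (g x) = sgn (w 0)" .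
  qed auto
  moreover have "- pi < Im (Ln (r 1))" "Im (Ln (r 0)) \<le> pi"
    using rnz[of 1] rnz[of 0] by (auto intro: mpi_less_Im_Ln Im_Ln_le_pi)
  ultimately have "\<Theta> a 1 - \<Theta> a 0 > k - M - 2 * pi" using ImL by (simp add: g_def L_def)
  then have "B < \<Theta> a 1" using \<Theta>_init[of a "(0, t)"] by (simp add: k_def)
  then show ?thesis unfolding a_def by blast
qed

lemma boundary_condition:
  "sin (\<Theta> a 1 + \<beta>) = 0 \<longleftrightarrow> y a 1 * cos \<beta> + v a 1 * sin \<beta> = 0"
proof -
  have "y a 1 * cos \<beta> + v a 1 * sin \<beta> = cmod (Z a 1) * sin (\<Theta> a 1 + \<beta>)"
    using polar(1,2)[of 1 a] by (simp add: sin_add algebra_simps)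
  then show ?thesis using polar(3)[of 1 a] by simp
qed

lemma spectrum_iff:
  "l \<in> SL_spectrum (\<lambda>x. q x + t * h x) \<alpha> \<beta> \<longleftrightarrow> sin (\<Theta> (l, t) 1 + \<beta>) = 0"
proof -
  have "sl_system (\<lambda>x. integral {0..x} (\<lambda>x. q x + t * h x)) l (y (l, t)) (p (l, t))"
    using sl_system_cong[OF sys[of "(l, t)"]] sg_eq by simp
  from SL_spectrum_iff[OF qh this, of \<alpha> \<beta>] show ?thesis
    by (simp add: boundary_condition sg_eq v_def)
qed

text \<open>
  The boundary conditions bound the products \<open>p y\<close> at the endpoints by multiples of \<open>y\<^sup>2\<close>, as
  \<open>eigenfunction_bounds\<close> requires. If the sine of an angle vanishes, the solution vanishes at that
  endpoint, and the convention \<open>x / 0 = 0\<close> gives the correct multiple.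
\<close>

lemma uniform_bounds:
  "\<exists>C D. D \<ge> 0 \<and> (\<forall>t\<in>{-2..2}. \<forall>l. sin (\<Theta> (l, t) 1 + \<beta>) = 0 \<longrightarrow>
     - C \<le> l \<and> (\<forall>x\<in>{0..1}. (y (l, t) x)\<^sup>2 \<le> D * K (l, t) (l, t)))"
proof -
  obtain M1 where M1: "M1 \<ge> 0" "\<And>x. x \<in> {0..1} \<Longrightarrow> \<bar>sg 0 x\<bar> \<le> M1"
    using continuous_on_unit_interval_bounded[OF sg_cont[of 0]] unfolding real_norm_def by blast
  obtain M2 where M2: "M2 \<ge> 0" "\<And>x. x \<in> {0..1} \<Longrightarrow> \<bar>\<eta> x\<bar> \<le> M2"
    using continuous_on_unit_interval_bounded[OF \<eta>_cont] unfolding real_norm_def by blast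
  define M where "M = M1 + 2 * M2"
  have M0: "M \<ge> 0" using M1 M2 by (simp add: M_def)
  have M: "\<bar>sg t x\<bar> \<le> M" if "t \<in> {-2..2}" "x \<in> {0..1}" for t x
  proof -
    have "\<bar>sg t x\<bar> \<le> \<bar>sg 0 x\<bar> + \<bar>t\<bar> * \<bar>\<eta> x\<bar>"
      unfolding abs_mult[symmetric] by (simp add: sg_def)
    also have "\<dots> \<le> M1 + 2 * M2"
      using that M1 M2 by (intro add_mono mult_mono) auto
    finally show ?thesis by (simp add: M_def)
  qed
  define B where "B = \<bar>cos \<alpha> / sin \<alpha>\<bar> + \<bar>cos \<beta> / sin \<beta>\<bar> + M"
  have B0: "B \<ge> 0" using M0 by (simp add: B_def)
  have SB0: "spectral_bound M B \<ge> 0" unfolding spectral_bound_def using M0 B0 by simp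
  show ?thesis
  proof (rule exI[of _ "spectral_bound M B"], rule exI[of _ "eigfun_bound M B"], intro conjI ballI allI impI)
    show "0 \<le> eigfun_bound M B" unfolding eigfun_bound_def using SB0 by simp
    fix t l assume t: "t \<in> {-2..2}" and ev: "sin (\<Theta> (l, t) 1 + \<beta>) = 0"
    define a where "a = (l, t)"
    obtain z where z: "z \<in> {0..1}" "y a z \<noteq> 0" using y_nonzero by blast
    note s = sys[of a, unfolded a_def fst_conv snd_conv, folded a_def]
    have Mt: "\<And>x. x \<in> {0..1} \<Longrightarrow> \<bar>sg t x\<bar> \<le> M" using M[OF t] .
    have b0: "\<bar>p a 0 * y a 0\<bar> \<le> B * (y a 0)\<^sup>2"
    proof -
      have "\<bar>- cos \<alpha> * sin \<alpha>\<bar> \<le> \<bar>cos \<alpha> / sin \<alpha>\<bar> * (sin \<alpha>)\<^sup>2"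
        by (rule abs_mult_le_of_boundary_condition) auto
      also have "\<dots> \<le> B * (sin \<alpha>)\<^sup>2" by (intro mult_right_mono) (use M0 in \<open>auto simp: B_def\<close>)
      finally show ?thesis by simp
    qed
    have b1: "\<bar>p a 1 * y a 1\<bar> \<le> B * (y a 1)\<^sup>2"
    proof -
      have "\<bar>v a 1 * y a 1\<bar> \<le> \<bar>cos \<beta> / sin \<beta>\<bar> * (y a 1)\<^sup>2"
        by (rule abs_mult_le_of_boundary_condition) (use ev boundary_condition[of a] in \<open>auto simp: a_def\<close>)
      moreover have "\<bar>sg t 1 * (y a 1)\<^sup>2\<bar> \<le> M * (y a 1)\<^sup>2"
        unfolding abs_mult using Mt[of 1] by (intro mult_mono) auto
      moreover have "p a 1 * y a 1 = v a 1 * y a 1 - sg t 1 * (y a 1)\<^sup>2"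
        by (simp add: v_def a_def algebra_simps power2_eq_square)
      ultimately have "\<bar>p a 1 * y a 1\<bar> \<le> (\<bar>cos \<beta> / sin \<beta>\<bar> + M) * (y a 1)\<^sup>2"
        unfolding distrib_right by linarith
      also have "\<dots> \<le> B * (y a 1)\<^sup>2" by (intro mult_right_mono) (auto simp: B_def)
      finally show ?thesis .
    qed
    show "- spectral_bound M B \<le> l"
      by (rule eigenfunction_bounds(1)[OF s sg_cont Mt B0 b0 b1 z])
    show "(y (l, t) x)\<^sup>2 \<le> eigfun_bound M B * K (l, t) (l, t)" if x: "x \<in> {0..1}" for x
      using eigenfunction_bounds(2)[OF s sg_cont Mt B0 b0 b1 z x]
      by (simp add: a_def K_def power2_eq_square)
  qed
qed

lemma \<Theta>_joint1: "continuous_on UNIV (\<lambda>a. \<Theta> a 1)" by (rule \<Theta>_cont(2)) simp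

definition eig :: "real \<Rightarrow> nat \<Rightarrow> real \<Rightarrow> real" where
  "eig \<beta> n t = SL_eigenvalue (\<lambda>x. q x + t * h x) \<alpha> \<beta> n"

text \<open>
  No eigenvalue lies below \<open>- C\<close>, whatever \<open>t\<close> is. On the connected set of parameters with \<open>l \<le> - C - 1\<close> the
  shifted phase therefore stays between two consecutive multiples of \<open>\<pi>\<close>, and the phase of the lowest
  eigenvalue is the same for all \<open>t\<close>. The range of \<open>t\<close> is chosen to contain neighbourhoods of \<open>0\<close> and \<open>1\<close>.
\<close>

lemma eig_phase:
  "\<exists>k::int. \<forall>t\<in>{-2..2}. \<forall>n l. \<Theta> (l, t) 1 + \<beta> = of_int (k + int n) * pi \<longleftrightarrow> l = eig \<beta> n t"
proof -
  obtain C D where CD: "\<And>t l. t \<in> {-2..2} \<Longrightarrow> sin (\<Theta> (l, t) 1 + \<beta>) = 0 \<Longrightarrow> - C \<le> l"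
    using uniform_bounds[of \<beta>] by blast
  define R where "R = {.. - C - 1} \<times> {-2..2::real}"
  have "connected R" unfolding R_def by (intro convex_connected convex_Times) auto
  moreover have "continuous_on R (\<lambda>a. \<Theta> a 1 + \<beta>)"
    by (intro continuous_intros continuous_on_subset[OF \<Theta>_joint1]) auto
  moreover have "sin (\<Theta> a 1 + \<beta>) \<noteq> 0" if "a \<in> R" for a
    using CD[of "snd a" "fst a"] that by (auto simp: R_def)
  ultimately obtain j :: int where j: "\<And>a. a \<in> R \<Longrightarrow> of_int j * pi < \<Theta> a 1 + \<beta> \<and> \<Theta> a 1 + \<beta> < of_int (j + 1) * pi"
    using sin_nonzero_imp_between_multiples[of R "\<lambda>a. \<Theta> a 1 + \<beta>"] by blast
  show ?thesis
  proof (intro exI[of _ "j + 1"] ballI allI)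
    fix t :: real and n l assume t: "t \<in> {-2..2}"
    have pc: "continuous_on UNIV (\<lambda>l::real. (l, t))" by (intro continuous_intros)
    show "\<Theta> (l, t) 1 + \<beta> = of_int (j + 1 + int n) * pi \<longleftrightarrow> l = eig \<beta> n t"
      unfolding eig_def SL_eigenvalue_def
    proof (rule nth_zero_of_sine_phase)
      show "strict_mono (\<lambda>l. \<Theta> (l, t) 1 + \<beta>)"
        using \<Theta>_strict_mono[of t] by (auto simp: strict_mono_def)
      show "continuous_on UNIV (\<lambda>l. \<Theta> (l, t) 1 + \<beta>)"
        by (intro continuous_intros continuous_on_compose2[OF \<Theta>_joint1 pc]) auto
      show "\<exists>l. B < \<Theta> (l, t) 1 + \<beta>" for B using \<Theta>_unbounded[of "B - \<beta>" t] by (auto simp: algebra_simps)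
      show "\<Theta> (- C - 1, t) 1 + \<beta> < of_int (j + 1) * pi" using j[of "(- C - 1, t)"] t by (simp add: R_def)
      show "of_int (j + 1 - 1) * pi < \<Theta> (l, t) 1 + \<beta>" for l
      proof (cases "l \<le> - C - 1")
        case True
        then show ?thesis using j[of "(l, t)"] t by (simp add: R_def)
      next
        case False
        then show ?thesis
          using j[of "(- C - 1, t)"] t strict_monoD[OF \<Theta>_strict_mono[of t], of "- C - 1" l] by (simp add: R_def)
      qed
      show "SL_spectrum (\<lambda>x. q x + t * h x) \<alpha> \<beta> = {l. sin (\<Theta> (l, t) 1 + \<beta>) = 0}"
        using spectrum_iff by auto
    qed
  qed
qed

lemma eig_phase_value: "\<exists>c. \<forall>t\<in>{-2..2}. \<Theta> (eig \<beta> n t, t) 1 = c"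
proof -
  obtain k :: int where "\<And>t. t \<in> {-2..2} \<Longrightarrow> \<Theta> (eig \<beta> n t, t) 1 + \<beta> = of_int (k + int n) * pi"
    using eig_phase[of \<beta>] by blast
  then show ?thesis by (intro exI[of _ "of_int (k + int n) * pi - \<beta>"]) (auto simp: eq_diff_eq)
qed

lemma eig_boundary_condition:
  assumes "t \<in> {-2..2}"
  shows "sin (\<Theta> (eig \<beta> n t, t) 1 + \<beta>) = 0"
  using eig_phase[of \<beta>] assms sin_zero_iff_int2 by metis

lemma eig_inj:
  assumes "t \<in> {-2..2}" "eig \<beta> n t = eig \<beta> m t"
  shows "n = m"
proof -
  obtain k :: int where "\<And>n l. \<Theta> (l, t) 1 + \<beta> = of_int (k + int n) * pi \<longleftrightarrow> l = eig \<beta> n t"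
    using eig_phase[of \<beta>] assms by blast
  then have "of_int (k + int n) * pi = of_int (k + int m) * pi" using assms(2) by metis
  then show ?thesis by simp
qed

text \<open>
  The equation \<open>\<Theta> = c\<close> has a unique solution \<open>l\<close> for each \<open>t\<close>, and the signs of \<open>\<Theta> - c\<close> at \<open>l - e\<close> and
  \<open>l + e\<close> persist under small changes of \<open>t\<close>.
\<close>

lemma eig_isCont:
  assumes t: "t \<in> {-2<..<2}"
  shows "isCont (eig \<beta> n) t"
proof -
  obtain c where c: "\<And>t. t \<in> {-2..2} \<Longrightarrow> \<Theta> (eig \<beta> n t, t) 1 = c" using eig_phase_value[of \<beta> n] by blast
  have "\<forall>\<^sub>F s in at t. dist (eig \<beta> n s) (eig \<beta> n t) < e" if e: "e > 0" for e
  proof -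
    have pc: "continuous_on UNIV (\<lambda>s::real. (l::real, s))" for l by (intro continuous_intros)
    have cc: "((\<lambda>s. \<Theta> (l, s) 1) \<longlongrightarrow> \<Theta> (l, t) 1) (at t)" for l
      using continuous_on_compose2[OF \<Theta>_joint1 pc[of l]] by (simp add: continuous_on_def)
    have "\<Theta> (eig \<beta> n t - e, t) 1 < c" "c < \<Theta> (eig \<beta> n t + e, t) 1"
      using strict_monoD[OF \<Theta>_strict_mono[of t], of "eig \<beta> n t - e" "eig \<beta> n t"]
        strict_monoD[OF \<Theta>_strict_mono[of t], of "eig \<beta> n t" "eig \<beta> n t + e"] e c[of t] t by auto
    then have "\<forall>\<^sub>F s in at t. \<Theta> (eig \<beta> n t - e, s) 1 < c" "\<forall>\<^sub>F s in at t. c < \<Theta> (eig \<beta> n t + e, s) 1"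
      using order_tendstoD[OF cc] by blast+
    moreover have "\<forall>\<^sub>F s in at t. s \<in> {-2<..<2}"
      using t by (intro eventually_at_in_open') auto
    ultimately show ?thesis
    proof eventually_elim
      case (elim s)
      have "\<Theta> (eig \<beta> n s, s) 1 = c" using c[of s] elim(3) by simp
      then have "eig \<beta> n t - e < eig \<beta> n s" "eig \<beta> n s < eig \<beta> n t + e"
        using elim strict_mono_less[OF \<Theta>_strict_mono[of s]] by auto
      then show ?case by (simp add: dist_real_def abs_less_iff)
    qed
  qed
  then show ?thesis unfolding isCont_def by (rule tendstoI)
qed

text \<open>
  The derivative \<open>\<integral>h y\<^sup>2 / \<integral>y\<^sup>2\<close> of an eigenvalue with respect to \<open>t\<close>.
\<close>

definition drv :: "real \<times> real \<Rightarrow> real" where "drv a = H a a / K a a"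

text \<open>
  Eigenfunctions for different \<open>t\<close> have the same phase at \<open>1\<close>, so their Wronskian vanishes there. The
  Wronskian identity then gives the difference quotient of the eigenvalue as \<open>H / K\<close>, and both integrals
  are continuous in the parameter.
\<close>

lemma eig_derivative:
  assumes t: "t \<in> {-2<..<2}"
  shows "(eig \<beta> n has_real_derivative drv (eig \<beta> n t, t)) (at t)"
proof -
  define a where "a = (\<lambda>s. (eig \<beta> n s, s))"
  have ac: "(a \<longlongrightarrow> a t) (at t)"
    using eig_isCont[OF t] unfolding a_def isCont_def by (intro tendsto_intros) auto
  have Kc: "((\<lambda>s. K (a s) (a t)) \<longlongrightarrow> K (a t) (a t)) (at t)"
    and Hc: "((\<lambda>s. H (a s) (a t)) \<longlongrightarrow> H (a t) (a t)) (at t)"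
    by (rule continuous_on_tendsto_compose[OF K_cont ac]; simp)
       (rule continuous_on_tendsto_compose[OF H_cont ac]; simp)
  have phase: "\<Theta> (a s) 1 = \<Theta> (a t) 1" if "s \<in> {-2..2}" for s
    using eig_phase_value[of \<beta> n] that t unfolding a_def by force
  have eq: "(eig \<beta> n s - eig \<beta> n t) * K (a s) (a t) = (s - t) * H (a s) (a t)" if "s \<in> {-2..2}" for s
    using wronskian[of "a s" "a t"] wronskian_polar[of "a s" "a t"] phase[OF that]
    by (simp add: a_def algebra_simps)
  have "((\<lambda>s. H (a s) (a t) / K (a s) (a t)) \<longlongrightarrow> H (a t) (a t) / K (a t) (a t)) (at t)"
    using K_pos[of "a t"] by (intro tendsto_divide Hc Kc) auto
  moreover have "\<forall>\<^sub>F s in at t. H (a s) (a t) / K (a s) (a t) = (eig \<beta> n s - eig \<beta> n t) / (s - t)"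
  proof -
    have "\<forall>\<^sub>F s in at t. K (a s) (a t) > 0" by (rule order_tendstoD(1)[OF Kc K_pos])
    moreover have "\<forall>\<^sub>F s in at t. s \<in> {-2<..<2}" using t by (intro eventually_at_in_open') auto
    moreover have "\<forall>\<^sub>F s in at t. s \<noteq> t" by (simp add: eventually_at_filter)
    ultimately show ?thesis
    proof eventually_elim
      case (elim s)
      then show ?case using eq[of s] by (simp add: frac_eq_eq mult.commute)
    qed
  qed
  ultimately have "((\<lambda>s. (eig \<beta> n s - eig \<beta> n t) / (s - t)) \<longlongrightarrow> H (a t) (a t) / K (a t) (a t)) (at t)"
    by (rule Lim_transform_eventually)
  then show ?thesis by (simp add: has_field_derivative_iff drv_def a_def)
qed

lemma drv_bound:
  "\<exists>L\<ge>0. \<forall>n. \<forall>t\<in>{-2..2}. \<bar>drv (eig \<beta> n t, t)\<bar> \<le> L"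
proof -
  obtain C D where D: "D \<ge> 0" "\<And>t l x. t \<in> {-2..2} \<Longrightarrow> sin (\<Theta> (l, t) 1 + \<beta>) = 0 \<Longrightarrow> x \<in> {0..1} \<Longrightarrow>
      (y (l, t) x)\<^sup>2 \<le> D * K (l, t) (l, t)"
    using uniform_bounds[of \<beta>] by blast
  have ha: "(\<lambda>x. \<bar>h x\<bar>) integrable_on {0..1}"
    using set_lebesgue_integral_eq_integral(1)[OF absolutely_integrable_norm[OF h]] by (simp add: o_def)
  show ?thesis
  proof (intro exI[of _ "D * integral {0..1} (\<lambda>x. \<bar>h x\<bar>)"] conjI allI ballI)
    show "0 \<le> D * integral {0..1} (\<lambda>x. \<bar>h x\<bar>)"
      using D(1) ha by (intro mult_nonneg_nonneg Henstock_Kurzweil_Integration.integral_nonneg) auto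
    fix n t assume t: "t \<in> {-2..2::real}"
    define a where "a = (eig \<beta> n t, t)"
    have "\<bar>H a a\<bar> \<le> integral {0..1} (\<lambda>x. D * K a a * \<bar>h x\<bar>)"
      unfolding H_eq
    proof (rule integral_abs_bound_integral)
      show "(\<lambda>x. h x * (y a x * y a x)) integrable_on {0..1}"
        by (intro set_lebesgue_integral_eq_integral(1) absolutely_integrable_times_continuous h
            continuous_intros y_cont)
      show "(\<lambda>x. D * K a a * \<bar>h x\<bar>) integrable_on {0..1}" by (intro integrable_on_mult_right ha)
      fix x :: real assume x: "x \<in> {0..1}"
      have "(y a x)\<^sup>2 \<le> D * K a a"
        using D(2)[OF t eig_boundary_condition[OF t] x] by (simp add: a_def)
      then have "(y a x)\<^sup>2 * \<bar>h x\<bar> \<le> D * K a a * \<bar>h x\<bar>" by (rule mult_right_mono) auto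
      then show "\<bar>h x * (y a x * y a x)\<bar> \<le> D * K a a * \<bar>h x\<bar>"
        by (simp add: abs_mult power2_eq_square mult_ac)
    qed
    then have "\<bar>H a a\<bar> \<le> D * integral {0..1} (\<lambda>x. \<bar>h x\<bar>) * K a a" by (simp add: mult_ac)
    then show "\<bar>drv (eig \<beta> n t, t)\<bar> \<le> D * integral {0..1} (\<lambda>x. \<bar>h x\<bar>)"
      using K_pos[of a] by (simp add: drv_def abs_divide pos_divide_le_eq flip: a_def)
  qed
qed

lemma eig_lipschitz:
  "\<exists>L\<ge>0. \<forall>n. \<forall>s\<in>{-2<..<2}. \<forall>t\<in>{-2<..<2}. \<bar>eig \<beta> n s - eig \<beta> n t\<bar> \<le> L * \<bar>s - t\<bar>"
proof -
  obtain L where L: "L \<ge> 0" "\<And>n t. t \<in> {-2..2} \<Longrightarrow> \<bar>drv (eig \<beta> n t, t)\<bar> \<le> L"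
    using drv_bound[of \<beta>] by blast
  have "\<bar>eig \<beta> n s - eig \<beta> n t\<bar> \<le> L * \<bar>s - t\<bar>" if "s \<in> {-2<..<2}" "t \<in> {-2<..<2}" for n s t
  proof -
    have "norm (eig \<beta> n s - eig \<beta> n t) \<le> L * norm (s - t)"
    proof (rule field_differentiable_bound)
      show "convex {-2<..<2::real}" by simp
      show "(eig \<beta> n has_real_derivative drv (eig \<beta> n z, z)) (at z within {-2<..<2})"
        if "z \<in> {-2<..<2}" for z
        using eig_derivative[OF that] by (rule has_field_derivative_at_within)
    qed (use L that in auto)
    then show ?thesis by simp
  qed
  then show ?thesis using L(1) by blast
qed

end

section \<open>Termwise limits of infinite sums\<close>

lemma summable_on_dominated:
  fixes g M :: "'a \<Rightarrow> real"
  assumes "M summable_on I" "\<And>z. z \<in> I \<Longrightarrow> \<bar>g z\<bar> \<le> M z"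
  shows "g summable_on I"
proof (rule abs_summable_summable)
  show "(\<lambda>z. norm (g z)) summable_on I"
    by (rule summable_on_comparison_test[OF assms(1)]) (use assms(2) in auto)
qed

lemma infsum_dominated_convergence:
  fixes f :: "'a \<Rightarrow> 'b \<Rightarrow> real"
  assumes lim: "\<And>z. z \<in> I \<Longrightarrow> (f z \<longlongrightarrow> g z) G"
    and ev: "\<forall>\<^sub>F t in G. t \<in> S" and G: "G \<noteq> bot"
    and M: "\<And>z t. z \<in> I \<Longrightarrow> t \<in> S \<Longrightarrow> \<bar>f z t\<bar> \<le> M z" "M summable_on I"
  shows "((\<lambda>t. infsum (\<lambda>z. f z t) I) \<longlongrightarrow> infsum g I) G"
proof (rule swap_uniform_limit')
  have gM: "\<bar>g z\<bar> \<le> M z" if "z \<in> I" for z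
  proof (rule tendsto_upperbound[OF _ _ G])
    show "((\<lambda>t. \<bar>f z t\<bar>) \<longlongrightarrow> \<bar>g z\<bar>) G" by (intro tendsto_intros lim that)
    show "\<forall>\<^sub>F t in G. \<bar>f z t\<bar> \<le> M z" using ev by eventually_elim (rule M(1)[OF that])
  qed
  show "((\<lambda>X. sum g X) \<longlongrightarrow> infsum g I) (finite_subsets_at_top I)"
    using has_sum_infsum[OF summable_on_dominated[OF M(2) gM]] by (simp add: has_sum_def)
  show "uniform_limit S (\<lambda>X t. \<Sum>z\<in>X. f z t) (\<lambda>t. infsum (\<lambda>z. f z t) I) (finite_subsets_at_top I)"
    by (rule Weierstrass_m_test_general[OF _ M(2)]) (use M(1) in auto)
  show "\<forall>\<^sub>F X in finite_subsets_at_top I. ((\<lambda>t. \<Sum>z\<in>X. f z t) \<longlongrightarrow> sum g X) G"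
    using eventually_finite_subsets_at_top_weakI[of I "\<lambda>X. ((\<lambda>t. \<Sum>z\<in>X. f z t) \<longlongrightarrow> sum g X) G"] lim
    by (auto intro!: tendsto_sum)
  show "\<forall>\<^sub>F t in G. t \<in> S" by (rule ev)
qed simp

lemma has_real_derivative_infsum:
  fixes f :: "'a \<Rightarrow> real \<Rightarrow> real"
  assumes d: "\<And>z. z \<in> I \<Longrightarrow> (f z has_real_derivative f' z) (at 0)"
    and M: "\<And>z t. z \<in> I \<Longrightarrow> \<bar>t\<bar> < 1 \<Longrightarrow> \<bar>f z t - f z 0\<bar> \<le> M z * \<bar>t\<bar>" "M summable_on I"
    and f0: "(\<lambda>z. f z 0) summable_on I"
  shows "((\<lambda>t. infsum (\<lambda>z. f z t) I) has_real_derivative infsum f' I) (at 0)"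
proof -
  have "((\<lambda>t. infsum (\<lambda>z. (f z t - f z 0) / t) I) \<longlongrightarrow> infsum f' I) (at 0)"
  proof (rule infsum_dominated_convergence[OF _ _ _ _ M(2)])
    show "((\<lambda>t. (f z t - f z 0) / t) \<longlongrightarrow> f' z) (at 0)" if "z \<in> I" for z
      using d[OF that] by (simp add: has_field_derivative_iff)
    show "\<forall>\<^sub>F t in at 0. t \<in> {t::real. t \<noteq> 0 \<and> \<bar>t\<bar> < 1}"
      unfolding eventually_at by (rule exI[of _ 1]) auto
    show "\<bar>(f z t - f z 0) / t\<bar> \<le> M z" if "z \<in> I" "t \<in> {t::real. t \<noteq> 0 \<and> \<bar>t\<bar> < 1}" for z t
      using M(1)[of z t] that by (auto simp: abs_divide pos_divide_le_eq)
  qed simp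
  moreover have "\<forall>\<^sub>F t in at 0. infsum (\<lambda>z. (f z t - f z 0) / t) I
      = (infsum (\<lambda>z. f z t) I - infsum (\<lambda>z. f z 0) I) / t"
  proof -
    have "\<forall>\<^sub>F t in at 0. t \<in> {t::real. \<bar>t\<bar> < 1}"
      unfolding eventually_at by (rule exI[of _ 1]) auto
    then show ?thesis
    proof eventually_elim
      case (elim t)
      have s: "(\<lambda>z. f z t - f z 0) summable_on I"
        by (rule summable_on_dominated[OF summable_on_cmult_left[OF M(2), of "\<bar>t\<bar>"]]) (use M(1) elim in auto)
      have "infsum (\<lambda>z. (f z t - f z 0) + f z 0) I = infsum (\<lambda>z. f z t - f z 0) I + infsum (\<lambda>z. f z 0) I"
        by (rule infsum_add[OF s f0])
      then show ?case using infsum_cmult_right'[of "1 / t" "\<lambda>z. f z t - f z 0" I] by simp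
    qed
  qed
  ultimately have "((\<lambda>t. (infsum (\<lambda>z. f z t) I - infsum (\<lambda>z. f z 0) I) / (t - 0)) \<longlongrightarrow> infsum f' I) (at 0)"
    by (simp add: Lim_transform_eventually)
  then show ?thesis unfolding has_field_derivative_iff .
qed

section \<open>Directions in the Sobolev space\<close>

lemma continuous_imp_measurable_leb01:
  "continuous_on {0..1} f \<Longrightarrow> f \<in> borel_measurable leb01" for f :: "real \<Rightarrow> real"
  by (rule continuous_imp_measurable_on_sets_lebesgue) auto

lemma continuous_imp_L2: "continuous_on {0..1} f \<Longrightarrow> f \<in> L2"
  unfolding L2_def
  by (auto simp: integrable_lebesgue_on_iff intro!: continuous_imp_measurable_leb01
      absolutely_integrable_continuous_real continuous_intros)

lemma L2_add:
  assumes "f \<in> L2" "g \<in> L2"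
  shows "(\<lambda>x. f x + g x) \<in> L2"
proof -
  have m: "f \<in> borel_measurable leb01" "g \<in> borel_measurable leb01"
    and i: "integrable leb01 (\<lambda>x. (f x)\<^sup>2)" "integrable leb01 (\<lambda>x. (g x)\<^sup>2)"
    using assms by (auto simp: L2_def)
  have "integrable leb01 (\<lambda>x. (f x + g x)\<^sup>2)"
  proof (rule Bochner_Integration.integrable_bound)
    show "integrable leb01 (\<lambda>x. 2 * (f x)\<^sup>2 + 2 * (g x)\<^sup>2)" using i by auto
    have "(a + b)\<^sup>2 \<le> 2 * a\<^sup>2 + 2 * b\<^sup>2" for a b :: real
      using sum_squares_bound[of a b] by (simp add: power2_sum)
    then show "AE x in leb01. norm ((f x + g x)\<^sup>2) \<le> norm (2 * (f x)\<^sup>2 + 2 * (g x)\<^sup>2)" by auto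
  qed (use m in measurable)
  then show ?thesis using m unfolding L2_def by auto
qed

lemma L2_mult_continuous:
  assumes "f \<in> L2" "continuous_on {0..1} g"
  shows "(\<lambda>x. f x * g x) \<in> L2"
proof -
  have "(\<lambda>x. (f x)\<^sup>2) absolutely_integrable_on {0..1}"
    using assms(1) by (simp add: L2_def integrable_lebesgue_on_iff)
  then have "(\<lambda>x. (f x)\<^sup>2 * (g x)\<^sup>2) absolutely_integrable_on {0..1}"
    by (rule absolutely_integrable_times_continuous) (intro continuous_intros assms)
  then have "integrable leb01 (\<lambda>x. (f x * g x)\<^sup>2)"
    by (simp add: integrable_lebesgue_on_iff power_mult_distrib)
  moreover have "(\<lambda>x. f x * g x) \<in> borel_measurable leb01"
    using assms(1) continuous_imp_measurable_leb01[OF assms(2)] by (auto simp: L2_def)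
  ultimately show ?thesis by (simp add: L2_def)
qed

lemma L2_add_scaled: "f \<in> L2 \<Longrightarrow> g \<in> L2 \<Longrightarrow> (\<lambda>x. f x + t * g x) \<in> L2"
  using L2_add[OF _ L2_mult_continuous[of g "\<lambda>_. t"]] by (simp add: mult.commute)

lemma test_functionsD:
  assumes "\<phi> \<in> test_functions"
  shows "(\<phi> has_real_derivative deriv \<phi> x) (at x within S)" "continuous_on S (deriv \<phi>)"
    "\<phi> 0 = 0" "\<phi> 1 = 0"
proof -
  have d: "(deriv ^^ k) \<phi> differentiable (at x)" for k x using assms by (auto simp: test_functions_def)
  show "(\<phi> has_real_derivative deriv \<phi> x) (at x within S)"
    using d[of 0 x] by (auto simp: DERIV_deriv_iff_real_differentiable intro: has_field_derivative_at_within)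
  have "deriv \<phi> differentiable (at x)" for x using d[of 1 x] by simp
  then show "continuous_on S (deriv \<phi>)"
    by (intro continuous_at_imp_continuous_on ballI differentiable_imp_continuous_within)
  have "closure {x. \<phi> x \<noteq> 0} \<subseteq> {0<..<1}" using assms by (auto simp: test_functions_def)
  then have "{x. \<phi> x \<noteq> 0} \<subseteq> {0<..<1}" by (rule order_trans[OF closure_subset])
  then show "\<phi> 0 = 0" "\<phi> 1 = 0" by auto
qed

text \<open>
  A product of two solutions has the derivative \<open>F + \<sigma> f\<close> with continuously differentiable \<open>F\<close> and \<open>f\<close>.
  It has the square integrable weak derivative \<open>F' + \<sigma> f' + q f\<close>, by the product rule applied to \<open>\<sigma>\<close> and
  \<open>f \<phi>\<close>, where \<open>\<phi>\<close> is a test function.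
\<close>

lemma H1_I:
  fixes q F F' f f' :: "real \<Rightarrow> real"
  assumes q: "q \<in> L2"
    and F: "\<And>x. x \<in> {0..1} \<Longrightarrow> (F has_real_derivative F' x) (at x within {0..1})" "continuous_on {0..1} F'"
    and f: "\<And>x. x \<in> {0..1} \<Longrightarrow> (f has_real_derivative f' x) (at x within {0..1})" "continuous_on {0..1} f'"
  shows "(\<lambda>x. F x + integral {0..x} q * f x) \<in> H1"
proof -
  define \<sigma> where "\<sigma> = (\<lambda>x. integral {0..x} q)"
  have qa: "q absolutely_integrable_on {0..1}" by (rule L2_absolutely_integrable[OF q])
  have \<sigma>c: "continuous_on {0..1} \<sigma>" unfolding \<sigma>_def by (rule continuous_on_indefinite_integral[OF qa])
  have Fc: "continuous_on {0..1} F" by (rule DERIV_continuous_on) (rule F)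
  have fc: "continuous_on {0..1} f" by (rule DERIV_continuous_on) (rule f)
  have hL: "(\<lambda>x. F x + \<sigma> x * f x) \<in> L2" by (intro continuous_imp_L2 continuous_intros Fc fc \<sigma>c)
  have gL: "(\<lambda>x. (F' x + \<sigma> x * f' x) + q x * f x) \<in> L2"
    by (intro L2_add L2_mult_continuous q continuous_imp_L2 continuous_intros F f fc \<sigma>c)
  have "weak_deriv (\<lambda>x. F x + \<sigma> x * f x) (\<lambda>x. (F' x + \<sigma> x * f' x) + q x * f x)"
    unfolding weak_deriv_def
  proof
    fix \<phi> assume "\<phi> \<in> test_functions"
    note \<phi> = test_functionsD[OF this]
    have \<phi>c: "continuous_on {0..1} \<phi>" by (rule DERIV_continuous_on) (rule \<phi>(1))
    have a1: "(\<lambda>x. (F x + \<sigma> x * f x) * deriv \<phi> x) absolutely_integrable_on {0..1}"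
      by (intro absolutely_integrable_continuous_real continuous_intros Fc fc \<sigma>c \<phi>(2))
    have a2: "(\<lambda>x. ((F' x + \<sigma> x * f' x) + q x * f x) * \<phi> x) absolutely_integrable_on {0..1}"
      by (rule absolutely_integrable_times_continuous[OF L2_absolutely_integrable[OF gL] \<phi>c])
    have i1: "((\<lambda>x. F' x * \<phi> x + F x * deriv \<phi> x) has_integral (F 1 * \<phi> 1 - F 0 * \<phi> 0)) {0..1}"
      by (rule ftc01) (rule derivative_eq_intros F(1) \<phi>(1) refl | assumption | simp add: algebra_simps)+
    have i2: "integral {0..1} (\<lambda>x. q x * (f x * \<phi> x)) = integral {0..1} q * (f 1 * \<phi> 1)
        - integral {0..1} (\<lambda>x. \<sigma> x * (f' x * \<phi> x + f x * deriv \<phi> x))"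
      unfolding \<sigma>_def
      by (rule indefinite_integral_product_rule[OF qa])
         (rule derivative_eq_intros f(1) \<phi>(1) refl continuous_intros f(2) fc \<phi>c \<phi>(2)
           | assumption | simp add: algebra_simps)+
    have j1: "(\<lambda>x. q x * (f x * \<phi> x)) integrable_on {0..1}"
      by (intro set_lebesgue_integral_eq_integral(1) absolutely_integrable_times_continuous qa continuous_intros fc \<phi>c)
    have j2: "(\<lambda>x. \<sigma> x * (f' x * \<phi> x + f x * deriv \<phi> x)) integrable_on {0..1}"
      by (intro integrable_continuous_real continuous_intros \<sigma>c f(2) \<phi>c fc \<phi>(2))
    have "((\<lambda>x. (F' x * \<phi> x + F x * deriv \<phi> x) +
        (q x * (f x * \<phi> x) + \<sigma> x * (f' x * \<phi> x + f x * deriv \<phi> x))) has_integral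
        (F 1 * \<phi> 1 - F 0 * \<phi> 0) + (integral {0..1} (\<lambda>x. q x * (f x * \<phi> x))
         + integral {0..1} (\<lambda>x. \<sigma> x * (f' x * \<phi> x + f x * deriv \<phi> x)))) {0..1}"
      by (intro has_integral_add i1 integrable_integral j1 j2)
    then have s: "((\<lambda>x. (F x + \<sigma> x * f x) * deriv \<phi> x + ((F' x + \<sigma> x * f' x) + q x * f x) * \<phi> x) has_integral 0) {0..1}"
      using i2 \<phi>(3,4) by (simp add: algebra_simps)
    have "integral {0..1} (\<lambda>x. (F x + \<sigma> x * f x) * deriv \<phi> x)
        + integral {0..1} (\<lambda>x. ((F' x + \<sigma> x * f' x) + q x * f x) * \<phi> x) = 0"
      using integral_unique[OF s]
        Henstock_Kurzweil_Integration.integral_add[OF set_lebesgue_integral_eq_integral(1)[OF a1] set_lebesgue_integral_eq_integral(1)[OF a2]]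
      by simp
    then show "(LINT x|leb01. (F x + \<sigma> x * f x) * deriv \<phi> x)
       = - (LINT x|leb01. ((F' x + \<sigma> x * f' x) + q x * f x) * \<phi> x)"
      unfolding lebesgue_on_integral_eq[OF a1] lebesgue_on_integral_eq[OF a2] by simp
  qed
  then have "(\<lambda>x. F x + \<sigma> x * f x) \<in> H1" using hL gL unfolding H1_def by blast
  then show ?thesis by (simp add: \<sigma>_def)
qed

lemma smooth_in_H1:
  assumes "\<And>x. x \<in> {0..1} \<Longrightarrow> (F has_real_derivative F' x) (at x within {0..1})" "continuous_on {0..1} F'"
  shows "F \<in> H1"
  using H1_I[of "\<lambda>_. 0" F F' "\<lambda>_. 0" "\<lambda>_. 0"] assms continuous_imp_L2[of "\<lambda>_. 0"] by simp

text \<open>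
  Integration by parts leaves the error \<open>\<integral>x\<^bsup>k+1\<^esup> f'\<close>, which is of order \<open>1 / (k + 1)\<close>.
\<close>

lemma concentration_at_1:
  fixes f f' :: "real \<Rightarrow> real"
  assumes f: "\<And>x. x \<in> {0..1} \<Longrightarrow> (f has_real_derivative f' x) (at x within {0..1})" "continuous_on {0..1} f'"
  shows "(\<lambda>k. integral {0..1} (\<lambda>x. real (Suc k) * x ^ k * f x)) \<longlonglongrightarrow> f 1"
proof -
  have fc: "continuous_on {0..1} f" by (rule DERIV_continuous_on) (rule f)
  obtain V where V: "\<And>x. x \<in> {0..1} \<Longrightarrow> \<bar>f' x\<bar> \<le> V"
    using continuous_on_unit_interval_bounded[OF f(2)] unfolding real_norm_def by blast
  have main: "\<bar>integral {0..1} (\<lambda>x. real (Suc k) * x ^ k * f x) - f 1\<bar> \<le> V * inverse (real (Suc k))" for k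
  proof -
    have "((\<lambda>x. real (Suc k) * x ^ k * f x + x ^ Suc k * f' x) has_integral (1 ^ Suc k * f 1 - 0 ^ Suc k * f 0)) {0..1}"
      by (rule ftc01) (rule derivative_eq_intros f(1) refl | assumption | simp del: of_nat_Suc)+
    then have "integral {0..1} (\<lambda>x. real (Suc k) * x ^ k * f x) + integral {0..1} (\<lambda>x. x ^ Suc k * f' x) = f 1"
      by (subst Henstock_Kurzweil_Integration.integral_add[symmetric])
         (auto intro!: integrable_continuous_real continuous_intros fc f(2) simp: integral_unique simp del: of_nat_Suc)
    then have "\<bar>integral {0..1} (\<lambda>x. real (Suc k) * x ^ k * f x) - f 1\<bar> = \<bar>integral {0..1} (\<lambda>x. x ^ Suc k * f' x)\<bar>"
      by linarith
    also have "\<dots> \<le> integral {0..1} (\<lambda>x. V * x ^ k)"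
    proof (rule integral_abs_bound_integral)
      fix x :: real assume x: "x \<in> {0..1}"
      have "x ^ Suc k \<le> x ^ k" using x by (intro power_decreasing) auto
      then have "x ^ Suc k * \<bar>f' x\<bar> \<le> x ^ k * V" using x V[OF x] by (intro mult_mono) auto
      then show "\<bar>x ^ Suc k * f' x\<bar> \<le> V * x ^ k" using x by (simp add: abs_mult power_abs mult.commute)
    qed (auto intro!: integrable_continuous_real continuous_intros f(2))
    also have "\<dots> = V * inverse (real (Suc k))"
    proof -
      have "((\<lambda>x. V * x ^ k) has_integral (V * (1 ^ Suc k / real (Suc k)) - V * (0 ^ Suc k / real (Suc k)))) {0..1}"
        by (rule ftc01) (rule derivative_eq_intros refl | simp del: of_nat_Suc)+
      from integral_unique[OF this] show ?thesis by (simp add: divide_inverse)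
    qed
    finally show ?thesis .
  qed
  have "(\<lambda>k. V * inverse (real (Suc k))) \<longlonglongrightarrow> V * 0"
    by (intro tendsto_intros LIMSEQ_inverse_real_of_nat)
  then have z: "(\<lambda>k. V * inverse (real (Suc k))) \<longlonglongrightarrow> 0" by simp
  have "(\<lambda>k. integral {0..1} (\<lambda>x. real (Suc k) * x ^ k * f x) - f 1) \<longlonglongrightarrow> 0"
    by (rule Lim_null_comparison[OF _ z]) (use main in simp)
  then show ?thesis by (simp add: LIM_zero_iff)
qed

lemma integral_reflect01: "integral {0..1} (\<lambda>x. f (1 - x)) = integral {0..1::real} f" for f :: "real \<Rightarrow> real"
proof -
  have "integral {0..1} (\<lambda>x. f (1 - x)) = integral {-1..0} (\<lambda>x. f (1 + x))"
    using Henstock_Kurzweil_Integration.integral_reflect_real[of 0 "-1" "\<lambda>x. f (1 + x)"] by simp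
  also have "\<dots> = integral {0..1} f"
    using integral_shift_Icc_real[of "-1" 0 f 1] by (simp add: o_def)
  finally show ?thesis .
qed

lemma concentration_at_0:
  fixes f f' :: "real \<Rightarrow> real"
  assumes f: "\<And>x. x \<in> {0..1} \<Longrightarrow> (f has_real_derivative f' x) (at x within {0..1})" "continuous_on {0..1} f'"
  shows "(\<lambda>k. integral {0..1} (\<lambda>x. real (Suc k) * (1 - x) ^ k * f x)) \<longlonglongrightarrow> f 0"
proof -
  have "(\<lambda>k. integral {0..1} (\<lambda>x. real (Suc k) * x ^ k * f (1 - x))) \<longlonglongrightarrow> f (1 - 1)"
  proof (rule concentration_at_1[OF has_real_derivative_reflect01[OF f(1)]])
    show "continuous_on {0..1} (\<lambda>x. - f' (1 - x))"
      by (intro continuous_intros continuous_on_compose2[OF f(2)]) auto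
  qed
  moreover have "integral {0..1} (\<lambda>x. real (Suc k) * x ^ k * f (1 - x))
      = integral {0..1} (\<lambda>x. real (Suc k) * (1 - x) ^ k * f x)" for k
    using integral_reflect01[of "\<lambda>x. real (Suc k) * (1 - x) ^ k * f x"] by simp
  ultimately show ?thesis by simp
qed

section \<open>Linear independence of the gradients\<close>

text \<open>
  The solution with initial data \<open>(sin \<alpha>, - cos \<alpha>)\<close> and its derivative for the single potential \<open>q\<close>, obtained
  from the family with direction zero. The gradients of eigenvalues in different directions \<open>h\<close> thus refer
  to one and the same eigenfunction.
\<close>

definition efun :: "(real \<Rightarrow> real) \<Rightarrow> real \<Rightarrow> real \<Rightarrow> real \<Rightarrow> real" where
  "efun q \<alpha> l = sl_family.y q (\<lambda>_. 0) \<alpha> (l, 0)"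

definition efun' :: "(real \<Rightarrow> real) \<Rightarrow> real \<Rightarrow> real \<Rightarrow> real \<Rightarrow> real" where
  "efun' q \<alpha> l = sl_family.v q (\<lambda>_. 0) \<alpha> (l, 0)"

definition eig_gradient :: "(real \<Rightarrow> real) \<Rightarrow> real \<Rightarrow> real \<Rightarrow> (real \<Rightarrow> real) \<Rightarrow> real" where
  "eig_gradient q \<alpha> l h =
     integral {0..1} (\<lambda>x. h x * (efun q \<alpha> l x)\<^sup>2) / integral {0..1} (\<lambda>x. (efun q \<alpha> l x)\<^sup>2)"

context
  fixes q :: "real \<Rightarrow> real" and \<alpha> :: real
  assumes q: "q absolutely_integrable_on {0..1}"
begin

interpretation fam: sl_family q "\<lambda>_. 0" \<alpha>
  using q by unfold_locales (auto intro: absolutely_integrable_continuous_real)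

lemma efun_system:
  "sl_system (\<lambda>x. integral {0..x} q) l (efun q \<alpha> l) (\<lambda>x. efun' q \<alpha> l x - integral {0..x} q * efun q \<alpha> l x)"
  using fam.sys[of "(l, 0)"] unfolding efun_def efun'_def
  by (simp add: fam.v_def[abs_def] fam.sg_def[abs_def])

lemma efun_init: "efun q \<alpha> l 0 = sin \<alpha>" "efun' q \<alpha> l 0 = - cos \<alpha>"
  by (simp_all add: efun_def efun'_def)

lemma efun_deriv: "x \<in> {0..1} \<Longrightarrow> (efun q \<alpha> l has_real_derivative efun' q \<alpha> l x) (at x within {0..1})"
  unfolding efun_def efun'_def by (rule fam.y_deriv)

lemma efun_cont: "continuous_on {0..1} (efun q \<alpha> l)" "continuous_on {0..1} (efun' q \<alpha> l)"
  unfolding efun_def efun'_def by (rule fam.y_cont fam.v_cont)+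

lemma efun_norm_pos: "integral {0..1} (\<lambda>x. (efun q \<alpha> l x)\<^sup>2) > 0"
  using fam.K_pos[of "(l, 0)"] by (simp add: fam.K_def efun_def power2_eq_square)

lemma efun_not_zero_at_1: "efun q \<alpha> l 1 \<noteq> 0 \<or> efun' q \<alpha> l 1 \<noteq> 0"
  using fam.nonzero[of 1 "(l, 0)"] by (auto simp: efun_def efun'_def fam.v_def)

lemma family_solution_eq_efun:
  assumes h: "h absolutely_integrable_on {0..1}" and x: "x \<in> {0..1}"
  shows "sl_family.y q h \<alpha> (l, 0) x = efun q \<alpha> l x"
proof -
  interpret f: sl_family q h \<alpha> by unfold_locales (fact q h)+
  have "sl_system (\<lambda>x. integral {0..x} q) l (f.y (l, 0)) (f.p (l, 0))"
    using f.sys[of "(l, 0)"] by (simp add: f.sg_def[abs_def])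
  from sl_system_unique[OF this efun_system continuous_on_indefinite_integral[OF q] _ _ x]
  show ?thesis by (simp add: efun_init)
qed

lemma eig_0: "fam.eig \<beta> n 0 = SL_eigenvalue q \<alpha> \<beta> n"
  by (simp add: fam.eig_def)

lemma efun_boundary_condition:
  "efun q \<alpha> (SL_eigenvalue q \<alpha> \<beta> n) 1 * cos \<beta> + efun' q \<alpha> (SL_eigenvalue q \<alpha> \<beta> n) 1 * sin \<beta> = 0"
  using fam.eig_boundary_condition[of 0 \<beta> n] fam.boundary_condition
  by (simp add: eig_0 efun_def efun'_def)

lemma SL_eigenvalue_inj: "SL_eigenvalue q \<alpha> \<beta> n = SL_eigenvalue q \<alpha> \<beta> m \<Longrightarrow> n = m"
  using fam.eig_inj[of 0 \<beta> n m] by (simp add: eig_0)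

lemma efun_bound:
  "\<exists>D\<ge>0. \<forall>n. \<forall>x\<in>{0..1}. (efun q \<alpha> (SL_eigenvalue q \<alpha> \<beta> n) x)\<^sup>2
     \<le> D * integral {0..1} (\<lambda>x. (efun q \<alpha> (SL_eigenvalue q \<alpha> \<beta> n) x)\<^sup>2)"
proof -
  obtain C D where D: "D \<ge> 0" "\<And>t l x. t \<in> {-2..2} \<Longrightarrow> sin (fam.\<Theta> (l, t) 1 + \<beta>) = 0 \<Longrightarrow> x \<in> {0..1} \<Longrightarrow>
      (fam.y (l, t) x)\<^sup>2 \<le> D * fam.K (l, t) (l, t)"
    using fam.uniform_bounds[of \<beta>] by blast
  have "(efun q \<alpha> (SL_eigenvalue q \<alpha> \<beta> n) x)\<^sup>2 \<le> D * integral {0..1} (\<lambda>x. (efun q \<alpha> (SL_eigenvalue q \<alpha> \<beta> n) x)\<^sup>2)"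
    if "x \<in> {0..1}" for n x
    using D(2)[of 0 "SL_eigenvalue q \<alpha> \<beta> n", OF _ _ that] fam.eig_boundary_condition[of 0 \<beta> n]
    by (simp add: eig_0 efun_def fam.K_def power2_eq_square)
  then show ?thesis using D(1) by blast
qed

lemma eigenvalue_perturbation:
  assumes h: "h absolutely_integrable_on {0..1}"
  shows "\<exists>L\<ge>0. \<forall>n. ((\<lambda>t. SL_eigenvalue (\<lambda>x. q x + t * h x) \<alpha> \<beta> n)
       has_real_derivative eig_gradient q \<alpha> (SL_eigenvalue q \<alpha> \<beta> n) h) (at 0) \<and>
     (\<forall>t. \<bar>t\<bar> \<le> 1 \<longrightarrow> \<bar>SL_eigenvalue (\<lambda>x. q x + t * h x) \<alpha> \<beta> n - SL_eigenvalue q \<alpha> \<beta> n\<bar> \<le> L * \<bar>t\<bar>)"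
proof -
  interpret f: sl_family q h \<alpha> by unfold_locales (fact q h)+
  obtain L where L: "L \<ge> 0" "\<And>n s t. s \<in> {-2<..<2} \<Longrightarrow> t \<in> {-2<..<2} \<Longrightarrow>
      \<bar>f.eig \<beta> n s - f.eig \<beta> n t\<bar> \<le> L * \<bar>s - t\<bar>" using f.eig_lipschitz[of \<beta>] by blast
  have e0: "f.eig \<beta> n 0 = SL_eigenvalue q \<alpha> \<beta> n" for n by (simp add: f.eig_def)
  have drv: "f.drv (l, 0) = eig_gradient q \<alpha> l h" for l
  proof -
    have "f.H (l, 0) (l, 0) = integral {0..1} (\<lambda>x. h x * (efun q \<alpha> l x)\<^sup>2)"
      unfolding f.H_eq
      by (rule integral_cong) (simp add: family_solution_eq_efun[OF h] power2_eq_square)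
    moreover have "f.K (l, 0) (l, 0) = integral {0..1} (\<lambda>x. (efun q \<alpha> l x)\<^sup>2)"
      unfolding f.K_def
      by (rule integral_cong) (simp add: family_solution_eq_efun[OF h] power2_eq_square)
    ultimately show ?thesis by (simp add: f.drv_def eig_gradient_def)
  qed
  have "((\<lambda>t. SL_eigenvalue (\<lambda>x. q x + t * h x) \<alpha> \<beta> n) has_real_derivative
      eig_gradient q \<alpha> (SL_eigenvalue q \<alpha> \<beta> n) h) (at 0)" for n
    using f.eig_derivative[of 0 \<beta> n] by (simp add: e0 drv f.eig_def[abs_def])
  moreover have "\<bar>SL_eigenvalue (\<lambda>x. q x + t * h x) \<alpha> \<beta> n - SL_eigenvalue q \<alpha> \<beta> n\<bar> \<le> L * \<bar>t\<bar>"
    if "\<bar>t\<bar> \<le> 1" for t n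
  proof -
    have "t \<in> {-2<..<2}" using that by (auto simp: abs_le_iff)
    then show ?thesis using L(2)[of t 0 n] by (simp add: e0 f.eig_def[of _ _ t])
  qed
  ultimately show ?thesis using L(1) by blast
qed

end

text \<open>
  The integrand on the right is \<open>y\<^sup>2 (z\<^sub>1 z\<^sub>2)' - (y\<^sup>2)' z\<^sub>1 z\<^sub>2\<close> in terms of the Wronskians of \<open>y\<close> with \<open>z\<^sub>1\<close> and \<open>z\<^sub>2\<close>.
\<close>

lemma square_product_identity:
  assumes y: "sl_system \<sigma> l y p" and z1: "sl_system \<sigma> m z1 r1" and z2: "sl_system \<sigma> m z2 r2"
    and \<sigma>: "continuous_on {0..1} \<sigma>"
  shows "2 * integral {0..1} (\<lambda>x. (z1 x * (r2 x + \<sigma> x * z2 x) + (r1 x + \<sigma> x * z1 x) * z2 x) * (y x)\<^sup>2)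
    = (y 1)\<^sup>2 * (z1 1 * z2 1) - (y 0)\<^sup>2 * (z1 0 * z2 0)
      + integral {0..1} (\<lambda>x. y x * z1 x * (y x * r2 x - p x * z2 x) + y x * z2 x * (y x * r1 x - p x * z1 x))"
proof -
  note c = sl_system_continuous[OF y] sl_system_continuous[OF z1] sl_system_continuous[OF z2] \<sigma>
  define f where "f = (\<lambda>x. (z1 x * (r2 x + \<sigma> x * z2 x) + (r1 x + \<sigma> x * z1 x) * z2 x) * (y x)\<^sup>2)"
  define g where "g = (\<lambda>x. y x * z1 x * (y x * r2 x - p x * z2 x) + y x * z2 x * (y x * r1 x - p x * z1 x))"
  have f: "f integrable_on {0..1}" and g: "g integrable_on {0..1}" unfolding f_def g_def
    by (intro integrable_continuous_real continuous_intros c)+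
  have 1: "((\<lambda>x. 2 * f x - g x) has_integral ((y 1)\<^sup>2 * (z1 1 * z2 1) - (y 0)\<^sup>2 * (z1 0 * z2 0))) {0..1}"
    unfolding f_def g_def
    by (rule ftc01) (rule derivative_eq_intros sl_systemD[OF y] sl_systemD[OF z1] sl_systemD[OF z2] refl
        | assumption | simp add: algebra_simps power2_eq_square)+
  have 2: "((\<lambda>x. 2 * f x - g x) has_integral (2 * integral {0..1} f - integral {0..1} g)) {0..1}"
    by (intro has_integral_diff has_integral_mult_right integrable_integral f g)
  show ?thesis unfolding f_def[symmetric] g_def[symmetric]
    using has_integral_unique[OF 1 2] by linarith
qed

text \<open>
  The derivative of each Wronskian is \<open>l - m\<close> times the product of the two solutions, so the integrand is,
  up to this factor, the derivative of the product of both Wronskians.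
\<close>

lemma cross_wronskian_integral:
  assumes y: "sl_system \<sigma> l y p" and z1: "sl_system \<sigma> m z1 r1" and z2: "sl_system \<sigma> m z2 r2"
    and lm: "l \<noteq> m"
    and b0: "(y 0 * r1 0 - p 0 * z1 0) * (y 0 * r2 0 - p 0 * z2 0) = 0"
    and b1: "(y 1 * r1 1 - p 1 * z1 1) * (y 1 * r2 1 - p 1 * z2 1) = 0"
  shows "integral {0..1} (\<lambda>x. y x * z1 x * (y x * r2 x - p x * z2 x) + y x * z2 x * (y x * r1 x - p x * z1 x)) = 0"
proof -
  define g where "g = (\<lambda>x. y x * z1 x * (y x * r2 x - p x * z2 x) + y x * z2 x * (y x * r1 x - p x * z1 x))"
  have W: "((\<lambda>x. y x * r x - p x * z x) has_real_derivative (l - m) * (y x * z x)) (at x within {0..1})"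
    if "sl_system \<sigma> m z r" "x \<in> {0..1}" for z r x
    using sl_wronskian_derivative[OF y that] by simp
  have "((\<lambda>x. (l - m) * g x) has_integral
     ((y 1 * r1 1 - p 1 * z1 1) * (y 1 * r2 1 - p 1 * z2 1) - (y 0 * r1 0 - p 0 * z1 0) * (y 0 * r2 0 - p 0 * z2 0))) {0..1}"
  proof (rule ftc01)
    fix x :: real assume x: "x \<in> {0..1}"
    show "((\<lambda>x. (y x * r1 x - p x * z1 x) * (y x * r2 x - p x * z2 x)) has_real_derivative (l - m) * g x)
        (at x within {0..1})"
      by (rule DERIV_cong[OF DERIV_mult[OF W[OF z1 x] W[OF z2 x]]]) (simp add: g_def algebra_simps)
  qed simp
  then have "((\<lambda>x. (l - m) * g x) has_integral 0) {0..1}" using b0 b1 by simp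
  from has_integral_mult_right[OF this, of "1 / (l - m)"] have "(g has_integral 0) {0..1}" using lm by simp
  then show ?thesis unfolding g_def[symmetric] by (rule integral_unique)
qed

text \<open>
  The fundamental system at \<open>0\<close> has Wronskian \<open>1\<close> at every point; Cramer's rule at \<open>1\<close> does the rest.
\<close>

lemma sl_system_exists_at_1:
  assumes \<sigma>: "continuous_on {0..1} \<sigma>"
  shows "\<exists>z r. sl_system \<sigma> m z r \<and> z 1 = A \<and> r 1 = B"
proof -
  obtain y1 p1 where s1: "sl_system \<sigma> m y1 p1" "y1 0 = 1" "p1 0 = 0" using sl_system_exists[OF \<sigma>] by blast
  obtain y2 p2 where s2: "sl_system \<sigma> m y2 p2" "y2 0 = 0" "p2 0 = 1" using sl_system_exists[OF \<sigma>] by blast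
  have "((\<lambda>x::real. 0) has_integral ((y1 1 * p2 1 - p1 1 * y2 1) - (y1 0 * p2 0 - p1 0 * y2 0))) {0..1}"
    by (rule ftc01[where f = "\<lambda>x. y1 x * p2 x - p1 x * y2 x" and x = 1])
       (use sl_wronskian_derivative[OF s1(1) s2(1)] in auto)
  then have w: "y1 1 * p2 1 - p1 1 * y2 1 = 1" using s1 s2 by simp
  define c where "c = A * p2 1 - B * y2 1"
  define d where "d = B * y1 1 - A * p1 1"
  have "c * y1 1 + d * y2 1 = A * (y1 1 * p2 1 - p1 1 * y2 1)"
    "c * p1 1 + d * p2 1 = B * (y1 1 * p2 1 - p1 1 * y2 1)"
    by (simp_all add: c_def d_def algebra_simps)
  then show ?thesis using sl_system_combination[OF s1(1) s2(1), of c d] w by auto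
qed

lemma same_boundary_condition_wronskian:
  fixes a a' b b' s c :: real
  assumes "a * c + a' * s = 0" "b * c + b' * s = 0" "s\<^sup>2 + c\<^sup>2 = 1"
  shows "a * b' - a' * b = 0"
proof -
  have "(a * b' - a' * b) * s = 0" "(a * b' - a' * b) * c = 0"
    using assms(1,2) by algebra+
  moreover have "s \<noteq> 0 \<or> c \<noteq> 0" using assms(3) by auto
  ultimately show ?thesis by auto
qed

text \<open>
  The direction \<open>g\<close> is \<open>(y\<^sub>\<mu> z)'\<close>, where \<open>z\<close> solves the equation for \<open>\<mu>\<close> with the condition \<open>\<beta>'\<close> at \<open>1\<close>. Among the
  eigenfunctions of both problems, only \<open>y\<^sub>\<mu>\<close> has a Wronskian product that fails to cancel, as
  \<open>sin (\<beta> - \<beta>') \<noteq> 0\<close> makes the Wronskian \<open>c\<close> of \<open>y\<^sub>\<mu>\<close> and \<open>z\<close> nonzero. The boundary terms have the same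
  coefficients \<open>A\<close> and \<open>B\<close> for all eigenfunctions.
\<close>

lemma biorthogonal_direction:
  fixes \<alpha> \<beta> \<beta>' \<mu> :: real
  assumes q: "q \<in> L2" and sin: "sin (\<beta> - \<beta>') \<noteq> 0"
    and \<mu>: "efun q \<alpha> \<mu> 1 * cos \<beta> + efun' q \<alpha> \<mu> 1 * sin \<beta> = 0"
  shows "\<exists>g\<in>H1. \<exists>A B w. w \<noteq> 0 \<and>
    (\<forall>l. (efun q \<alpha> l 1 * cos \<beta> + efun' q \<alpha> l 1 * sin \<beta> = 0 \<or>
          efun q \<alpha> l 1 * cos \<beta>' + efun' q \<alpha> l 1 * sin \<beta>' = 0) \<longrightarrow>
       eig_gradient q \<alpha> l g =
         A * ((efun q \<alpha> l 1)\<^sup>2 / integral {0..1} (\<lambda>x. (efun q \<alpha> l x)\<^sup>2))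
       + B * ((efun q \<alpha> l 0)\<^sup>2 / integral {0..1} (\<lambda>x. (efun q \<alpha> l x)\<^sup>2))
       + (if l = \<mu> then w else 0))"
proof -
  define \<sigma> where "\<sigma> = (\<lambda>x. integral {0..x} q)"
  have qa: "q absolutely_integrable_on {0..1}" by (rule L2_absolutely_integrable[OF q])
  have \<sigma>c: "continuous_on {0..1} \<sigma>" unfolding \<sigma>_def by (rule continuous_on_indefinite_integral[OF qa])
  have \<sigma>0: "\<sigma> 0 = 0" by (simp add: \<sigma>_def)
  define y where "y = efun q \<alpha>"
  define v where "v = efun' q \<alpha>"
  define p where "p = (\<lambda>l x. v l x - \<sigma> x * y l x)"
  have sysy: "sl_system \<sigma> l (y l) (p l)" for l
    unfolding y_def v_def p_def \<sigma>_def by (rule efun_system[OF qa])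
  obtain z r where z: "sl_system \<sigma> \<mu> z r" "z 1 = sin \<beta>'" "r 1 = - cos \<beta>' - \<sigma> 1 * sin \<beta>'"
    using sl_system_exists_at_1[OF \<sigma>c] by blast
  define c where "c = y \<mu> 1 * r 1 - p \<mu> 1 * z 1"
  have c: "c = - (y \<mu> 1 * cos \<beta>' + v \<mu> 1 * sin \<beta>')" by (simp add: c_def p_def z algebra_simps)
  have "c \<noteq> 0"
  proof
    assume "c = 0"
    then have 2: "y \<mu> 1 * cos \<beta>' + v \<mu> 1 * sin \<beta>' = 0" using c by simp
    have 1: "y \<mu> 1 * cos \<beta> + v \<mu> 1 * sin \<beta> = 0" using \<mu> by (simp add: y_def v_def)
    have "y \<mu> 1 * sin (\<beta> - \<beta>') = 0" "v \<mu> 1 * sin (\<beta> - \<beta>') = 0"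
      unfolding sin_diff using 1 2 by algebra+
    then show False using sin efun_not_zero_at_1[OF qa, of \<alpha> \<mu>] by (simp add: y_def v_def)
  qed
  define F where "F = (\<lambda>x. y \<mu> x * r x + p \<mu> x * z x)"
  define F' where "F' = (\<lambda>x. (p \<mu> x + \<sigma> x * y \<mu> x) * r x + y \<mu> x * (- \<mu> * z x - \<sigma> x * (r x + \<sigma> x * z x))
     + (- \<mu> * y \<mu> x - \<sigma> x * (p \<mu> x + \<sigma> x * y \<mu> x)) * z x + p \<mu> x * (r x + \<sigma> x * z x))"
  define f where "f = (\<lambda>x. 2 * (y \<mu> x * z x))"
  define f' where "f' = (\<lambda>x. 2 * ((p \<mu> x + \<sigma> x * y \<mu> x) * z x + y \<mu> x * (r x + \<sigma> x * z x)))"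
  define g where "g = (\<lambda>x. F x + \<sigma> x * f x)"
  note cs = sl_system_continuous[OF sysy] sl_system_continuous[OF z(1)] \<sigma>c
  have gH: "g \<in> H1" unfolding g_def \<sigma>_def
  proof (rule H1_I[OF q])
    show "continuous_on {0..1} F'" "continuous_on {0..1} f'" unfolding F'_def f'_def
      by (intro continuous_intros cs)+
    show "(F has_real_derivative F' x) (at x within {0..1})" if "x \<in> {0..1}" for x
      unfolding F_def F'_def
      by (rule derivative_eq_intros sl_systemD[OF sysy that] sl_systemD[OF z(1) that] refl | simp add: algebra_simps)+
    show "(f has_real_derivative f' x) (at x within {0..1})" if "x \<in> {0..1}" for x
      unfolding f_def f'_def
      by (rule derivative_eq_intros sl_systemD[OF sysy that] sl_systemD[OF z(1) that] refl | simp add: algebra_simps)+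
  qed
  have g_eq: "g = (\<lambda>x. y \<mu> x * (r x + \<sigma> x * z x) + (p \<mu> x + \<sigma> x * y \<mu> x) * z x)"
    by (auto simp: g_def F_def f_def algebra_simps)
  have main: "eig_gradient q \<alpha> l g =
         (y \<mu> 1 * z 1 / 2) * ((y l 1)\<^sup>2 / integral {0..1} (\<lambda>x. (y l x)\<^sup>2))
       + (- y \<mu> 0 * z 0 / 2) * ((y l 0)\<^sup>2 / integral {0..1} (\<lambda>x. (y l x)\<^sup>2))
       + (if l = \<mu> then c / 2 else 0)"
    if bc: "y l 1 * cos \<beta> + v l 1 * sin \<beta> = 0 \<or> y l 1 * cos \<beta>' + v l 1 * sin \<beta>' = 0" for l
  proof -
    define I where "I = integral {0..1} (\<lambda>x. (y l x)\<^sup>2)"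
    have I: "I > 0" unfolding I_def y_def by (rule efun_norm_pos[OF qa])
    define T where "T = integral {0..1} (\<lambda>x. y l x * y \<mu> x * (y l x * r x - p l x * z x)
        + y l x * z x * (y l x * p \<mu> x - p l x * y \<mu> x))"
    have id: "2 * integral {0..1} (\<lambda>x. g x * (y l x)\<^sup>2)
        = (y l 1)\<^sup>2 * (y \<mu> 1 * z 1) - (y l 0)\<^sup>2 * (y \<mu> 0 * z 0) + T"
      unfolding g_eq T_def by (rule square_product_identity[OF sysy sysy z(1) \<sigma>c])
    have T: "T = (if l = \<mu> then c * I else 0)"
    proof (cases "l = \<mu>")
      case True
      have W: "y \<mu> x * r x - p \<mu> x * z x = c" if x: "x \<in> {0..1}" for x
      proof -
        have d: "((\<lambda>x. y \<mu> x * r x - p \<mu> x * z x) has_real_derivative 0) (at x within {0..1})"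
          if "x \<in> {0..1}" for x using sl_wronskian_derivative[OF sysy z(1) that, of \<mu>] by simp
        obtain k where "\<And>x. x \<in> {0..1} \<Longrightarrow> y \<mu> x * r x - p \<mu> x * z x = k"
          using has_field_derivative_zero_constant[of "{0..1}" "\<lambda>x. y \<mu> x * r x - p \<mu> x * z x"] d by auto
        then show ?thesis using x by (simp add: c_def)
      qed
      have "T = integral {0..1} (\<lambda>x. c * (y l x)\<^sup>2)"
        unfolding T_def by (rule integral_cong) (use W True in \<open>auto simp: power2_eq_square\<close>)
      also have "\<dots> = c * I" by (simp add: I_def)
      finally show ?thesis using True by simp
    next
      case False
      have "T = 0"
        unfolding T_def
      proof (rule cross_wronskian_integral[OF sysy sysy z(1) False])
        show "(y l 0 * p \<mu> 0 - p l 0 * y \<mu> 0) * (y l 0 * r 0 - p l 0 * z 0) = 0"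
          by (simp add: p_def y_def v_def efun_init[OF qa])
        have e1: "y l 1 * p \<mu> 1 - p l 1 * y \<mu> 1 = y l 1 * v \<mu> 1 - v l 1 * y \<mu> 1"
          by (simp add: p_def algebra_simps)
        have e2: "y l 1 * r 1 - p l 1 * z 1 = y l 1 * (- cos \<beta>') - v l 1 * sin \<beta>'"
          by (simp add: p_def z algebra_simps)
        show "(y l 1 * p \<mu> 1 - p l 1 * y \<mu> 1) * (y l 1 * r 1 - p l 1 * z 1) = 0"
          using bc
        proof
          assume "y l 1 * cos \<beta> + v l 1 * sin \<beta> = 0"
          then have "y l 1 * v \<mu> 1 - v l 1 * y \<mu> 1 = 0"
            using \<mu> by (intro same_boundary_condition_wronskian[of _ "cos \<beta>" _ "sin \<beta>"]) (auto simp: y_def v_def)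
          then show ?thesis unfolding e1 by simp
        next
          assume "y l 1 * cos \<beta>' + v l 1 * sin \<beta>' = 0"
          then show ?thesis unfolding e2 by simp
        qed
      qed
      then show ?thesis using False by simp
    qed
    have "integral {0..1} (\<lambda>x. g x * (y l x)\<^sup>2)
        = ((y l 1)\<^sup>2 * (y \<mu> 1 * z 1) - (y l 0)\<^sup>2 * (y \<mu> 0 * z 0) + (if l = \<mu> then c * I else 0)) / 2"
      using id unfolding T by simp
    then show ?thesis
      unfolding eig_gradient_def y_def[symmetric] I_def[symmetric] using I
      by (simp add: field_simps)
  qed
  have "c / 2 \<noteq> 0" using \<open>c \<noteq> 0\<close> by simp
  then show ?thesis using gH main unfolding y_def v_def by blast
qed

lemma eig_gradient_bounded_by_mass:
  assumes q: "q absolutely_integrable_on {0..1}"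
    and D: "\<And>x. x \<in> {0..1} \<Longrightarrow> (efun q \<alpha> l x)\<^sup>2 \<le> D * integral {0..1} (\<lambda>x. (efun q \<alpha> l x)\<^sup>2)"
    and g: "continuous_on {0..1} g" "\<And>x. x \<in> {0..1} \<Longrightarrow> g x \<ge> 0" "integral {0..1} g = 1"
  shows "\<bar>eig_gradient q \<alpha> l g\<bar> \<le> D"
proof -
  define I where "I = integral {0..1} (\<lambda>x. (efun q \<alpha> l x)\<^sup>2)"
  have I: "I > 0" unfolding I_def by (rule efun_norm_pos[OF q])
  have "\<bar>integral {0..1} (\<lambda>x. g x * (efun q \<alpha> l x)\<^sup>2)\<bar> \<le> integral {0..1} (\<lambda>x. D * I * g x)"
  proof (rule integral_abs_bound_integral)
    fix x :: real assume x: "x \<in> {0..1}"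
    show "\<bar>g x * (efun q \<alpha> l x)\<^sup>2\<bar> \<le> D * I * g x"
      using mult_right_mono[OF D[OF x] g(2)[OF x]] g(2)[OF x] by (simp add: I_def abs_mult mult.commute)
  qed (intro integrable_continuous_real continuous_intros g efun_cont[OF q])+
  also have "\<dots> = D * I" using g(3) by simp
  finally show ?thesis
    unfolding eig_gradient_def I_def[symmetric] using I by (simp add: abs_divide pos_divide_le_eq)
qed

text \<open>
  Directions of mass one that concentrate at an endpoint \<open>s\<close> show, by dominated convergence, that
  \<open>\<Sum> c y(s)\<^sup>2 / \<integral>y\<^sup>2\<close> vanishes for \<open>s = 0\<close> and \<open>s = 1\<close>. The biorthogonal direction for \<open>z0\<close> then leaves only
  the term \<open>c z0 * w\<close>.
\<close>

lemma gradients_independent: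
  fixes ev :: "nat \<times> nat \<Rightarrow> real" and c M :: "nat \<times> nat \<Rightarrow> real"
  assumes q: "q \<in> L2" and sin: "sin (\<beta> - \<gamma>) \<noteq> 0" and I: "I \<subseteq> {1, 2} \<times> UNIV"
    and ev: "\<And>i n. ev (i, n) = SL_eigenvalue q \<alpha> (if i = 1 then \<beta> else \<gamma>) n"
    and M: "M summable_on I" "\<And>z. z \<in> I \<Longrightarrow> \<bar>c z\<bar> \<le> M z"
    and zero: "\<And>h. h \<in> H1 \<Longrightarrow> infsum (\<lambda>z. c z * eig_gradient q \<alpha> (ev z) h) I = 0"
    and z0: "z0 \<in> I"
  shows "c z0 = 0"
proof -
  have qa: "q absolutely_integrable_on {0..1}" by (rule L2_absolutely_integrable[OF q])
  define y where "y = efun q \<alpha>"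
  define N where "N = (\<lambda>l. integral {0..1} (\<lambda>x. (y l x)\<^sup>2))"
  have N: "N l > 0" for l unfolding N_def y_def by (rule efun_norm_pos[OF qa])
  obtain D' where D': "\<And>\<beta>. D' \<beta> \<ge> 0"
    "\<And>\<beta> n x. x \<in> {0..1} \<Longrightarrow> (y (SL_eigenvalue q \<alpha> \<beta> n) x)\<^sup>2 \<le> D' \<beta> * N (SL_eigenvalue q \<alpha> \<beta> n)"
    using efun_bound[OF qa, of \<alpha>] unfolding y_def N_def by metis
  define D where "D = D' \<beta> + D' \<gamma>"
  have D: "(y (ev z) x)\<^sup>2 \<le> D * N (ev z)" if "x \<in> {0..1}" for z x
  proof -
    obtain i n where [simp]: "z = (i, n)" by (cases z)
    have "(y (ev z) x)\<^sup>2 \<le> D' (if i = 1 then \<beta> else \<gamma>) * N (ev z)" using D'(2)[OF that] by (simp add: ev)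
    also have "\<dots> \<le> D * N (ev z)"
      using D'(1) N[of "ev z"] by (intro mult_right_mono) (auto simp: D_def)
    finally show ?thesis .
  qed
  have D0: "D \<ge> 0" using D'(1) by (simp add: D_def)
  have ysq: "((\<lambda>x. (y l x)\<^sup>2) has_real_derivative 2 * y l x * efun' q \<alpha> l x) (at x within {0..1})"
    if "x \<in> {0..1}" for l x
    unfolding y_def by (rule derivative_eq_intros efun_deriv[OF qa that] refl | simp)+
  have ysqc: "continuous_on {0..1} (\<lambda>x. 2 * y l x * efun' q \<alpha> l x)" for l
    unfolding y_def by (intro continuous_intros efun_cont[OF qa])
  have grad_eq: "eig_gradient q \<alpha> l h = integral {0..1} (\<lambda>x. h x * (y l x)\<^sup>2) / N l" for l h
    by (simp add: eig_gradient_def y_def N_def)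
  have Mc: "(\<lambda>z. M z * D) summable_on I" by (rule summable_on_cmult_left[OF M(1)])
  have point: "infsum (\<lambda>z. c z * ((y (ev z) s)\<^sup>2 / N (ev z))) I = 0"
    if G: "\<And>k. continuous_on {0..1} (G k)" "\<And>k x. x \<in> {0..1} \<Longrightarrow> G k x \<ge> 0" "\<And>k. integral {0..1} (G k) = 1"
      "\<And>k. G k \<in> H1"
      and lim: "\<And>l. (\<lambda>k. integral {0..1} (\<lambda>x. G k x * (y l x)\<^sup>2)) \<longlonglongrightarrow> (y l s)\<^sup>2"
    for G :: "nat \<Rightarrow> real \<Rightarrow> real" and s
  proof -
    have "((\<lambda>k. infsum (\<lambda>z. c z * eig_gradient q \<alpha> (ev z) (G k)) I)
        \<longlongrightarrow> infsum (\<lambda>z. c z * ((y (ev z) s)\<^sup>2 / N (ev z))) I) sequentially"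
    proof (rule infsum_dominated_convergence[OF _ _ _ _ Mc, where S = UNIV])
      fix z assume z: "z \<in> I"
      show "(\<lambda>k. c z * eig_gradient q \<alpha> (ev z) (G k)) \<longlonglongrightarrow> c z * ((y (ev z) s)\<^sup>2 / N (ev z))"
        unfolding grad_eq
        using N[of "ev z"] by (intro tendsto_intros lim) auto
      fix k
      have "\<bar>eig_gradient q \<alpha> (ev z) (G k)\<bar> \<le> D"
        by (rule eig_gradient_bounded_by_mass[OF qa _ G(1-3)]) (use D in \<open>auto simp: y_def N_def\<close>)
      then show "\<bar>c z * eig_gradient q \<alpha> (ev z) (G k)\<bar> \<le> M z * D"
        unfolding abs_mult using M(2)[OF z] by (intro mult_mono) auto
    qed auto
    then have "((\<lambda>k. 0) \<longlongrightarrow> infsum (\<lambda>z. c z * ((y (ev z) s)\<^sup>2 / N (ev z))) I) sequentially"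
      using zero[OF G(4)] by simp
    then show ?thesis by (simp add: LIMSEQ_const_iff)
  qed
  have hi1: "((\<lambda>x. real (Suc k) * x ^ k) has_integral 1) {0..1}" for k
  proof -
    have "((\<lambda>x. real (Suc k) * x ^ k) has_integral (1 ^ Suc k - 0 ^ Suc k)) {0..1}"
      by (rule ftc01) (rule derivative_eq_intros refl | simp del: of_nat_Suc)+
    then show ?thesis by simp
  qed
  have p1: "infsum (\<lambda>z. c z * ((y (ev z) 1)\<^sup>2 / N (ev z))) I = 0"
  proof (rule point)
    show "(\<lambda>x. real (Suc k) * x ^ k) \<in> H1" for k
      by (rule smooth_in_H1[where F' = "\<lambda>x. real (Suc k) * (real k * x ^ (k - 1))"])
         (rule derivative_eq_intros refl continuous_intros | simp del: of_nat_Suc)+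
    show "integral {0..1} (\<lambda>x. real (Suc k) * x ^ k) = 1" for k by (rule integral_unique[OF hi1])
    show "(\<lambda>k. integral {0..1} (\<lambda>x. real (Suc k) * x ^ k * (y l x)\<^sup>2)) \<longlonglongrightarrow> (y l 1)\<^sup>2" for l
      by (rule concentration_at_1[OF ysq ysqc])
  qed (auto intro!: continuous_intros)
  have p0: "infsum (\<lambda>z. c z * ((y (ev z) 0)\<^sup>2 / N (ev z))) I = 0"
  proof (rule point)
    show "(\<lambda>x. real (Suc k) * (1 - x) ^ k) \<in> H1" for k
      by (rule smooth_in_H1[where F' = "\<lambda>x. real (Suc k) * (real k * (1 - x) ^ (k - 1) * (- 1))"])
         (rule derivative_eq_intros refl continuous_intros | simp del: of_nat_Suc)+
    show "integral {0..1} (\<lambda>x. real (Suc k) * (1 - x) ^ k) = 1" for k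
      using integral_reflect01[of "\<lambda>x. real (Suc k) * x ^ k"] integral_unique[OF hi1[of k]] by simp
    show "(\<lambda>k. integral {0..1} (\<lambda>x. real (Suc k) * (1 - x) ^ k * (y l x)\<^sup>2)) \<longlonglongrightarrow> (y l 0)\<^sup>2" for l
      by (rule concentration_at_0[OF ysq ysqc])
  qed (auto intro!: continuous_intros)
  define b where "b = (\<lambda>i::nat. if i = 1 then \<beta> else \<gamma>)"
  obtain j m where z0_eq: "z0 = (j, m)" by (cases z0)
  have bcs: "y (ev (i, n)) 1 * cos (b i) + efun' q \<alpha> (ev (i, n)) 1 * sin (b i) = 0" for i n
    unfolding ev y_def b_def by (rule efun_boundary_condition[OF qa])
  define b' where "b' = (if j = 1 then \<gamma> else \<beta>)"
  have sb: "sin (b j - b') \<noteq> 0" using sin sin_minus[of "\<beta> - \<gamma>"] by (auto simp: b_def b'_def)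
  obtain g A B w where g: "g \<in> H1" "w \<noteq> 0"
    "\<And>l. y l 1 * cos (b j) + efun' q \<alpha> l 1 * sin (b j) = 0 \<or> y l 1 * cos b' + efun' q \<alpha> l 1 * sin b' = 0 \<Longrightarrow>
      eig_gradient q \<alpha> l g = A * ((y l 1)\<^sup>2 / N l) + B * ((y l 0)\<^sup>2 / N l) + (if l = ev z0 then w else 0)"
    using biorthogonal_direction[OF q sb, of \<alpha> "ev z0"] bcs[of j m] unfolding y_def N_def z0_eq by blast
  \<comment> \<open>The two problems have no eigenvalue in common: an eigenfunction of both would vanish at \<open>1\<close> with its derivative.\<close>
  have inj: "ev z = ev z0 \<longleftrightarrow> z = z0" if z: "z \<in> I" for z
  proof
    assume eq: "ev z = ev z0"
    obtain i n where z_eq: "z = (i, n)" by (cases z)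
    have ij: "i \<in> {1, 2}" "j \<in> {1, 2}" using z z0 I z_eq z0_eq by auto
    have "i = j"
    proof (rule ccontr)
      assume "i \<noteq> j"
      then have "b i = b'" using ij by (auto simp: b_def b'_def)
      then have 1: "y (ev z0) 1 * cos b' + efun' q \<alpha> (ev z0) 1 * sin b' = 0"
        using bcs[of i n] eq by (simp add: z_eq)
      have 2: "y (ev z0) 1 * cos (b j) + efun' q \<alpha> (ev z0) 1 * sin (b j) = 0"
        using bcs[of j m] by (simp add: z0_eq)
      have "y (ev z0) 1 * sin (b j - b') = 0" "efun' q \<alpha> (ev z0) 1 * sin (b j - b') = 0"
        unfolding sin_diff using 1 2 by algebra+
      then show False using sb efun_not_zero_at_1[OF qa, of \<alpha> "ev z0"] by (simp add: y_def)
    qed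
    moreover have "n = m" using eq SL_eigenvalue_inj[OF qa] ev unfolding z_eq z0_eq \<open>i = j\<close> by metis
    ultimately show "z = z0" by (simp add: z_eq z0_eq)
  qed simp
  have grad: "c z * eig_gradient q \<alpha> (ev z) g = A * (c z * ((y (ev z) 1)\<^sup>2 / N (ev z)))
      + B * (c z * ((y (ev z) 0)\<^sup>2 / N (ev z))) + (if z = z0 then c z0 * w else 0)" if z: "z \<in> I" for z
  proof -
    obtain i n where z_eq: "z = (i, n)" by (cases z)
    have ij: "i \<in> {1, 2}" "j \<in> {1, 2}" using z z0 I z_eq z0_eq by auto
    have "b i = b j \<or> b i = b'" using ij by (auto simp: b_def b'_def)
    then have "eig_gradient q \<alpha> (ev z) g = A * ((y (ev z) 1)\<^sup>2 / N (ev z)) + B * ((y (ev z) 0)\<^sup>2 / N (ev z))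
       + (if ev z = ev z0 then w else 0)"
      using bcs[of i n] by (intro g(3)) (auto simp: z_eq)
    then show ?thesis using inj[OF z] by (simp add: algebra_simps)
  qed
  have sm: "(\<lambda>z. c z * ((y (ev z) s)\<^sup>2 / N (ev z))) summable_on I" if s: "s \<in> {0..1}" for s
  proof (rule summable_on_dominated[OF Mc])
    fix z assume z: "z \<in> I"
    have "(y (ev z) s)\<^sup>2 / N (ev z) \<le> D" using D[OF s, of z] N[of "ev z"] by (simp add: pos_divide_le_eq)
    then show "\<bar>c z * ((y (ev z) s)\<^sup>2 / N (ev z))\<bar> \<le> M z * D"
      unfolding abs_mult using M(2)[OF z] N[of "ev z"] by (intro mult_mono) (auto simp: abs_divide)
  qed
  have hs: "((\<lambda>z. if z = z0 then c z0 * w else 0) has_sum c z0 * w) I"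
    by (rule has_sum_finite_neutralI[of "{z0}"]) (use z0 in auto)
  have "((\<lambda>z. A * (c z * ((y (ev z) 1)\<^sup>2 / N (ev z))) + B * (c z * ((y (ev z) 0)\<^sup>2 / N (ev z)))
      + (if z = z0 then c z0 * w else 0)) has_sum (A * 0 + B * 0 + c z0 * w)) I"
    using has_sum_infsum[OF sm[of 1]] has_sum_infsum[OF sm[of 0]] unfolding p1 p0
    by (intro has_sum_add has_sum_cmult_right hs) auto
  then have "((\<lambda>z. c z * eig_gradient q \<alpha> (ev z) g) has_sum (A * 0 + B * 0 + c z0 * w)) I"
    by (subst has_sum_cong[OF grad])
  from infsumI[OF this] have "c z0 * w = 0" unfolding zero[OF g(1)] by simp
  then show ?thesis using g(2) by simp
qed

section \<open>Critical points of the functional\<close>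

lemma eigval_perturbation:
  assumes q: "q absolutely_integrable_on {0..1}" and h: "h absolutely_integrable_on {0..1}"
  shows "\<exists>L\<ge>0. \<forall>i n. ((\<lambda>t. eigval \<alpha> \<beta> \<gamma> (\<lambda>x. q x + t * h x) i n)
       has_real_derivative eig_gradient q \<alpha> (eigval \<alpha> \<beta> \<gamma> q i n) h) (at 0) \<and>
     (\<forall>t. \<bar>t\<bar> \<le> 1 \<longrightarrow> \<bar>eigval \<alpha> \<beta> \<gamma> (\<lambda>x. q x + t * h x) i n - eigval \<alpha> \<beta> \<gamma> q i n\<bar> \<le> L * \<bar>t\<bar>)"
proof -
  obtain L where L: "\<And>\<beta>. L \<beta> \<ge> 0" "\<And>\<beta> n. ((\<lambda>t. SL_eigenvalue (\<lambda>x. q x + t * h x) \<alpha> \<beta> n)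
       has_real_derivative eig_gradient q \<alpha> (SL_eigenvalue q \<alpha> \<beta> n) h) (at 0)"
     "\<And>\<beta> n t. \<bar>t\<bar> \<le> 1 \<Longrightarrow> \<bar>SL_eigenvalue (\<lambda>x. q x + t * h x) \<alpha> \<beta> n - SL_eigenvalue q \<alpha> \<beta> n\<bar> \<le> L \<beta> * \<bar>t\<bar>"
    using eigenvalue_perturbation[OF q h, of \<alpha>] by metis
  have "L \<beta> * \<bar>t\<bar> \<le> (L \<beta> + L \<gamma>) * \<bar>t\<bar>" "L \<gamma> * \<bar>t\<bar> \<le> (L \<beta> + L \<gamma>) * \<bar>t\<bar>" for t :: real
    using L(1) by (auto intro: mult_right_mono)
  from order_trans[OF L(3) this(1)] order_trans[OF L(3) this(2)] L(1,2) show ?thesis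
    by (intro exI[of _ "L \<beta> + L \<gamma>"]) (auto simp: eigval_def)
qed

text \<open>
  The segment from \<open>q\<close> to \<open>p\<close> is traversed with a speed of the eigenvalues that is bounded uniformly in \<open>n\<close>.
\<close>

lemma eigval_difference_bounded:
  assumes p: "p absolutely_integrable_on {0..1}" and q: "q absolutely_integrable_on {0..1}"
  shows "\<exists>A\<ge>0. \<forall>i n. \<bar>eigval \<alpha> \<beta> \<gamma> p i n - eigval \<alpha> \<beta> \<gamma> q i n\<bar> \<le> A"
proof -
  have "(\<lambda>x. p x - q x) absolutely_integrable_on {0..1}" by (rule set_integral_diff(1)[OF p q])
  from eigval_perturbation[OF q this, of \<alpha> \<beta> \<gamma>] obtain L where "L \<ge> 0"
    "\<And>i n t. \<bar>t\<bar> \<le> 1 \<Longrightarrow> \<bar>eigval \<alpha> \<beta> \<gamma> (\<lambda>x. q x + t * (p x - q x)) i n - eigval \<alpha> \<beta> \<gamma> q i n\<bar> \<le> L * \<bar>t\<bar>"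
    by blast
  from this(1) this(2)[of 1] show ?thesis by (intro exI[of _ L]) auto
qed

text \<open>
  Only the indices with \<open>n = 0\<close> are not controlled by \<open>n \<omega>\<^bsub>i,n\<^esub>\<close>, and there are at most two of them.
\<close>

lemma weights_summable:
  fixes \<omega> :: "nat \<Rightarrow> nat \<Rightarrow> real"
  assumes I: "I \<subseteq> {1, 2} \<times> UNIV" and \<omega>: "\<And>i n. (i, n) \<in> I \<Longrightarrow> \<omega> i n > 0"
    and s: "finite I \<or> (\<lambda>(i, n). real n * \<omega> i n) summable_on I"
  shows "(\<lambda>z. \<omega> (fst z) (snd z)) summable_on I"
  using s
proof
  assume s: "(\<lambda>(i, n). real n * \<omega> i n) summable_on I"
  define J where "J = I \<inter> {1, 2} \<times> {0}"
  have "finite J" unfolding J_def by auto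
  then have "((\<lambda>z. if z \<in> J then \<omega> (fst z) (snd z) else 0) has_sum (\<Sum>z\<in>J. \<omega> (fst z) (snd z))) I"
    by (rule has_sum_finite_neutralI) (auto simp: J_def)
  then have "(\<lambda>z. (\<lambda>(i, n). real n * \<omega> i n) z + (if z \<in> J then \<omega> (fst z) (snd z) else 0)) summable_on I"
    by (intro summable_on_add s) (auto simp: summable_on_def)
  then show ?thesis
  proof (rule summable_on_dominated)
    fix z assume z: "z \<in> I"
    obtain i n where [simp]: "z = (i, n)" by (cases z)
    have w: "\<omega> i n > 0" using \<omega> z by simp
    show "\<bar>\<omega> (fst z) (snd z)\<bar> \<le> (\<lambda>(i, n). real n * \<omega> i n) z + (if z \<in> J then \<omega> (fst z) (snd z) else 0)"
    proof (cases "n = 0")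
      case True
      then have "z \<in> J" using z I by (auto simp: J_def)
      then show ?thesis using w True by simp
    next
      case False
      then have "1 * \<omega> i n \<le> real n * \<omega> i n" using w by (intro mult_right_mono) auto
      then show ?thesis using w by simp
    qed
  qed
qed (rule summable_on_finite)

text \<open>
  The eigenvalue differences are bounded by some \<open>A\<close> and Lipschitz in \<open>t\<close> with some constant \<open>L\<close>, both
  independent of the index. The difference quotients of the terms are therefore dominated by
  \<open>\<omega>\<^bsub>i,n\<^esub> L (2 A + L)\<close>.
\<close>

lemma G_functional_derivative:
  fixes \<omega> :: "nat \<Rightarrow> nat \<Rightarrow> real"
  assumes q: "q \<in> L2" and Q: "Q \<in> L2" and h: "h \<in> L2"
    and \<omega>: "\<And>i n. (i, n) \<in> I \<Longrightarrow> \<omega> i n > 0" and s: "(\<lambda>z. \<omega> (fst z) (snd z)) summable_on I"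
  shows "has_dir_derivative (G_functional \<alpha> \<beta> \<gamma> I \<omega> Q) q h
     (infsum (\<lambda>(i, n). 2 * \<omega> i n * (eigval \<alpha> \<beta> \<gamma> q i n - eigval \<alpha> \<beta> \<gamma> Q i n)
        * eig_gradient q \<alpha> (eigval \<alpha> \<beta> \<gamma> q i n) h) I)"
    (is "has_dir_derivative _ _ _ (infsum ?D I)")
proof -
  note qa = L2_absolutely_integrable[OF q] and ha = L2_absolutely_integrable[OF h]
  define e where "e = (\<lambda>t i n. eigval \<alpha> \<beta> \<gamma> (\<lambda>x. q x + t * h x) i n)"
  define e0 where "e0 = (\<lambda>i n. eigval \<alpha> \<beta> \<gamma> Q i n)"
  have eq: "eigval \<alpha> \<beta> \<gamma> q i n = e 0 i n" for i n by (simp add: e_def)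
  obtain L where L: "L \<ge> 0"
    "\<And>i n. ((\<lambda>t. e t i n) has_real_derivative eig_gradient q \<alpha> (e 0 i n) h) (at 0)"
    "\<And>i n t. \<bar>t\<bar> \<le> 1 \<Longrightarrow> \<bar>e t i n - e 0 i n\<bar> \<le> L * \<bar>t\<bar>"
    using eigval_perturbation[OF qa ha, of \<alpha> \<beta> \<gamma>] unfolding eq unfolding e_def by blast
  obtain A where A: "A \<ge> 0" "\<And>i n. \<bar>e 0 i n - e0 i n\<bar> \<le> A"
    using eigval_difference_bounded[OF qa L2_absolutely_integrable[OF Q], of \<alpha> \<beta> \<gamma>]
    unfolding eq e0_def[symmetric] by blast
  define f where "f = (\<lambda>z t. \<omega> (fst z) (snd z) * (e t (fst z) (snd z) - e0 (fst z) (snd z))\<^sup>2)"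
  have "((\<lambda>t. infsum (\<lambda>z. f z t) I) has_real_derivative infsum ?D I) (at 0)"
  proof (rule has_real_derivative_infsum)
    fix z assume "z \<in> I"
    obtain i n where z: "z = (i, n)" by (cases z)
    then have w: "\<omega> i n > 0" using \<open>z \<in> I\<close> \<omega> by simp
    show "(f z has_real_derivative ?D z) (at 0)"
      unfolding f_def z e0_def[symmetric] eq
      by (rule derivative_eq_intros L(2) refl | simp)+
    show "\<bar>f z t - f z 0\<bar> \<le> \<omega> (fst z) (snd z) * (L * (2 * A + L)) * \<bar>t\<bar>" if t: "\<bar>t\<bar> < 1" for t
    proof -
      define d where "d = e t i n - e 0 i n"
      define a where "a = e 0 i n - e0 i n"
      have d: "\<bar>d\<bar> \<le> L * \<bar>t\<bar>" using L(3)[of t i n] t by (simp add: d_def)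
      also have "L * \<bar>t\<bar> \<le> L * 1" using L(1) t by (intro mult_left_mono) auto
      finally have "\<bar>2 * a + d\<bar> \<le> 2 * A + L" using A(2)[of i n] by (simp add: a_def)
      then have "\<bar>d\<bar> * \<bar>2 * a + d\<bar> \<le> (L * \<bar>t\<bar>) * (2 * A + L)" using d L(1) by (intro mult_mono) auto
      moreover have "f z t - f z 0 = \<omega> i n * (d * (2 * a + d))"
        by (simp add: f_def z d_def a_def power2_eq_square algebra_simps)
      ultimately have "\<bar>f z t - f z 0\<bar> \<le> \<omega> i n * ((L * \<bar>t\<bar>) * (2 * A + L))"
        using w by (simp add: abs_mult)
      then show ?thesis by (simp add: z mult_ac)
    qed
  next
    show "(\<lambda>z. \<omega> (fst z) (snd z) * (L * (2 * A + L))) summable_on I" by (rule summable_on_cmult_left[OF s])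
    show "(\<lambda>z. f z 0) summable_on I"
    proof (rule summable_on_dominated[OF summable_on_cmult_left[OF s, of "A\<^sup>2"]])
      fix z assume "z \<in> I"
      then have "\<omega> (fst z) (snd z) > 0" using \<omega>[of "fst z" "snd z"] by simp
      moreover have "(e 0 (fst z) (snd z) - e0 (fst z) (snd z))\<^sup>2 \<le> A\<^sup>2"
        using A by (simp add: abs_le_square_iff[symmetric])
      ultimately show "\<bar>f z 0\<bar> \<le> \<omega> (fst z) (snd z) * A\<^sup>2" by (simp add: f_def abs_mult)
    qed
  qed
  then show ?thesis
    unfolding has_dir_derivative_def G_functional_def f_def e_def e0_def by (simp add: case_prod_beta')
qed

lemma G_functional_critical_iff:
  fixes \<omega> :: "nat \<Rightarrow> nat \<Rightarrow> real"
  assumes sin: "sin (\<beta> - \<gamma>) \<noteq> 0" and I: "I \<subseteq> {1, 2} \<times> UNIV" and q: "q \<in> L2" and Q: "Q \<in> L2"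
    and \<omega>: "\<And>i n. (i, n) \<in> I \<Longrightarrow> \<omega> i n > 0" and s: "(\<lambda>z. \<omega> (fst z) (snd z)) summable_on I"
  shows "(\<forall>h\<in>H1. has_dir_derivative (G_functional \<alpha> \<beta> \<gamma> I \<omega> Q) q h 0) \<longleftrightarrow> G_functional \<alpha> \<beta> \<gamma> I \<omega> Q q = 0"
proof -
  define d where "d = (\<lambda>z. eigval \<alpha> \<beta> \<gamma> q (fst z) (snd z) - eigval \<alpha> \<beta> \<gamma> Q (fst z) (snd z))"
  define c where "c = (\<lambda>z. 2 * \<omega> (fst z) (snd z) * d z)"
  define ev where "ev = (\<lambda>z. eigval \<alpha> \<beta> \<gamma> q (fst z) (snd z))"
  define D where "D = (\<lambda>h. infsum (\<lambda>z. c z * eig_gradient q \<alpha> (ev z) h) I)"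
  obtain A where A: "A \<ge> 0" "\<And>z. \<bar>d z\<bar> \<le> A"
    using eigval_difference_bounded[OF L2_absolutely_integrable[OF q] L2_absolutely_integrable[OF Q], of \<alpha> \<beta> \<gamma>]
    unfolding d_def by blast
  have pos: "\<omega> (fst z) (snd z) > 0" if "z \<in> I" for z using \<omega>[of "fst z" "snd z"] that by simp
  have der: "has_dir_derivative (G_functional \<alpha> \<beta> \<gamma> I \<omega> Q) q h (D h)" if "h \<in> H1" for h
  proof -
    have "h \<in> L2" using that by (simp add: H1_def)
    from G_functional_derivative[OF q Q this \<omega> s, where \<alpha> = \<alpha> and \<beta> = \<beta> and \<gamma> = \<gamma>]
    show ?thesis by (simp add: D_def c_def d_def ev_def case_prod_beta')
  qed
  have Gsum: "G_functional \<alpha> \<beta> \<gamma> I \<omega> Q q = infsum (\<lambda>z. \<omega> (fst z) (snd z) * (d z)\<^sup>2) I"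
    by (simp add: G_functional_def d_def case_prod_beta')
  have sm: "(\<lambda>z. \<omega> (fst z) (snd z) * (d z)\<^sup>2) summable_on I"
  proof (rule summable_on_dominated[OF summable_on_cmult_left[OF s, of "A\<^sup>2"]])
    fix z assume "z \<in> I"
    moreover have "(d z)\<^sup>2 \<le> A\<^sup>2" using A by (simp add: abs_le_square_iff[symmetric])
    ultimately show "\<bar>\<omega> (fst z) (snd z) * (d z)\<^sup>2\<bar> \<le> \<omega> (fst z) (snd z) * A\<^sup>2"
      using pos[of z] by (simp add: abs_mult)
  qed
  show ?thesis
  proof
    assume crit: "\<forall>h\<in>H1. has_dir_derivative (G_functional \<alpha> \<beta> \<gamma> I \<omega> Q) q h 0"
    have D0: "D h = 0" if "h \<in> H1" for h
      using crit der[OF that] that unfolding has_dir_derivative_def by (meson DERIV_unique)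
    have "c z = 0" if z: "z \<in> I" for z
    proof (rule gradients_independent[OF q sin I _ _ _ _ z])
      show "ev (i, n) = SL_eigenvalue q \<alpha> (if i = 1 then \<beta> else \<gamma>) n" for i n
        by (simp add: ev_def eigval_def)
      show "(\<lambda>z. \<omega> (fst z) (snd z) * (2 * A)) summable_on I" by (rule summable_on_cmult_left[OF s])
      show "\<bar>c z\<bar> \<le> \<omega> (fst z) (snd z) * (2 * A)" if "z \<in> I" for z
        using mult_left_mono[OF A(2), of "2 * \<omega> (fst z) (snd z)" z] pos[OF that] by (simp add: c_def abs_mult)
      show "infsum (\<lambda>z. c z * eig_gradient q \<alpha> (ev z) h) I = 0" if "h \<in> H1" for h
        using D0[OF that] by (simp add: D_def)
    qed
    then have "d z = 0" if "z \<in> I" for z using pos[OF that] that unfolding c_def by fastforce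
    then show "G_functional \<alpha> \<beta> \<gamma> I \<omega> Q q = 0" unfolding Gsum by (intro infsum_0) simp
  next
    assume G0: "G_functional \<alpha> \<beta> \<gamma> I \<omega> Q q = 0"
    have "d z = 0" if z: "z \<in> I" for z
    proof -
      have "\<omega> (fst z) (snd z) * (d z)\<^sup>2 = 0"
        by (rule nonneg_infsum_le_0D[OF _ sm _ z]) (use G0 pos in \<open>auto simp: Gsum less_imp_le\<close>)
      then show ?thesis using pos[OF z] by simp
    qed
    then have "D h = 0" for h unfolding D_def by (intro infsum_0) (simp add: c_def)
    then show "\<forall>h\<in>H1. has_dir_derivative (G_functional \<alpha> \<beta> \<gamma> I \<omega> Q) q h 0" using der by metis
  qed
qed

lemma L2_local_min_imp_critical:
  assumes min: "L2_local_min F q" and h: "h \<in> L2" and d: "has_dir_derivative F q h D"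
  shows "D = 0"
proof -
  obtain \<epsilon> where \<epsilon>: "\<epsilon> > 0" "\<And>p. p \<in> L2 \<Longrightarrow> L2_dist p q < \<epsilon> \<Longrightarrow> F q \<le> F p" and q: "q \<in> L2"
    using min by (auto simp: L2_local_min_def)
  define N where "N = sqrt (LINT x|leb01. (h x)\<^sup>2)"
  have N: "N \<ge> 0" by (simp add: N_def)
  have dist: "L2_dist (\<lambda>x. q x + t * h x) q = \<bar>t\<bar> * N" for t
    by (simp add: L2_dist_def N_def power_mult_distrib real_sqrt_mult)
  have "\<forall>t. \<bar>0 - t\<bar> < \<epsilon> / (N + 1) \<longrightarrow> F (\<lambda>x. q x + 0 * h x) \<le> F (\<lambda>x. q x + t * h x)"
  proof (intro allI impI)
    fix t assume "\<bar>0 - t\<bar> < \<epsilon> / (N + 1)"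
    then have "\<bar>t\<bar> * (N + 1) < \<epsilon>" using N by (simp add: pos_less_divide_eq)
    moreover have "\<bar>t\<bar> * N \<le> \<bar>t\<bar> * (N + 1)" by (intro mult_left_mono) auto
    ultimately have "L2_dist (\<lambda>x. q x + t * h x) q < \<epsilon>" unfolding dist by linarith
    then have "F q \<le> F (\<lambda>x. q x + t * h x)" by (rule \<epsilon>(2)[OF L2_add_scaled[OF q h]])
    then show "F (\<lambda>x. q x + 0 * h x) \<le> F (\<lambda>x. q x + t * h x)" by simp
  qed
  moreover have "\<epsilon> / (N + 1) > 0" using \<epsilon>(1) N by simp
  ultimately show ?thesis using DERIV_local_min[OF d[unfolded has_dir_derivative_def]] by blast
qed

theorem theorem2p2:
  fixes \<alpha> \<beta> \<gamma> :: real
    and I :: "(nat \<times> nat) set"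
    and \<omega> :: "nat \<Rightarrow> nat \<Rightarrow> real"
    and Q :: "real \<Rightarrow> real"
  defines "G \<equiv> G_functional \<alpha> \<beta> \<gamma> I \<omega> Q"
  assumes "sin (\<beta> - \<gamma>) \<noteq> 0"
    and "I \<subseteq> {1, 2} \<times> UNIV"
    and "Q \<in> L2"
    and "\<And>i n. (i, n) \<in> I \<Longrightarrow> \<omega> i n > 0"
    and "finite I \<or> (\<lambda>(i, n). real n * \<omega> i n) summable_on I"
  shows "(\<forall>q\<in>L2. G q > 0 \<longrightarrow> \<not> L2_local_min G q) \<and>
         (\<forall>q\<in>L2. (\<forall>h\<in>H1. has_dir_derivative G q h 0) \<longleftrightarrow> G q = 0)"
proof -
  note s = weights_summable[OF assms(3,5,6)]
  have critical: "(\<forall>h\<in>H1. has_dir_derivative G q h 0) \<longleftrightarrow> G q = 0" if "q \<in> L2" for q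
    unfolding G_def by (rule G_functional_critical_iff[OF assms(2,3) that assms(4,5) s])
  have "\<not> L2_local_min G q" if q: "q \<in> L2" and pos: "G q > 0" for q
  proof
    assume min: "L2_local_min G q"
    have "has_dir_derivative G q h 0" if "h \<in> H1" for h
    proof -
      have h: "h \<in> L2" using that by (simp add: H1_def)
      have "\<exists>D. has_dir_derivative G q h D"
        unfolding G_def using G_functional_derivative[OF q assms(4) h assms(5) s] by blast
      then show ?thesis using L2_local_min_imp_critical[OF min h] by blast
    qed
    then show False using critical[OF q] pos by simp
  qed
  then show ?thesis using critical by blast
qed

end
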